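(* Let $n\ge 2$, let $v$ be a weight in $\mathbb R^n$ and let $p\ge 1$ ($p<\infty$). The following facts are equivalent: (a) The functional $\|\cdot\|_{\Lambda^p_{Sp}(v)}$ is a norm. (b) For all measurable $A,B\subset\mathbb R^n$, $V((A\cup B)^* )+V((A\cap B)^* )\le V(A^* )+V(B^* )$. (c) The weight $$\bar v(s):=\int_{\Sigma_{n-1}} v\bigl((s/\sigma_n)^{1/n}\theta_{n-1}\bigr)\,d\theta_{n-1},\qquad s\in\mathbb R^+,$$ is a decreasing function. (d) For all measurable functions $f$ in $\mathbb R^n$, the equality $$\sup_{h}\int_{\mathbb R^n}|f(x)h(x)|\,dx=\int_{\mathbb R^n} f^*_{Sp}(x)\,\bar v(\sigma_n|x|^n)\,dx$$ holds, where the supremum is over all measurable $h$ on $\mathbb R^n$ with $h^*_{Sp}=\bar v$, i.e. $h^*_{Sp}(x)=\bar v(\sigma_n|x|^n)$ for a.e. $x$.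
   Context: $\sigma_n$ is the volume of the unit ball of $\mathbb R^n$, $\Sigma_{n-1}$ is the unit sphere of $\mathbb R^n$ with surface measure $d\theta_{n-1}$, $\mathbb R^+=(0,\infty)$, $|A|$ is Lebesgue measure. The spherical symmetrization of a measurable set $A\subset\mathbb R^n$ is $A^*=B(0,(\sigma_n^{-1}|A|)^{1/n})$ (open ball centred at $0$; empty if $|A|=0$, $\mathbb R^n$ if $|A|=\infty$). For measurable $f$ on $\mathbb R^n$, $f^*_{Sp}(x)=\int_0^\infty\chi_{\{|f|>s\}^*}(x)\,ds$. A weight in $\mathbb R^n$ is a non-negative locally integrable function $v$ such that $|A|>0$ implies $\int_{A^*}v\,dx>0$. $V(E)=\int_E v(x)\,dx$. The space $\Lambda^p_{Sp}(v)$ consists of the measurable $f$ (modulo a.e. equality) for which $\|f\|_{\Lambda^p_{Sp}(v)}=\bigl(\int_{\mathbb R^n}(f^*_{Sp}(x))^p v(x)\,dx\bigr)^{1/p}$ is finite. "Decreasing" means non-increasing, up to modification on a null set. *)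

theory Defs
  imports "HOL-Analysis.Analysis"
begin

definition ball_vol :: "'a::euclidean_space itself \<Rightarrow> real" where
  "ball_vol _ = measure lebesgue (ball (0::'a) 1)"

text \<open>
  The surface measure of the unit sphere is the cone measure: a Borel set \<open>E\<close> of the sphere gets
  \<open>n\<close> times the volume of the cone of all \<open>r *\<^sub>R \<theta>\<close> with \<open>0 < r < 1\<close> and \<open>\<theta> \<in> E\<close>.  The factor \<open>n\<close>
  is the normalisation for which \<open>dx = r\<^sup>n\<^sup>-\<^sup>1 dr d\<theta>\<close> holds in polar coordinates.
  It is completed because a Lebesgue measurable function restricts to almost every sphere centred
  at the origin as a function that is measurable only for the completion.
\<close>

definition sphere_borel_measure :: "'a::euclidean_space measure" where
  "sphere_borel_measure =
     scale_measure (of_nat DIM('a))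
       (distr (restrict_space lborel (ball 0 1 - {0})) (restrict_space borel (sphere 0 1)) sgn)"

definition sphere_measure :: "'a::euclidean_space measure" where
  "sphere_measure = completion sphere_borel_measure"

lemma emeasure_sphere_borel_measure:
  fixes E :: "'a::euclidean_space set"
  assumes "E \<in> sets borel" "E \<subseteq> sphere 0 1"
  shows "emeasure sphere_borel_measure E =
           of_nat DIM('a) * emeasure lborel {x \<in> ball 0 1 - {0}. sgn x \<in> E}"
proof -
  have "sgn \<in> borel_measurable (borel :: 'a measure)"
    unfolding sgn_div_norm[abs_def] by measurable
  then have m: "sgn \<in> measurable (restrict_space lborel (ball (0::'a) 1 - {0}))
                             (restrict_space borel (sphere 0 1))"
    by (intro measurable_restrict_space3) (auto simp: norm_sgn)
  have "E \<in> sets (restrict_space borel (sphere 0 1))"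
    using assms by (auto simp: sets_restrict_space)
  then show ?thesis
    using m
    by (simp add: sphere_borel_measure_def emeasure_distr emeasure_restrict_space
        space_restrict_space vimage_def Int_def conj_commute subset_iff)
qed

definition spherical_symm :: "'a::euclidean_space set \<Rightarrow> 'a set" where
  "spherical_symm A =
     (if emeasure lebesgue A = \<infinity> then UNIV
      else ball 0 (root DIM('a) (measure lebesgue A / ball_vol TYPE('a))))"

definition spherical_rearr :: "('a::euclidean_space \<Rightarrow> real) \<Rightarrow> 'a \<Rightarrow> ennreal" where
  "spherical_rearr f x =
     (\<integral>\<^sup>+s\<in>{0<..}. indicator (spherical_symm {y. \<bar>f y\<bar> > s}) x \<partial>lebesgue)"

definition weighted_vol :: "('a::euclidean_space \<Rightarrow> real) \<Rightarrow> 'a set \<Rightarrow> ennreal" where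
  "weighted_vol v E = (\<integral>\<^sup>+x\<in>E. ennreal (v x) \<partial>lebesgue)"

definition weight :: "('a::euclidean_space \<Rightarrow> real) \<Rightarrow> bool" where
  "weight v \<longleftrightarrow>
     (\<forall>x. 0 \<le> v x) \<and>
     (\<forall>K. compact K \<longrightarrow> set_integrable lebesgue K v) \<and>
     (\<forall>A\<in>sets lebesgue. emeasure lebesgue A > 0 \<longrightarrow> weighted_vol v (spherical_symm A) > 0)"

definition sphere_weight :: "('a::euclidean_space \<Rightarrow> real) \<Rightarrow> real \<Rightarrow> ennreal" where
  "sphere_weight v s =
     (\<integral>\<^sup>+\<theta>. ennreal (v (root DIM('a) (s / ball_vol TYPE('a)) *\<^sub>R \<theta>)) \<partial>sphere_measure)"

definition ae_decreasing :: "(real \<Rightarrow> ennreal) \<Rightarrow> bool" where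
  "ae_decreasing w \<longleftrightarrow>
     (\<exists>w'. antimono_on {0<..} w' \<and> (AE s in lebesgue. s > 0 \<longrightarrow> w s = w' s))"

text \<open>Real powers on \<open>[0, \<infinity>]\<close>; used only for positive exponents, where \<open>\<infinity>\<close> is sent to \<open>\<infinity>\<close>.\<close>

definition ennpowr :: "ennreal \<Rightarrow> real \<Rightarrow> ennreal" where
  "ennpowr x a = (if x = \<infinity> then \<infinity> else ennreal (enn2real x powr a))"

definition Lambda_fun :: "real \<Rightarrow> ('a::euclidean_space \<Rightarrow> real) \<Rightarrow> ('a \<Rightarrow> real) \<Rightarrow> ennreal" where
  "Lambda_fun p v f =
     ennpowr (\<integral>\<^sup>+x. ennpowr (spherical_rearr f x) p * ennreal (v x) \<partial>lebesgue) (1 / p)"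

definition Lambda_space :: "real \<Rightarrow> ('a::euclidean_space \<Rightarrow> real) \<Rightarrow> ('a \<Rightarrow> real) set" where
  "Lambda_space p v = {f \<in> borel_measurable lebesgue. Lambda_fun p v f < \<infinity>}"

text \<open>
  \<open>N\<close> is a norm on the classes modulo \<open>M\<close>-a.e. equality of functions in \<open>S\<close>: the first clause says
  that \<open>S\<close> and \<open>N\<close> pass to classes, the next ones that the classes form a vector space and that
  \<open>N\<close> is a norm on it.
\<close>

definition norm_mod_AE :: "'b measure \<Rightarrow> ('b \<Rightarrow> real) set \<Rightarrow> (('b \<Rightarrow> real) \<Rightarrow> real) \<Rightarrow> bool" where
  "norm_mod_AE M S N \<longleftrightarrow>
     (\<forall>f\<in>S. \<forall>g\<in>borel_measurable M. (AE x in M. f x = g x) \<longrightarrow> g \<in> S \<and> N g = N f) \<and>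
     (\<lambda>_. 0) \<in> S \<and>
     (\<forall>f\<in>S. \<forall>g\<in>S. (\<lambda>x. f x + g x) \<in> S \<and> N (\<lambda>x. f x + g x) \<le> N f + N g) \<and>
     (\<forall>c. \<forall>f\<in>S. (\<lambda>x. c * f x) \<in> S \<and> N (\<lambda>x. c * f x) = \<bar>c\<bar> * N f) \<and>
     (\<forall>f\<in>S. 0 \<le> N f \<and> (N f = 0 \<longleftrightarrow> (AE x in M. f x = 0)))"

end

theory Submission
  imports Defs "HOL-Real_Asymp.Real_Asymp"
begin

text \<open>
  Let \<open>n\<close> be the dimension, \<open>\<sigma>\<close> the volume of the unit ball and \<open>\<kappa> = 1 / (n \<sigma>)\<close>.  Everything is
  read off from the coordinate \<open>\<sigma> |x|\<^sup>n\<close>, the volume of the centred ball with \<open>x\<close> on its boundary.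
  It carries Lebesgue measure to Lebesgue measure on \<open>(0, \<infinity>)\<close>, and \<open>x\<close> lies in the symmetrization
  of \<open>A\<close> iff its coordinate is below \<open>|A|\<close>.  So the spherical rearrangement of \<open>f\<close> is the ordinary
  decreasing rearrangement \<open>f\<^sup>*\<close> evaluated at this coordinate, and polar coordinates
  (\<open>weight_profile\<close>) turn \<open>v\<close> into a weight \<open>u\<close> on \<open>(0, \<infinity>)\<close>, equal to the spherical weight almost
  everywhere.  With \<open>\<Phi>(m) = \<integral>\<^sub>0\<^sup>m u\<close> the symmetrization of \<open>A\<close> has weighted volume \<open>\<kappa> \<Phi>(|A|)\<close>, and
  by Tonelli the \<open>p\<close>-th power of the Lorentz functional is \<open>\<kappa>\<close> times the Choquet integral
  \<open>C(|f|\<^sup>p) = \<integral>\<^sub>0\<^sup>\<infinity> \<Phi>(|{|f|\<^sup>p > s}|) ds\<close>.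

  The norm gives submodularity: the triangle inequality for \<open>1 + \<delta>\<close> on \<open>A\<close> and \<open>1\<close> on \<open>B - A\<close>, and
  the same function with \<open>A\<close> and \<open>B\<close> exchanged, becomes the submodular inequality to first order in \<open>\<delta>\<close>
  (\<open>submodular_if_norm\<close>).

  Submodularity gives monotonicity: applied to balls and shells it says that
  \<open>\<Phi>(x + h) - \<Phi>(x)\<close> decreases in \<open>x\<close>.  The dyadic difference quotients of \<open>\<Phi>\<close> are then decreasing in
  \<open>x\<close> and increase to a limit with the same integrals as \<open>u\<close>
  (\<open>ae_decreasing_if_submodular\<close>).

  Monotonicity gives the norm: a decreasing profile is a superposition of indicators of intervals
  \<open>(0, \<tau>)\<close>, so \<open>C(f)\<close> is a superposition of \<open>\<integral>\<^sub>0\<^sup>\<tau> f\<^sup>*\<close>, which is the infimum over \<open>c \<ge> 0\<close> of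
  \<open>c \<tau> + \<integral> (|f| - c)\<^sup>+\<close> and hence subadditive (\<open>truncated_mass_subadditive\<close>).  Convexity of the
  \<open>p\<close>-th power passes from \<open>C\<close> to the Lorentz functional (\<open>power_mean_triangle\<close>).

  Monotonicity gives duality: the upper bound is the Hardy-Littlewood inequality.  For the lower
  bound, \<open>|f|\<close> is approximated from below by functions \<open>F\<close> with bounded support and values in a
  lattice, and a small radially decreasing term is added to break the ties of \<open>F\<close>.  The volume of
  the points ranked above \<open>x\<close> is then a measure-preserving map \<open>\<rho>\<close> onto \<open>(0, \<infinity>)\<close>, and \<open>u \<circ> \<rho>\<close> is
  equimeasurable with \<open>u\<close> and ordered like \<open>F\<close> (\<open>comonotone_partner\<close>), so that its pairing with
  \<open>F\<close> attains the bound.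

  Conversely, duality for the unit ball has a positive right-hand side, so some \<open>h\<close> competes in the
  supremum; then the spherical weight is almost everywhere the rearrangement of
  \<open>h\<close>, which decreases.
\<close>

section \<open>Down-closed sets of positive reals\<close>

text \<open>
  Superlevel sets of decreasing functions on \<open>(0, \<infinity>)\<close> have this shape.  The endpoint may or may
  not belong to them, as a decreasing function need not be continuous from either side.
\<close>

lemma downset_cases:
  fixes D :: "real set"
  assumes sub: "D \<subseteq> {0<..}" and down: "\<And>r s. s \<in> D \<Longrightarrow> 0 < r \<Longrightarrow> r \<le> s \<Longrightarrow> r \<in> D"
  obtains "D = {0<..}" | a where "0 \<le> a" "{0<..<a} \<subseteq> D" "D \<subseteq> {0<..a}"
proof (cases "bdd_above D")
  case False
  have "x \<in> D" if "0 < x" for x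
  proof -
    obtain s where "s \<in> D" "x < s" using False unfolding bdd_above_def by (meson not_le)
    then show ?thesis using down that by force
  qed
  then show thesis using that(1) sub by auto
next
  case True
  show thesis
  proof (cases "D = {}")
    case True then show thesis using that(2)[of 0] by auto
  next
    case False
    have 1: "D \<subseteq> {0<..Sup D}" using sub True cSup_upper by fastforce
    have 2: "{0<..<Sup D} \<subseteq> D"
    proof
      fix x assume x: "x \<in> {0<..<Sup D}"
      then obtain s where "s \<in> D" "x < s" using less_cSup_iff[OF False True] by auto
      then show "x \<in> D" using down x by force
    qed
    have "0 \<le> Sup D" using 1 False by fastforce
    then show thesis using that(2) 1 2 by blast
  qed
qed

lemma downset_borel:
  fixes D :: "real set"
  assumes sub: "D \<subseteq> {0<..}" and down: "\<And>r s. s \<in> D \<Longrightarrow> 0 < r \<Longrightarrow> r \<le> s \<Longrightarrow> r \<in> D"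
  shows "D \<in> sets borel"
proof -
  have "is_interval D" unfolding is_interval_1 using sub down
    by (metis greaterThan_iff less_le_trans subsetD)
  then show ?thesis by (simp add: is_interval_convex real_interval_borel_measurable)
qed

lemma ennreal_top_eqI:
  fixes x :: ennreal
  assumes "\<And>r. 0 \<le> r \<Longrightarrow> ennreal r \<le> x"
  shows "x = top"
proof (rule ccontr)
  assume "x \<noteq> top"
  then obtain q where "0 \<le> q" "x = ennreal q" by (cases x) auto
  then show False using assms[of "q + 1"] by simp
qed

text \<open>
  Every extended nonnegative number is the length of an interval; this is the source of all layer
  cake formulas below.
\<close>

lemma emeasure_positive_below: "emeasure lborel {s::real. 0 < s \<and> ennreal s < m} = m"
proof (cases m)
  case (real r)
  then have "{s::real. 0 < s \<and> ennreal s < m} = {0<..<r}"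
    by (auto simp: ennreal_less_iff)
  then show ?thesis using real by simp
next
  case top
  then have "{s::real. 0 < s \<and> ennreal s < m} = {0<..}" by auto
  moreover have "emeasure lborel {0::real<..} = top"
  proof (rule ennreal_top_eqI)
    fix r :: real assume "0 \<le> r"
    then show "ennreal r \<le> emeasure lborel {0::real<..}"
      using emeasure_mono[of "{0<..<r}" "{0<..}" lborel] by (auto simp: subset_eq)
  qed
  ultimately show ?thesis using top by simp
qed

lemma emeasure_between:
  assumes "{0<..<a} \<subseteq> E" "E \<subseteq> {0<..a}" "E \<in> sets borel" "0 \<le> a"
  shows "emeasure lborel E = ennreal a"
proof (rule antisym)
  show "emeasure lborel E \<le> ennreal a" using emeasure_mono[OF assms(2), of lborel] assms by simp
  show "ennreal a \<le> emeasure lborel E" using emeasure_mono[OF assms(1), of lborel] assms by simp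
qed

text \<open>
  Intervals starting at \<open>0\<close> are nested, so the length of their intersection is the smaller length.
\<close>

lemma emeasure_downset_below:
  fixes D :: "real set"
  assumes sub: "D \<subseteq> {0<..}" and down: "\<And>r s. s \<in> D \<Longrightarrow> 0 < r \<Longrightarrow> r \<le> s \<Longrightarrow> r \<in> D"
  shows "emeasure lborel {s \<in> D. ennreal s < m} = min (emeasure lborel D) m"
proof -
  consider (all) "D = {0<..}" | (bdd) a where "0 \<le> a" "{0<..<a} \<subseteq> D" "D \<subseteq> {0<..a}"
    by (rule downset_cases[OF sub down])
  then show ?thesis
  proof cases
    case all
    have "{s \<in> D. ennreal s < m} = {s. 0 < s \<and> ennreal s < m}" unfolding all by auto
    moreover have "D = {s. 0 < s \<and> ennreal s < top}" using all by auto
    ultimately show ?thesis using emeasure_positive_below[of top] by (simp add: emeasure_positive_below)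
  next
    case (bdd a)
    have D: "D \<in> sets borel" by (rule downset_borel[OF sub down])
    have eD: "emeasure lborel D = ennreal a" using bdd D by (intro emeasure_between)
    show ?thesis
    proof (cases "ennreal a \<le> m")
      case True
      have "emeasure lborel {s \<in> D. ennreal s < m} = ennreal a"
      proof (rule emeasure_between)
        show "{0<..<a} \<subseteq> {s \<in> D. ennreal s < m}"
          using bdd True by (auto simp: ennreal_less_iff intro!: less_le_trans[OF _ True])
        show "{s \<in> D. ennreal s < m} \<subseteq> {0<..a}" using bdd by auto
        show "{s \<in> D. ennreal s < m} \<in> sets borel" using D by measurable
      qed (rule bdd)
      then show ?thesis using eD True by (simp add: min_def)
    next
      case False
      have mem: "s \<in> D" if "0 < s" "ennreal s < m" for s
      proof -
        have "ennreal s < ennreal a" using that False by simp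
        then have "s < a" using that bdd by (simp add: ennreal_less_iff)
        then show ?thesis using bdd that by auto
      qed
      have "{s \<in> D. ennreal s < m} = {s. 0 < s \<and> ennreal s < m}"
        using mem sub by blast
      then show ?thesis using eD False by (simp add: emeasure_positive_below min_def)
    qed
  qed
qed

lemma sigma_finite_lebesgue: "sigma_finite_measure (lebesgue :: 'a::euclidean_space measure)"
proof
  obtain A :: "nat \<Rightarrow> 'a set" where A: "range A \<subseteq> sets lborel" "(\<Union>i. A i) = space lborel" "\<And>i. emeasure lborel (A i) \<noteq> \<infinity>"
    using lborel.sigma_finite by blast
  then show "\<exists>A. countable A \<and> A \<subseteq> sets (lebesgue :: 'a measure) \<and> \<Union> A = space lebesgue \<and> (\<forall>a\<in>A. emeasure lebesgue a \<noteq> \<infinity>)"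
    by (intro exI[of _ "range A"]) (auto simp: subset_eq)
qed

section \<open>Rearrangements as functions of the volume\<close>

definition distribution :: "('a::euclidean_space \<Rightarrow> real) \<Rightarrow> real \<Rightarrow> ennreal" where
  "distribution f s = emeasure lebesgue {x. s < \<bar>f x\<bar>}"

text \<open>
  The decreasing rearrangement, written as the length of the interval of levels \<open>s\<close> whose
  superlevel set is larger than \<open>t\<close> instead of as an infimum, which suits Tonelli's theorem.
\<close>

definition rearr :: "('a::euclidean_space \<Rightarrow> real) \<Rightarrow> real \<Rightarrow> ennreal" where
  "rearr f t = emeasure lborel {s. 0 < s \<and> ennreal t < distribution f s}"

lemma level_measurable [measurable]:
  fixes f :: "'a::euclidean_space \<Rightarrow> real"
  assumes [measurable]: "f \<in> borel_measurable lebesgue"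
  shows "{x. s < \<bar>f x\<bar>} \<in> sets lebesgue" "{x. s < f x} \<in> sets lebesgue"
proof -
  have "(\<lambda>x. \<bar>f x\<bar>) \<in> borel_measurable lebesgue" by (rule borel_measurable_abs[OF assms])
  then have "{x \<in> space lebesgue. s < \<bar>f x\<bar>} \<in> sets lebesgue" "{x \<in> space lebesgue. s < f x} \<in> sets lebesgue"
    using assms by (simp_all only: borel_measurable_iff_greater)
  then show "{x. s < \<bar>f x\<bar>} \<in> sets lebesgue"  "{x. s < f x} \<in> sets lebesgue" by auto
qed

lemma distribution_antimono:
  assumes [measurable]: "f \<in> borel_measurable lebesgue" and "s \<le> t"
  shows "distribution f t \<le> distribution f s"
  unfolding distribution_def using assms by (intro emeasure_mono) auto

lemma antimono_borel_measurable:
  fixes f :: "real \<Rightarrow> ennreal"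
  assumes "\<And>s t. s \<le> t \<Longrightarrow> f t \<le> f s"
  shows "f \<in> borel_measurable borel"
proof (rule borel_measurableI_greater)
  fix a
  have "is_interval {x. a < f x}"
    unfolding is_interval_1 using assms by (auto intro: less_le_trans)
  then show "{x \<in> space borel. a < f x} \<in> sets borel"
    by (simp add: is_interval_convex real_interval_borel_measurable)
qed

lemma antimono_on_borel_measurable:
  fixes f :: "real \<Rightarrow> ennreal"
  assumes "antimono_on {0<..} f"
  shows "(\<lambda>x. f x * indicator {0<..} x) \<in> borel_measurable borel"
proof -
  have *: "{x \<in> space borel. a < f x * indicator {0<..} x} \<in> sets borel" for a
  proof -
    have "{x \<in> space borel. a < f x * indicator {0<..} x} = {x. 0 < x \<and> a < f x}"
      by (auto simp: indicator_def split: if_splits)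
    also have "\<dots> \<in> sets borel"
      by (rule downset_borel) (auto intro: less_le_trans monotone_onD[OF assms])
    finally show ?thesis .
  qed
  show ?thesis by (rule borel_measurableI_greater) (use * in blast)
qed

lemma distribution_measurable [measurable]:
  "f \<in> borel_measurable lebesgue \<Longrightarrow> distribution f \<in> borel_measurable borel"
  by (rule antimono_borel_measurable) (rule distribution_antimono)

lemma rearr_antimono:
  assumes [measurable]: "f \<in> borel_measurable lebesgue"
  shows "antimono (rearr f)"
  unfolding rearr_def
  by (intro antimonoI emeasure_mono) (auto intro: le_less_trans ennreal_leI)

lemma rearr_measurable [measurable]:
  "f \<in> borel_measurable lebesgue \<Longrightarrow> rearr f \<in> borel_measurable borel"
  using antimonoD[OF rearr_antimono] by (rule antimono_borel_measurable)

text \<open>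
  The volume of the centred ball with \<open>x\<close> on its boundary.
\<close>

definition vol_coord :: "'a::euclidean_space \<Rightarrow> real" where
  "vol_coord x = ball_vol TYPE('a) * norm x ^ DIM('a)"

lemma ball_vol_pos: "0 < ball_vol TYPE('a::euclidean_space)"
  by (simp add: ball_vol_def content_ball)

lemma emeasure_ball0: "0 \<le> r \<Longrightarrow> emeasure lborel (ball (0::'a::euclidean_space) r) = ennreal (ball_vol TYPE('a) * r ^ DIM('a))"
  by (simp add: ball_vol_def content_ball emeasure_ball)

lemma vol_coord_nonneg [simp]: "0 \<le> vol_coord x"
  using ball_vol_pos[where 'a='a] by (auto simp: vol_coord_def)

lemma vol_coord_less_iff:
  fixes x :: "'a::euclidean_space"
  assumes "0 \<le> t"
  shows "vol_coord x < t \<longleftrightarrow> norm x < root DIM('a) (t / ball_vol TYPE('a))"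
proof -
  have "vol_coord x < t \<longleftrightarrow> norm x ^ DIM('a) < t / ball_vol TYPE('a)"
    using ball_vol_pos[where 'a='a] by (simp add: vol_coord_def field_simps)
  also have "\<dots> \<longleftrightarrow> root DIM('a) (norm x ^ DIM('a)) < root DIM('a) (t / ball_vol TYPE('a))"
    by simp
  also have "root DIM('a) (norm x ^ DIM('a)) = norm x"
    by (simp add: real_root_power_cancel)
  finally show ?thesis .
qed

text \<open>
  The volume coordinate replaces the radius of the symmetrized set by its volume; sets of infinite
  measure then need no separate treatment.
\<close>

lemma mem_spherical_symm_iff:
  fixes x :: "'a::euclidean_space"
  shows "x \<in> spherical_symm A \<longleftrightarrow> ennreal (vol_coord x) < emeasure lebesgue A"
proof (cases "emeasure lebesgue A = \<infinity>")
  case True then show ?thesis by (simp add: spherical_symm_def)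
next
  case False
  have "x \<in> spherical_symm A \<longleftrightarrow> vol_coord x < measure lebesgue A"
    using False by (simp add: spherical_symm_def vol_coord_less_iff)
  also have "\<dots> \<longleftrightarrow> ennreal (vol_coord x) < emeasure lebesgue A"
    using False by (simp add: emeasure_eq_ennreal_measure ennreal_less_iff)
  finally show ?thesis .
qed

lemma spherical_rearr_eq:
  fixes f :: "'a::euclidean_space \<Rightarrow> real"
  assumes [measurable]: "f \<in> borel_measurable lebesgue"
  shows "spherical_rearr f x = rearr f (vol_coord x)"
proof -
  let ?D = "{s. 0 < s \<and> ennreal (vol_coord x) < distribution f s}"
  have "spherical_rearr f x = (\<integral>\<^sup>+s. indicator ?D s \<partial>lborel)"
    unfolding spherical_rearr_def nn_integral_completion
    by (intro nn_integral_cong) (auto simp: indicator_def mem_spherical_symm_iff distribution_def)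
  also have "\<dots> = rearr f (vol_coord x)"
    unfolding rearr_def by (intro nn_integral_indicator) measurable
  finally show ?thesis .
qed

section \<open>Polar coordinates and the radial profile of a weight\<close>

text \<open>
  The value at the origin is an arbitrary unit vector, which makes the map take values in the
  sphere everywhere.
\<close>

definition direction :: "'a::euclidean_space \<Rightarrow> 'a" where
  "direction x = (if x = 0 then (SOME b. b \<in> Basis) else sgn x)"

text \<open>
  The constant in \<open>dx = \<kappa> ds d\<theta>\<close> for \<open>s = \<sigma> |x|\<^sup>n\<close>: here \<open>ds = n \<sigma> r\<^sup>n\<^sup>-\<^sup>1 dr\<close>.
\<close>

definition polar_factor :: "'a::euclidean_space itself \<Rightarrow> real" where
  "polar_factor _ = 1 / (real DIM('a) * ball_vol TYPE('a))"

lemma polar_factor_pos: "0 < polar_factor TYPE('a::euclidean_space)"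
  using ball_vol_pos[where 'a='a] by (simp add: polar_factor_def)

lemma norm_direction [simp]: "norm (direction x) = 1"
  by (auto simp: direction_def norm_sgn some_in_eq)

lemma polar_reconstruct:
  fixes x :: "'a::euclidean_space"
  shows "root DIM('a) (vol_coord x / ball_vol TYPE('a)) *\<^sub>R direction x = x"
proof (cases "x = 0")
  case True then show ?thesis by (simp add: vol_coord_def)
next
  case False
  have "root DIM('a) (vol_coord x / ball_vol TYPE('a)) = norm x"
    using ball_vol_pos[where 'a='a] by (simp add: vol_coord_def real_root_power_cancel)
  then show ?thesis using False by (simp add: direction_def sgn_div_norm)
qed

lemma space_sphere_borel [simp]: "space sphere_borel_measure = sphere 0 1"
  by (simp add: sphere_borel_measure_def space_restrict_space space_scale_measure)

lemma sets_sphere_borel [measurable_cong]: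
  "sets sphere_borel_measure = sets (restrict_space borel (sphere 0 1))"
  by (simp add: sphere_borel_measure_def)

lemma sgn_borel_measurable [measurable]: "sgn \<in> borel_measurable (borel :: 'a::euclidean_space measure)"
  unfolding sgn_div_norm[abs_def] by measurable

lemma direction_measurable [measurable]: "direction \<in> lborel \<rightarrow>\<^sub>M sphere_borel_measure"
proof -
  have "direction \<in> borel_measurable borel" unfolding direction_def[abs_def] by measurable
  then show ?thesis
    unfolding measurable_cong_sets[OF refl sets_sphere_borel]
    by (intro measurable_restrict_space2) auto
qed

lemma vol_coord_measurable [measurable]: "vol_coord \<in> borel_measurable borel"
  unfolding vol_coord_def[abs_def] by measurable

text \<open>
  Scaling by \<open>r\<close> multiplies the volume of a cone by \<open>r\<^sup>n\<close>, and the surface measure is \<open>n\<close> times the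
  volume of the unit cone by definition.
\<close>

lemma emeasure_cone_below:
  fixes E :: "'a::euclidean_space set"
  assumes E: "E \<in> sets sphere_borel_measure" and t: "0 < t"
  shows "emeasure lborel {x. vol_coord x < t \<and> direction x \<in> E}
    = ennreal t * (ennreal (polar_factor TYPE('a)) * emeasure sphere_borel_measure E)"
proof -
  let ?b = "ball_vol TYPE('a)"
  define r where "r = root DIM('a) (t / ?b)"
  have b: "0 < ?b" by (rule ball_vol_pos)
  have r: "0 < r" "r ^ DIM('a) = t / ?b" using t b by (auto simp: r_def)
  have Eb: "E \<in> sets borel" "E \<subseteq> sphere 0 1"
    using E by (auto simp: sets_sphere_borel sets_restrict_space)
  let ?C = "{x \<in> ball 0 1 - {0}. sgn x \<in> E}"
  let ?S = "{x. vol_coord x < t \<and> x \<noteq> 0 \<and> sgn x \<in> E}"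
  note [measurable] = Eb(1)
  have S[measurable]: "?S \<in> sets borel" by measurable
  have S': "{x. vol_coord x < t \<and> direction x \<in> E} \<in> sets lborel"
  proof -
    have [measurable]: "direction -` E \<in> sets borel"
      using measurable_sets[OF direction_measurable E] by simp
    have "{x \<in> space borel. vol_coord x < t} \<inter> direction -` E \<in> sets borel" by measurable
    then show ?thesis by (simp add: vimage_def Int_def)
  qed
  \<comment> \<open>The two sets differ at most by the origin; ?S is the unit cone scaled by r.\<close>
  have "emeasure lborel {x. vol_coord x < t \<and> direction x \<in> E} = emeasure lborel ?S"
  proof (rule emeasure_eq_AE)
    show "AE x in lborel. x \<in> {x. vol_coord x < t \<and> direction x \<in> E} \<longleftrightarrow> x \<in> ?S"
      using AE_lborel_singleton[of "0::'a"] by eventually_elim (simp add: direction_def)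
  qed (use S S' in auto)
  also have "\<dots> = emeasure (density (distr lborel borel (\<lambda>x. 0 + r *\<^sub>R x)) (\<lambda>_. ennreal (\<bar>r\<bar> ^ DIM('a)))) ?S"
    using r(1) by (subst lborel_affine[of r 0]) (auto)
  also have "\<dots> = ennreal (\<bar>r\<bar> ^ DIM('a)) * emeasure lborel {x. r *\<^sub>R x \<in> ?S}"
    by (subst emeasure_density) (auto simp: nn_integral_cmult emeasure_distr vimage_def)
  also have "{x. r *\<^sub>R x \<in> ?S} = ?C"
  proof -
    have "vol_coord (r *\<^sub>R x) < t \<longleftrightarrow> norm x < 1" for x :: 'a
    proof -
      have "vol_coord (r *\<^sub>R x) = t * norm x ^ DIM('a)"
        using r b by (simp add: vol_coord_def power_mult_distrib)
      also have "\<dots> < t \<longleftrightarrow> norm x ^ DIM('a) < 1" using t by simp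
      also have "\<dots> \<longleftrightarrow> norm x < 1" by (simp add: power_less_one_iff)
      finally show ?thesis .
    qed
    then show ?thesis using r(1) by (auto simp: sgn_scaleR)
  qed
  also have "ennreal (\<bar>r\<bar> ^ DIM('a)) * emeasure lborel ?C
    = ennreal t * (ennreal (polar_factor TYPE('a)) * (of_nat DIM('a) * emeasure lborel ?C))"
  proof -
    have "ennreal (\<bar>r\<bar> ^ DIM('a)) = ennreal t * (ennreal (polar_factor TYPE('a)) * of_nat DIM('a))"
      using r t b by (simp add: polar_factor_def ennreal_mult[symmetric] ennreal_of_nat_eq_real_of_nat)
    then show ?thesis by (simp add: mult.assoc)
  qed
  finally show ?thesis
    using emeasure_sphere_borel_measure[OF Eb] by simp
qed

lemma finite_sphere_borel: "emeasure sphere_borel_measure (sphere (0::'a::euclidean_space) 1) = of_nat DIM('a) * ennreal (ball_vol TYPE('a))"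
proof -
  have "{x \<in> ball 0 1 - {0}. sgn x \<in> sphere (0::'a) 1} = ball 0 1 - {0}" by (auto simp: norm_sgn)
  moreover have "emeasure lborel (ball (0::'a) 1 - {0}) = emeasure lborel (ball (0::'a) 1)"
    using AE_lborel_singleton[of "0::'a"] by (intro emeasure_eq_AE) auto
  ultimately show ?thesis
    by (subst emeasure_sphere_borel_measure) (auto simp: emeasure_ball0[where 'a='a and r=1])
qed

abbreviation pos_lborel :: "real measure" where
  "pos_lborel \<equiv> density lborel (indicator {0<..})"

lemma measure_eqI_Iio:
  fixes M N :: "real measure"
  assumes "sets M = sets borel" "sets N = sets borel"
    and "\<And>t. emeasure M {..<t} = emeasure N {..<t}" "\<And>t. emeasure M {..<t} < top"
  shows "M = N"
proof (rule measure_eqI_generator_eq[where E="range lessThan" and \<Omega>=UNIV and A="\<lambda>n. {..<real n}"])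
  show "Int_stable (range (lessThan :: real \<Rightarrow> real set))"
    by (rule Int_stableI) (auto simp: lessThan_def Int_def min_less_iff_conj[symmetric] simp del: min_less_iff_conj)
  show "\<And>X. X \<in> range lessThan \<Longrightarrow> emeasure M X = emeasure N X" using assms(3) by auto
  show "sets M = sigma_sets UNIV (range lessThan)" "sets N = sigma_sets UNIV (range lessThan)"
    using assms(1,2) by (simp_all add: borel_Iio)
  show "\<And>i. emeasure M {..<real i} \<noteq> \<infinity>" using assms(4) by (simp add: less_top)
  show "(\<Union>i. {..<real i}) = UNIV" using reals_Archimedean2 by auto
qed auto

lemma emeasure_pos_lborel:
  assumes "A \<in> sets borel"
  shows "emeasure pos_lborel A = emeasure lborel ({0<..} \<inter> A)"
  using assms by (subst emeasure_density) (auto simp: indicator_inter_arith[symmetric])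

lemma emeasure_pos_lborel_Iio: "emeasure pos_lborel {..<t} = ennreal t"
proof -
  have "{0<..} \<inter> {..<t} = {0<..<t}" by auto
  then show ?thesis by (cases "0 \<le> t") (auto simp: emeasure_pos_lborel ennreal_neg)
qed

text \<open>
  For fixed \<open>E\<close> both sides are measures in \<open>A\<close> that agree on the intervals \<open>(-\<infinity>, t)\<close> by the cone
  formula.
\<close>

lemma emeasure_polar_rectangle:
  fixes E :: "'a::euclidean_space set"
  assumes E[measurable]: "E \<in> sets sphere_borel_measure" and A: "A \<in> sets borel"
  shows "emeasure lborel {x. vol_coord x \<in> A \<and> direction x \<in> E}
    = emeasure pos_lborel A * (ennreal (polar_factor TYPE('a)) * emeasure sphere_borel_measure E)"
proof -
  let ?k = "ennreal (polar_factor TYPE('a)) * emeasure sphere_borel_measure E"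
  let ?D = "{x::'a. direction x \<in> E}"
  have D[measurable]: "?D \<in> sets borel"
    using measurable_sets[OF direction_measurable E] by (simp add: vimage_def)
  define M where "M = distr (density lborel (indicator ?D)) borel (vol_coord :: 'a \<Rightarrow> real)"
  define N where "N = scale_measure ?k pos_lborel"
  have M: "emeasure M B = emeasure lborel {x. vol_coord x \<in> B \<and> direction x \<in> E}" if [measurable]: "B \<in> sets borel" for B
  proof -
    have V[measurable]: "(vol_coord :: 'a \<Rightarrow> real) -` B \<in> sets borel"
      using measurable_sets[OF vol_coord_measurable that] by simp
    have "emeasure M B = emeasure (density lborel (indicator ?D)) (vol_coord -` B)"
      unfolding M_def by (subst emeasure_distr) auto
    also have "\<dots> = (\<integral>\<^sup>+x. indicator (?D \<inter> vol_coord -` B) x \<partial>lborel)"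
      by (subst emeasure_density) (auto intro!: nn_integral_cong simp: indicator_def simp del: nn_integral_indicator)
    also have "\<dots> = emeasure lborel (?D \<inter> vol_coord -` B)"
      by (rule nn_integral_indicator) simp
    also have "?D \<inter> vol_coord -` B = {x. vol_coord x \<in> B \<and> direction x \<in> E}" by auto
    finally show ?thesis .
  qed
  have N: "emeasure N B = ?k * emeasure pos_lborel B" for B
    by (simp add: N_def)
  have MN: "emeasure M {..<t} = ennreal t * ?k" for t
  proof (cases "0 < t")
    case True then show ?thesis using emeasure_cone_below[OF E True] by (simp add: M)
  next
    case False
    then have "\<not> vol_coord x < t" for x :: 'a
      using vol_coord_nonneg[of x] by linarith
    then have e: "{x::'a. vol_coord x \<in> {..<t} \<and> direction x \<in> E} = {}" by simp
    have "emeasure M {..<t} = 0" by (subst M, simp, subst e, simp)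
    then show ?thesis using False by (simp add: ennreal_neg)
  qed
  have fin: "?k \<noteq> \<infinity>"
  proof -
    have "emeasure sphere_borel_measure E \<le> emeasure sphere_borel_measure (sphere (0::'a) 1)"
      using sets.sets_into_space[OF E] by (intro emeasure_mono) (auto simp: sets_sphere_borel sets_restrict_space)
    also have "\<dots> < \<infinity>" by (simp add: finite_sphere_borel ennreal_mult_less_top ennreal_of_nat_eq_real_of_nat)
    finally show ?thesis by (simp add: ennreal_mult_eq_top_iff)
  qed
  have "M = N"
  proof (rule measure_eqI_Iio)
    show "emeasure M {..<t} = emeasure N {..<t}" for t
      using MN N emeasure_pos_lborel_Iio by (simp add: mult.commute)
    show "emeasure M {..<t} < top" for t using fin by (simp add: MN ennreal_mult_less_top less_top)
  qed (simp_all add: M_def N_def)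
  then have "emeasure M A = emeasure N A" by simp
  then show ?thesis using A by (simp add: M N mult.commute)
qed

lemma distr_vol_coord: "distr lborel borel (vol_coord :: 'a::euclidean_space \<Rightarrow> real) = pos_lborel"
proof (rule measure_eqI)
  fix A assume "A \<in> sets (distr lborel borel (vol_coord :: 'a \<Rightarrow> real))"
  then have A: "A \<in> sets borel" by simp
  have S: "sphere (0::'a) 1 \<in> sets sphere_borel_measure"
    by (metis sets.top space_sphere_borel)
  have "ennreal (polar_factor TYPE('a)) * emeasure sphere_borel_measure (sphere (0::'a) 1) = 1"
    using ball_vol_pos[where 'a='a]
    by (simp add: finite_sphere_borel polar_factor_def ennreal_of_nat_eq_real_of_nat ennreal_mult[symmetric])
  then have "emeasure lborel {x::'a. vol_coord x \<in> A} = emeasure pos_lborel A"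
    using emeasure_polar_rectangle[OF S A] by simp
  then show "emeasure (distr lborel borel (vol_coord :: 'a \<Rightarrow> real)) A = emeasure pos_lborel A"
    using A by (simp add: emeasure_distr vimage_def)
qed simp

lemma nn_integral_vol_coord:
  fixes G :: "real \<Rightarrow> ennreal"
  assumes [measurable]: "G \<in> borel_measurable borel"
  shows "(\<integral>\<^sup>+x. G (vol_coord (x :: 'a::euclidean_space)) \<partial>lborel) = (\<integral>\<^sup>+s. indicator {0<..} s * G s \<partial>lborel)"
proof -
  have "(\<integral>\<^sup>+x. G (vol_coord (x :: 'a)) \<partial>lborel) = (\<integral>\<^sup>+s. G s \<partial>distr lborel borel (vol_coord :: 'a \<Rightarrow> real))"
    by (simp add: nn_integral_distr)
  then show ?thesis by (simp add: distr_vol_coord nn_integral_density)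
qed

lemma AE_vol_coord:
  assumes "AE s in lborel. 0 < s \<longrightarrow> P s"
  shows "AE x in lborel. P (vol_coord (x :: 'a::euclidean_space))"
proof -
  have "AE s in pos_lborel. P s"
    using assms by (subst AE_density) (auto simp: indicator_def)
  then have "AE s in distr lborel borel (vol_coord :: 'a \<Rightarrow> real). P s" unfolding distr_vol_coord .
  then show ?thesis by (rule AE_distrD[rotated]) simp
qed

lemma AE_vol_coordD:
  assumes "AE x in lborel. P (vol_coord (x :: 'a::euclidean_space))" and [measurable]: "Measurable.pred borel P"
  shows "AE s in lborel. 0 < s \<longrightarrow> P s"
proof -
  have "AE s in distr lborel borel (vol_coord :: 'a \<Rightarrow> real). P s"
    using assms by (subst AE_distr_iff) auto
  then have "AE s in pos_lborel. P s" unfolding distr_vol_coord .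
  then show ?thesis by (subst (asm) AE_density) (auto simp: indicator_def split: if_splits)
qed

lemma finite_measure_sphere_borel: "finite_measure (sphere_borel_measure :: 'a::euclidean_space measure)"
  by standard (simp add: finite_sphere_borel ennreal_mult_eq_top_iff ennreal_of_nat_eq_real_of_nat)

text \<open>
  The pair of volume coordinate and direction has a product law, because it does so on rectangles;
  the rest is Tonelli's theorem.
\<close>

lemma polar_coordinates:
  fixes F :: "'a::euclidean_space \<Rightarrow> ennreal"
  assumes [measurable]: "F \<in> borel_measurable borel"
  shows "(\<integral>\<^sup>+x. F x \<partial>lborel) = ennreal (polar_factor TYPE('a)) *
    (\<integral>\<^sup>+s. indicator {0<..} s * (\<integral>\<^sup>+\<theta>. F (root DIM('a) (s / ball_vol TYPE('a)) *\<^sub>R \<theta>) \<partial>sphere_borel_measure) \<partial>lborel)"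
proof -
  let ?S = "sphere_borel_measure :: 'a measure"
  let ?k = "ennreal (polar_factor TYPE('a))"
  define M where "M = scale_measure ?k ?S"
  let ?p = "\<lambda>x::'a. (vol_coord x, direction x)"
  let ?q = "\<lambda>(s, \<theta>). root DIM('a) (s / ball_vol TYPE('a)) *\<^sub>R (\<theta>::'a)"
  have sM[measurable_cong]: "sets M = sets ?S" by (simp add: M_def)
  interpret S: finite_measure ?S by (rule finite_measure_sphere_borel)
  interpret M: finite_measure M
    by standard (auto simp: M_def space_scale_measure finite_sphere_borel ennreal_mult_eq_top_iff ennreal_of_nat_eq_real_of_nat)
  interpret R: sigma_finite_measure pos_lborel
    by (subst sigma_finite_measure.sigma_finite_iff_density_finite[OF lborel.sigma_finite_measure_axioms]) (auto simp: indicator_def)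
  have p[measurable]: "?p \<in> lborel \<rightarrow>\<^sub>M borel \<Otimes>\<^sub>M ?S" by measurable
  have id: "(\<lambda>\<theta>. \<theta>) \<in> ?S \<rightarrow>\<^sub>M borel"
    unfolding measurable_cong_sets[OF sets_sphere_borel refl] by (intro measurable_restrict_space1) auto
  have q[measurable]: "?q \<in> borel \<Otimes>\<^sub>M ?S \<rightarrow>\<^sub>M borel"
    using measurable_compose[OF measurable_snd id] by measurable
  have pair: "pos_lborel \<Otimes>\<^sub>M M = distr lborel (borel \<Otimes>\<^sub>M ?S) ?p"
  proof (rule pair_measure_eqI)
    show "sigma_finite_measure pos_lborel" "sigma_finite_measure M" by unfold_locales
    show "sets (pos_lborel \<Otimes>\<^sub>M M) = sets (distr lborel (borel \<Otimes>\<^sub>M ?S) ?p)"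
      using sM by (simp cong: sets_pair_measure_cong)
    fix A B assume "A \<in> sets pos_lborel" "B \<in> sets M"
    then have A: "A \<in> sets borel" and B: "B \<in> sets ?S" by (auto simp: sM)
    have "emeasure (distr lborel (borel \<Otimes>\<^sub>M ?S) ?p) (A \<times> B) = emeasure lborel {x. vol_coord x \<in> A \<and> direction x \<in> B}"
      using A B by (subst emeasure_distr[OF p]) (auto simp: vimage_def)
    then show "emeasure pos_lborel A * emeasure M B = emeasure (distr lborel (borel \<Otimes>\<^sub>M ?S) ?p) (A \<times> B)"
      by (simp add: emeasure_polar_rectangle[OF B A] M_def)
  qed
  have "(\<integral>\<^sup>+x. F x \<partial>lborel) = (\<integral>\<^sup>+x. F (?q (?p x)) \<partial>lborel)"
    by (simp add: polar_reconstruct)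
  also have "\<dots> = (\<integral>\<^sup>+z. F (?q z) \<partial>distr lborel (borel \<Otimes>\<^sub>M ?S) ?p)"
    by (subst nn_integral_distr[OF p]) simp_all
  also have "\<dots> = (\<integral>\<^sup>+s. \<integral>\<^sup>+\<theta>. F (?q (s, \<theta>)) \<partial>M \<partial>pos_lborel)"
    unfolding pair[symmetric] by (subst M.nn_integral_fst[symmetric]) simp_all
  also have "\<dots> = (\<integral>\<^sup>+s. indicator {0<..} s * (\<integral>\<^sup>+\<theta>. F (?q (s, \<theta>)) \<partial>M) \<partial>lborel)"
    by (subst nn_integral_density) simp_all
  also have "\<dots> = (\<integral>\<^sup>+s. ?k * (indicator {0<..} s * (\<integral>\<^sup>+\<theta>. F (?q (s, \<theta>)) \<partial>?S)) \<partial>lborel)"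
    unfolding M_def by (subst nn_integral_scale_measure) (auto simp: mult_ac)
  also have "\<dots> = ?k * (\<integral>\<^sup>+s. indicator {0<..} s * (\<integral>\<^sup>+\<theta>. F (?q (s, \<theta>)) \<partial>?S) \<partial>lborel)"
    by (subst nn_integral_cmult) simp_all
  finally show ?thesis by simp
qed

lemma weight_measurable:
  assumes "weight v"
  shows "v \<in> borel_measurable lebesgue"
proof (rule borel_measurable_LIMSEQ_real)
  show "(\<lambda>k. indicator (cball 0 (real k)) x * v x) \<longlonglongrightarrow> v x" for x
  proof (rule tendsto_eventually)
    obtain m where "norm x \<le> real m" using real_arch_simple by blast
    then show "\<forall>\<^sub>F k in sequentially. indicator (cball 0 (real k)) x * v x = v x"
      unfolding eventually_sequentially by (intro exI[of _ m]) auto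
  qed
  show "(\<lambda>x. indicator (cball 0 (real k)) x * v x) \<in> borel_measurable lebesgue" for k
    using assms compact_cball unfolding weight_def set_integrable_def
    by (metis (no_types, lifting) borel_measurable_integrable ext real_scaleR_def)
qed

text \<open>
  The spherical weight is formed from a merely Lebesgue measurable \<open>v\<close>.  Averaging a Borel
  representative of \<open>v\<close> over spheres gives a Borel profile \<open>u\<close>, and the exceptional null set meets
  almost every sphere in a null set by polar coordinates.
\<close>

lemma weight_profile:
  fixes v :: "'a::euclidean_space \<Rightarrow> real"
  assumes v: "weight v"
  obtains u :: "real \<Rightarrow> ennreal" where
    "u \<in> borel_measurable borel"
    "AE s in lborel. 0 < s \<longrightarrow> sphere_weight v s = u s"
    "\<And>G. G \<in> borel_measurable borel \<Longrightarrow> (\<integral>\<^sup>+x. G (vol_coord x) * ennreal (v x) \<partial>lborel)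
      = ennreal (polar_factor TYPE('a)) * (\<integral>\<^sup>+s. indicator {0<..} s * (G s * u s) \<partial>lborel)"
proof -
  let ?S = "sphere_borel_measure :: 'a measure"
  let ?r = "\<lambda>s. root DIM('a) (s / ball_vol TYPE('a))"
  have "(\<lambda>x. ennreal (v x)) \<in> borel_measurable (completion lborel)"
    using weight_measurable[OF v] by simp
  from completion_ex_borel_measurable[OF this]
  obtain w :: "'a \<Rightarrow> ennreal" where w: "w \<in> borel_measurable borel" "AE x in lborel. ennreal (v x) = w x"
    by auto
  obtain N where N: "N \<in> null_sets lborel" "{x. ennreal (v x) \<noteq> w x} \<subseteq> N"
    using AE_E3[OF w(2)] by (metis (mono_tags, lifting) Collect_mono DiffI UNIV_I mem_Collect_eq space_borel space_lborel subsetI)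
  note [measurable] = w(1)
  have Nb[measurable]: "N \<in> sets borel" using N by auto
  interpret S: finite_measure ?S by (rule finite_measure_sphere_borel)
  have id: "(\<lambda>\<theta>. \<theta>) \<in> ?S \<rightarrow>\<^sub>M borel"
    unfolding measurable_cong_sets[OF sets_sphere_borel refl] by (intro measurable_restrict_space1) auto
  have q[measurable]: "(\<lambda>(s, \<theta>). ?r s *\<^sub>R (\<theta>::'a)) \<in> borel \<Otimes>\<^sub>M ?S \<rightarrow>\<^sub>M borel"
    using measurable_compose[OF measurable_snd id] by measurable
  have q1[measurable]: "(\<lambda>\<theta>. ?r s *\<^sub>R (\<theta>::'a)) \<in> ?S \<rightarrow>\<^sub>M borel" for s
    using id by measurable
  define u where "u s = (\<integral>\<^sup>+\<theta>. w (?r s *\<^sub>R \<theta>) \<partial>?S)" for s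
  have u[measurable]: "u \<in> borel_measurable borel" unfolding u_def[abs_def]
    by (rule S.borel_measurable_nn_integral) (use measurable_compose[OF q w(1)] in \<open>simp add: case_prod_unfold\<close>)
  show thesis
  proof (rule that[of u])
    have m: "(\<lambda>s. \<integral>\<^sup>+\<theta>. indicator N (?r s *\<^sub>R \<theta>) \<partial>?S) \<in> borel_measurable borel"
      by (rule S.borel_measurable_nn_integral)
        (use measurable_compose[OF q borel_measurable_indicator[OF Nb]] in \<open>simp add: case_prod_unfold\<close>)
    have "0 = (\<integral>\<^sup>+x. indicator N x \<partial>(lborel::'a measure))" using N by (simp add: null_setsD1)
    also have "\<dots> = ennreal (polar_factor TYPE('a)) *
      (\<integral>\<^sup>+s. indicator {0<..} s * (\<integral>\<^sup>+\<theta>. indicator N (?r s *\<^sub>R \<theta>) \<partial>?S) \<partial>lborel)"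
      by (rule polar_coordinates) simp
    finally have "(\<integral>\<^sup>+s. indicator {0<..} s * (\<integral>\<^sup>+\<theta>. indicator N (?r s *\<^sub>R \<theta>) \<partial>?S) \<partial>lborel) = 0"
      using polar_factor_pos[where 'a='a] by auto
    then have "AE s in lborel. indicator {0<..} s * (\<integral>\<^sup>+\<theta>. indicator N (?r s *\<^sub>R \<theta>) \<partial>?S) = 0"
      using m by (subst (asm) nn_integral_0_iff_AE) auto
    then show "AE s in lborel. 0 < s \<longrightarrow> sphere_weight v s = u s"
    proof eventually_elim
      case (elim s)
      show ?case
      proof
        assume "0 < s"
        then have "(\<integral>\<^sup>+\<theta>. indicator N (?r s *\<^sub>R \<theta>) \<partial>?S) = 0" using elim by simp
        then have "AE \<theta> in ?S. indicator N (?r s *\<^sub>R \<theta>) = (0::ennreal)"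
          by (subst (asm) nn_integral_0_iff_AE) (use measurable_compose[OF q1 borel_measurable_indicator[OF Nb]] in auto)
        then have "AE \<theta> in ?S. ennreal (v (?r s *\<^sub>R \<theta>)) = w (?r s *\<^sub>R \<theta>)"
          by eventually_elim (use N(2) in \<open>auto simp: indicator_def split: if_splits\<close>)
        then show "sphere_weight v s = u s"
          unfolding sphere_weight_def u_def sphere_measure_def nn_integral_completion
          by (rule nn_integral_cong_AE)
      qed
    qed
  next
    fix G :: "real \<Rightarrow> ennreal" assume [measurable]: "G \<in> borel_measurable borel"
    have "(\<integral>\<^sup>+x. G (vol_coord x) * ennreal (v x) \<partial>lborel) = (\<integral>\<^sup>+x. G (vol_coord x) * w x \<partial>lborel)"
      by (rule nn_integral_cong_AE) (use w(2) in auto)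
    also have "\<dots> = ennreal (polar_factor TYPE('a)) *
      (\<integral>\<^sup>+s. indicator {0<..} s * (\<integral>\<^sup>+\<theta>. G (vol_coord (?r s *\<^sub>R \<theta>)) * w (?r s *\<^sub>R \<theta>) \<partial>?S) \<partial>lborel)"
      by (rule polar_coordinates) simp
    also have "(\<lambda>s. indicator {0<..} s * (\<integral>\<^sup>+\<theta>. G (vol_coord (?r s *\<^sub>R \<theta>)) * w (?r s *\<^sub>R \<theta>) \<partial>?S))
      = (\<lambda>s. indicator {0<..} s * (G s * u s))"
    proof
      fix s :: real
      show "indicator {0<..} s * (\<integral>\<^sup>+\<theta>. G (vol_coord (?r s *\<^sub>R \<theta>)) * w (?r s *\<^sub>R \<theta>) \<partial>?S)
        = indicator {0<..} s * (G s * u s)"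
      proof (cases "0 < s")
        case True
        then have "vol_coord (?r s *\<^sub>R \<theta>) = s" if "norm \<theta> = 1" for \<theta> :: 'a
          using that ball_vol_pos[where 'a='a] by (simp add: vol_coord_def power_mult_distrib)
        then have "(\<integral>\<^sup>+\<theta>. G (vol_coord (?r s *\<^sub>R \<theta>)) * w (?r s *\<^sub>R \<theta>) \<partial>?S) = (\<integral>\<^sup>+\<theta>. G s * w (?r s *\<^sub>R \<theta>) \<partial>?S)"
          by (intro nn_integral_cong) auto
        also have "\<dots> = G s * u s" unfolding u_def by (intro nn_integral_cmult) simp
        finally show ?thesis by simp
      qed simp
    qed
    finally show "(\<integral>\<^sup>+x. G (vol_coord x) * ennreal (v x) \<partial>lborel)
      = ennreal (polar_factor TYPE('a)) * (\<integral>\<^sup>+s. indicator {0<..} s * (G s * u s) \<partial>lborel)" .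
  qed (rule u)
qed

section \<open>The Choquet integral behind the Lorentz functional\<close>

text \<open>
  The primitive of \<open>u\<close> with the upper limit in \<open>[0, \<infinity>]\<close>, so that it applies to the measure of any
  set.
\<close>

definition cumulative :: "(real \<Rightarrow> ennreal) \<Rightarrow> ennreal \<Rightarrow> ennreal" where
  "cumulative u m = (\<integral>\<^sup>+s. u s * indicator {s. 0 < s \<and> ennreal s < m} s \<partial>lborel)"

text \<open>
  The Choquet integral of \<open>|f|\<close> with respect to the set function that sends \<open>A\<close> to
  \<open>cumulative u (emeasure lebesgue A)\<close>.
\<close>

definition choquet :: "(real \<Rightarrow> ennreal) \<Rightarrow> ('a::euclidean_space \<Rightarrow> real) \<Rightarrow> ennreal" where
  "choquet u f = (\<integral>\<^sup>+s. indicator {0<..} s * cumulative u (distribution f s) \<partial>lborel)"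

lemma cumulative_mono: "m \<le> m' \<Longrightarrow> cumulative u m \<le> cumulative u m'"
  unfolding cumulative_def
  by (intro nn_integral_mono mult_left_mono) (auto simp: indicator_def intro: less_le_trans)

lemma cumulative_0 [simp]: "cumulative u 0 = 0"
  by (simp add: cumulative_def)

text \<open>
  Superlevel sets of an increasing function on the extended nonnegative numbers are rays.
\<close>

lemma cumulative_measurable [measurable]: "cumulative u \<in> borel_measurable borel"
proof (rule borel_measurableI_greater)
  fix a
  define S where "S = {m. a < cumulative u m}"
  have up: "m' \<in> S" if "m \<in> S" "m \<le> m'" for m m'
    using cumulative_mono[OF that(2), of u] that(1) by (simp add: S_def)
  have "S = {Inf S<..} \<or> S = {Inf S..}"
  proof (cases "Inf S \<in> S")
    case True
    have "S = {Inf S..}"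
    proof (intro set_eqI iffI)
      fix m assume "m \<in> {Inf S..}"
      then show "m \<in> S" using up[OF True] by simp
    qed (simp add: Inf_lower)
    then show ?thesis by blast
  next
    case False
    have "S = {Inf S<..}"
    proof (intro set_eqI iffI)
      fix m assume m: "m \<in> S"
      then have "Inf S \<le> m" by (rule Inf_lower)
      moreover have "Inf S \<noteq> m" using m False by metis
      ultimately show "m \<in> {Inf S<..}" by simp
    next
      fix m assume "m \<in> {Inf S<..}"
      then obtain m0 where "m0 \<in> S" "m0 < m" by (auto simp: Inf_less_iff)
      then show "m \<in> S" using up[of m0 m] by simp
    qed
    then show ?thesis by blast
  qed
  then have "S \<in> sets borel"
    by (metis borel_closed borel_open closed_atLeast open_greaterThan)
  then show "{x \<in> space borel. a < cumulative u x} \<in> sets borel" by (simp add: S_def)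
qed

text \<open>
  Both sides integrate \<open>u t\<close> over the plane region where \<open>s > 0\<close> and \<open>0 < t < |{|f| > s}|\<close>, in the two
  orders of integration.
\<close>

lemma nn_integral_rearr_eq_choquet:
  fixes f :: "'a::euclidean_space \<Rightarrow> real"
  assumes [measurable]: "f \<in> borel_measurable lebesgue" "u \<in> borel_measurable borel"
  shows "(\<integral>\<^sup>+t. indicator {0<..} t * (rearr f t * u t) \<partial>lborel) = choquet u f"
proof -
  let ?k = "\<lambda>t s. indicator {0<..} t * indicator {0<..} s * indicator {z. ennreal (fst z) < distribution f (snd z)} (t, s) :: ennreal"
  have [measurable]: "(\<lambda>z. ?k (fst z) (snd z) * u (fst z)) \<in> borel_measurable (lborel \<Otimes>\<^sub>M lborel)"
    by measurable
  have "(\<integral>\<^sup>+t. indicator {0<..} t * (rearr f t * u t) \<partial>lborel)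
    = (\<integral>\<^sup>+t. (\<integral>\<^sup>+s. ?k t s * u t \<partial>lborel) \<partial>lborel)"
  proof (rule nn_integral_cong)
    fix t :: real
    let ?D = "{s. 0 < s \<and> ennreal t < distribution f s}"
    have "(\<integral>\<^sup>+s. ?k t s * u t \<partial>lborel) = (\<integral>\<^sup>+s. (indicator {0<..} t * u t) * indicator ?D s \<partial>lborel)"
      by (intro nn_integral_cong) (auto simp: indicator_def)
    also have "\<dots> = (indicator {0<..} t * u t) * emeasure lborel ?D"
      by (subst nn_integral_cmult_indicator) auto
    finally show "indicator {0<..} t * (rearr f t * u t) = (\<integral>\<^sup>+s. ?k t s * u t \<partial>lborel)"
      by (simp add: rearr_def mult_ac)
  qed
  also have "\<dots> = (\<integral>\<^sup>+s. (\<integral>\<^sup>+t. ?k t s * u t \<partial>lborel) \<partial>lborel)"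
    by (rule lborel_pair.Fubini') (simp add: case_prod_unfold)
  also have "\<dots> = choquet u f"
    unfolding choquet_def cumulative_def
    by (subst nn_integral_cmult[symmetric])
      (auto intro!: nn_integral_cong simp: indicator_def)
  finally show ?thesis .
qed

lemma distribution_powr:
  assumes "0 < p" "0 < s"
  shows "distribution (\<lambda>x. \<bar>f x\<bar> powr p) s = distribution f (s powr (1 / p))"
proof -
  have "s < \<bar>\<bar>y\<bar> powr p\<bar> \<longleftrightarrow> s powr (1 / p) < \<bar>y\<bar>" for y :: real
  proof
    assume "s < \<bar>\<bar>y\<bar> powr p\<bar>"
    then have "s powr (1 / p) < (\<bar>y\<bar> powr p) powr (1 / p)"
      using assms by (intro powr_less_mono2) auto
    then show "s powr (1 / p) < \<bar>y\<bar>" using assms by (simp add: powr_powr)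
  next
    assume "s powr (1 / p) < \<bar>y\<bar>"
    then have "(s powr (1 / p)) powr p < \<bar>y\<bar> powr p"
      using assms by (intro powr_less_mono2) auto
    then show "s < \<bar>\<bar>y\<bar> powr p\<bar>" using assms by (simp add: powr_powr)
  qed
  then show ?thesis unfolding distribution_def by (simp only:)
qed

text \<open>
  Rearrangement commutes with increasing bijections of \<open>(0, \<infinity>)\<close>: the interval of levels of
  \<open>|f|\<^sup>p\<close> is the image of the one of \<open>f\<close> under the \<open>p\<close>-th power.  This reduces exponent \<open>p\<close> to exponent \<open>1\<close>.
\<close>

lemma rearr_powr:
  fixes f :: "'a::euclidean_space \<Rightarrow> real"
  assumes [measurable]: "f \<in> borel_measurable lebesgue" and p: "0 < p"
  shows "ennpowr (rearr f t) p = rearr (\<lambda>x. \<bar>f x\<bar> powr p) t"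
proof -
  let ?D = "{s. 0 < s \<and> ennreal t < distribution f s}"
  let ?E = "{s. 0 < s \<and> ennreal t < distribution (\<lambda>x. \<bar>f x\<bar> powr p) s}"
  have [measurable]: "(\<lambda>x. \<bar>f x\<bar> powr p) \<in> borel_measurable lebesgue" by measurable
  have mem: "s \<in> ?E \<longleftrightarrow> 0 < s \<and> s powr (1 / p) \<in> ?D" for s
    using distribution_powr[OF p, of s f] by auto
  have Db: "?D \<in> sets borel" "?E \<in> sets borel" by measurable
  consider (all) "?D = {0<..}" | (bdd) a where "0 \<le> a" "{0<..<a} \<subseteq> ?D" "?D \<subseteq> {0<..a}"
    by (rule downset_cases[of ?D]) (auto intro: less_le_trans distribution_antimono[OF assms(1)])
  then show ?thesis
  proof cases
    case all
    have "?E = {0<..}"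
    proof (intro set_eqI)
      fix s :: real
      have "0 < s \<Longrightarrow> s powr (1 / p) \<in> {0<..}" by simp
      then show "s \<in> ?E \<longleftrightarrow> s \<in> {0<..}" using mem[of s] all by auto
    qed
    moreover have "emeasure lborel {0::real<..} = top"
      using emeasure_positive_below[of top] by (simp add: greaterThan_def)
    ultimately show ?thesis using all by (simp add: rearr_def ennpowr_def)
  next
    case (bdd a)
    have D: "emeasure lborel ?D = ennreal a"
      using bdd Db by (intro emeasure_between) auto
    have "emeasure lborel ?E = ennreal (a powr p)"
    proof (rule emeasure_between)
      show "{0<..<a powr p} \<subseteq> ?E"
      proof
        fix s assume s: "s \<in> {0<..<a powr p}"
        then have "s powr (1 / p) < (a powr p) powr (1 / p)" using p by (intro powr_less_mono2) auto
        then have "s powr (1 / p) < a" using p bdd(1) by (simp add: powr_powr)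
        then have "s powr (1 / p) \<in> {0<..<a}" using s by simp
        then have "s powr (1 / p) \<in> ?D" by (rule subsetD[OF bdd(2)])
        then show "s \<in> ?E" using mem[of s] s by auto
      qed
      show "?E \<subseteq> {0<..a powr p}"
      proof
        fix s assume s: "s \<in> ?E"
        then have "s powr (1 / p) \<in> ?D" "0 < s" using mem[of s] by auto
        then have "s powr (1 / p) \<le> a" using subsetD[OF bdd(3), of "s powr (1 / p)"] by simp
        then have "(s powr (1 / p)) powr p \<le> a powr p" using p by (intro powr_mono2) auto
        then show "s \<in> {0<..a powr p}" using p \<open>0 < s\<close> by (simp add: powr_powr)
      qed
    qed (use Db in auto)
    then show ?thesis using D bdd(1) by (simp add: rearr_def ennpowr_def)
  qed
qed

lemma distribution_cong_AE:
  fixes f g :: "'a::euclidean_space \<Rightarrow> real"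
  assumes [measurable]: "f \<in> borel_measurable lebesgue" "g \<in> borel_measurable lebesgue"
    and "AE x in lebesgue. f x = g x"
  shows "distribution f s = distribution g s"
  unfolding distribution_def
proof (rule emeasure_eq_AE)
  show "AE x in lebesgue. x \<in> {x. s < \<bar>f x\<bar>} \<longleftrightarrow> x \<in> {x. s < \<bar>g x\<bar>}"
    using assms(3) by eventually_elim simp
qed measurable

lemma choquet_cong_AE:
  fixes f g :: "'a::euclidean_space \<Rightarrow> real"
  assumes "f \<in> borel_measurable lebesgue" "g \<in> borel_measurable lebesgue"
    and "AE x in lebesgue. f x = g x"
  shows "choquet u f = choquet u g"
  using distribution_cong_AE[OF assms] by (simp add: choquet_def)

lemma choquet_mono:
  fixes f g :: "'a::euclidean_space \<Rightarrow> real"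
  assumes [measurable]: "g \<in> borel_measurable lebesgue" and "\<And>x. \<bar>f x\<bar> \<le> \<bar>g x\<bar>"
  shows "choquet u f \<le> choquet u g"
  unfolding choquet_def
proof (intro nn_integral_mono mult_left_mono cumulative_mono)
  fix s
  show "distribution f s \<le> distribution g s"
    unfolding distribution_def
  proof (rule emeasure_mono)
    show "{x. s < \<bar>f x\<bar>} \<subseteq> {x. s < \<bar>g x\<bar>}" using assms(2) by (auto intro: less_le_trans)
  qed measurable
qed simp

lemma choquet_zero [simp]: "choquet u (\<lambda>x::'a::euclidean_space. 0) = 0"
proof -
  have "indicator {0<..} s * cumulative u (distribution (\<lambda>x::'a. 0) s) = 0" for s :: real
    by (simp add: distribution_def indicator_def)
  then show ?thesis unfolding choquet_def by (simp only: nn_integral_const mult_zero_left)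
qed

lemma choquet_cmult:
  fixes f :: "'a::euclidean_space \<Rightarrow> real"
  assumes [measurable]: "f \<in> borel_measurable lebesgue"
  shows "choquet u (\<lambda>x. c * f x) = ennreal \<bar>c\<bar> * choquet u f"
proof (cases "c = 0")
  case True then show ?thesis by simp
next
  case False
  have d: "distribution (\<lambda>x. c * f x) (\<bar>c\<bar> * s) = distribution f s" for s
    using False by (simp add: distribution_def abs_mult)
  have [measurable]: "(\<lambda>x. c * f x) \<in> borel_measurable lebesgue" by measurable
  have "choquet u (\<lambda>x. c * f x) = \<bar>c\<bar> * (\<integral>\<^sup>+s. indicator {0<..} (0 + \<bar>c\<bar> * s) * cumulative u (distribution (\<lambda>x. c * f x) (0 + \<bar>c\<bar> * s)) \<partial>lborel)"
    unfolding choquet_def using False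
    by (subst nn_integral_real_affine[where c="\<bar>c\<bar>" and t=0]) auto
  also have "\<dots> = \<bar>c\<bar> * choquet u f"
    unfolding choquet_def using False by (simp add: d indicator_def zero_less_mult_iff)
  finally show ?thesis .
qed

text \<open>
  This is the place where the positivity condition on a weight enters: a superlevel set of positive
  measure contributes a positive amount.
\<close>

lemma choquet_eq_0_iff:
  fixes f :: "'a::euclidean_space \<Rightarrow> real"
  assumes [measurable]: "f \<in> borel_measurable lebesgue"
    and pos: "\<And>A::'a set. A \<in> sets lebesgue \<Longrightarrow> 0 < emeasure lebesgue A \<Longrightarrow> 0 < cumulative u (emeasure lebesgue A)"
  shows "choquet u f = 0 \<longleftrightarrow> (AE x in lebesgue. f x = 0)"
proof
  assume "AE x in lebesgue. f x = 0"
  then have "choquet u f = choquet u (\<lambda>x::'a. 0)" by (intro choquet_cong_AE) auto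
  then show "choquet u f = 0" by simp
next
  assume 0: "choquet u f = 0"
  have null: "emeasure lebesgue {x. e < \<bar>f x\<bar>} = 0" if e: "0 < e" for e
  proof (rule ccontr)
    assume "\<not> ?thesis"
    then have c: "0 < cumulative u (distribution f e)"
      unfolding distribution_def by (intro pos) (auto simp: zero_less_iff_neq_zero)
    have "ennreal e * cumulative u (distribution f e)
      = (\<integral>\<^sup>+s. cumulative u (distribution f e) * indicator {0<..<e} s \<partial>lborel)"
      using e by (subst nn_integral_cmult_indicator) (auto simp: mult.commute)
    also have "\<dots> \<le> choquet u f" unfolding choquet_def
      by (intro nn_integral_mono) (auto simp: indicator_def intro!: cumulative_mono distribution_antimono)
    finally show False using 0 c e by simp
  qed
  have "AE x in lebesgue. \<forall>n. x \<notin> {x. 1 / real (Suc n) < \<bar>f x\<bar>}"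
    unfolding AE_all_countable
  proof
    fix n
    have "{x. 1 / real (Suc n) < \<bar>f x\<bar>} \<in> null_sets lebesgue" by (intro null_setsI null) auto
    then show "AE x in lebesgue. x \<notin> {x. 1 / real (Suc n) < \<bar>f x\<bar>}" by (rule AE_not_in)
  qed
  then show "AE x in lebesgue. f x = 0"
  proof eventually_elim
    case (elim x)
    show ?case
    proof (rule ccontr)
      assume "f x \<noteq> 0"
      then obtain n where "1 / real (Suc n) < \<bar>f x\<bar>" using nat_approx_posE[of "\<bar>f x\<bar>"] by auto
      then show False using elim by auto
    qed
  qed
qed

text \<open>
  The superlevel sets are \<open>E2\<close> up to the level \<open>\<beta>\<close>, \<open>E1\<close> from there up to \<open>\<alpha>\<close>, and empty above.
\<close>

lemma choquet_two_step:
  fixes E1 E2 :: "'a::euclidean_space set"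
  assumes E: "E1 \<subseteq> E2" and ab: "0 \<le> \<beta>" "\<beta> \<le> \<alpha>"
  shows "choquet u (\<lambda>x. \<alpha> * indicator E1 x + \<beta> * indicator (E2 - E1) x)
    = ennreal \<beta> * cumulative u (emeasure lebesgue E2) + ennreal (\<alpha> - \<beta>) * cumulative u (emeasure lebesgue E1)"
proof -
  let ?f = "\<lambda>x. \<alpha> * indicator E1 x + \<beta> * indicator (E2 - E1) x :: real"
  have "choquet u ?f = (\<integral>\<^sup>+s. cumulative u (emeasure lebesgue E2) * indicator {0<..<\<beta>} s
      + cumulative u (emeasure lebesgue E1) * indicator {\<beta><..<\<alpha>} s \<partial>lborel)"
    unfolding choquet_def
  proof (rule nn_integral_cong_AE)
    show "AE s in lborel. indicator {0<..} s * cumulative u (distribution ?f s)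
      = cumulative u (emeasure lebesgue E2) * indicator {0<..<\<beta>} s
      + cumulative u (emeasure lebesgue E1) * indicator {\<beta><..<\<alpha>} s"
      using AE_lborel_singleton[of \<alpha>] AE_lborel_singleton[of \<beta>]
    proof eventually_elim
      case (elim s)
      have "{x. s < \<bar>?f x\<bar>} = (if s < \<beta> then E2 else if s < \<alpha> then E1 else {})" if "0 < s"
        using that E ab by (auto simp: indicator_def split: if_splits)
      then show ?case using elim ab by (auto simp: distribution_def indicator_def)
    qed
  qed
  also have "\<dots> = ennreal \<beta> * cumulative u (emeasure lebesgue E2) + ennreal (\<alpha> - \<beta>) * cumulative u (emeasure lebesgue E1)"
    using ab by (subst nn_integral_add) (simp_all add: nn_integral_cmult_indicator mult.commute[of "ennreal _"])
  finally show ?thesis .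
qed

section \<open>Subadditivity for a decreasing profile\<close>

text \<open>
  The distribution function of a profile on \<open>(0, \<infinity>)\<close>.
\<close>

definition profile_level :: "(real \<Rightarrow> ennreal) \<Rightarrow> real \<Rightarrow> ennreal" where
  "profile_level w y = emeasure lborel {s. 0 < s \<and> ennreal y < w s}"

lemma profile_level_antimono:
  assumes [measurable]: "w \<in> borel_measurable borel" and "y \<le> z"
  shows "profile_level w z \<le> profile_level w y"
  unfolding profile_level_def using assms(2)
  by (intro emeasure_mono) (auto intro: le_less_trans ennreal_leI)

lemma profile_level_measurable [measurable]:
  "w \<in> borel_measurable borel \<Longrightarrow> profile_level w \<in> borel_measurable borel"
  by (rule antimono_borel_measurable) (rule profile_level_antimono)

text \<open>
  A decreasing profile is the superposition, over the levels \<open>y\<close>, of indicators of intervals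
  \<open>(0, \<tau>)\<close> with \<open>\<tau>\<close> the length of the superlevel set; the primitive of such an indicator is
  \<open>min \<tau> m\<close>.
\<close>

lemma cumulative_eq_level_integral:
  assumes [measurable]: "w \<in> borel_measurable borel" and anti: "antimono_on {0<..} w"
  shows "cumulative w m = (\<integral>\<^sup>+y. indicator {0<..} y * min (profile_level w y) m \<partial>lborel)"
proof -
  let ?k = "\<lambda>s y. indicator {0<..} s * indicator {0<..} y * indicator {z. ennreal (snd z) < w (fst z)} (s, y)
    * indicator {s. ennreal s < m} s :: ennreal"
  have "cumulative w m = (\<integral>\<^sup>+s. (\<integral>\<^sup>+y. ?k s y \<partial>lborel) \<partial>lborel)"
    unfolding cumulative_def
  proof (rule nn_integral_cong)
    fix s :: real
    have "w s * indicator {s. 0 < s \<and> ennreal s < m} s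
      = (\<integral>\<^sup>+y. indicator {y. 0 < y \<and> ennreal y < w s} y * indicator {s. 0 < s \<and> ennreal s < m} s \<partial>lborel)"
      by (subst nn_integral_multc) (auto simp: emeasure_positive_below)
    also have "\<dots> = (\<integral>\<^sup>+y. ?k s y \<partial>lborel)"
      by (intro nn_integral_cong) (auto simp: indicator_def)
    finally show "w s * indicator {s. 0 < s \<and> ennreal s < m} s = (\<integral>\<^sup>+y. ?k s y \<partial>lborel)" .
  qed
  also have "\<dots> = (\<integral>\<^sup>+y. (\<integral>\<^sup>+s. ?k s y \<partial>lborel) \<partial>lborel)"
    by (rule lborel_pair.Fubini') measurable
  also have "\<dots> = (\<integral>\<^sup>+y. indicator {0<..} y * min (profile_level w y) m \<partial>lborel)"
  proof (rule nn_integral_cong)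
    fix y :: real
    let ?D = "{s. 0 < s \<and> ennreal y < w s}"
    have "(\<integral>\<^sup>+s. ?k s y \<partial>lborel) = (\<integral>\<^sup>+s. indicator {0<..} y * indicator {s \<in> ?D. ennreal s < m} s \<partial>lborel)"
      by (intro nn_integral_cong) (auto simp: indicator_def)
    also have "\<dots> = indicator {0<..} y * emeasure lborel {s \<in> ?D. ennreal s < m}"
      by (subst nn_integral_cmult_indicator) auto
    also have "emeasure lborel {s \<in> ?D. ennreal s < m} = min (emeasure lborel ?D) m"
      by (rule emeasure_downset_below) (auto intro: less_le_trans monotone_onD[OF anti])
    finally show "(\<integral>\<^sup>+s. ?k s y \<partial>lborel) = indicator {0<..} y * min (profile_level w y) m"
      by (simp add: profile_level_def)
  qed
  finally show ?thesis .
qed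

text \<open>
  This number is the integral of the decreasing rearrangement of \<open>f\<close> over \<open>(0, \<tau>)\<close>; it is also the
  K-functional of \<open>f\<close> between \<open>L\<^sup>1\<close> and \<open>L\<^sup>\<infinity>\<close>, which explains its subadditivity.
\<close>

definition truncated_mass :: "ennreal \<Rightarrow> ('a::euclidean_space \<Rightarrow> real) \<Rightarrow> ennreal" where
  "truncated_mass \<tau> f = (\<integral>\<^sup>+s. indicator {0<..} s * min (distribution f s) \<tau> \<partial>lborel)"

lemma choquet_eq_truncated_mass:
  fixes f :: "'a::euclidean_space \<Rightarrow> real"
  assumes [measurable]: "w \<in> borel_measurable borel" "f \<in> borel_measurable lebesgue"
    and anti: "antimono_on {0<..} w"
  shows "choquet w f = (\<integral>\<^sup>+y. indicator {0<..} y * truncated_mass (profile_level w y) f \<partial>lborel)"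
proof -
  have "choquet w f = (\<integral>\<^sup>+s. (\<integral>\<^sup>+y. indicator {0<..} s * (indicator {0<..} y * min (profile_level w y) (distribution f s)) \<partial>lborel) \<partial>lborel)"
    unfolding choquet_def cumulative_eq_level_integral[OF assms(1) anti]
    by (subst nn_integral_cmult) simp_all
  also have "\<dots> = (\<integral>\<^sup>+y. (\<integral>\<^sup>+s. indicator {0<..} s * (indicator {0<..} y * min (profile_level w y) (distribution f s)) \<partial>lborel) \<partial>lborel)"
    by (rule lborel_pair.Fubini') measurable
  also have "\<dots> = (\<integral>\<^sup>+y. indicator {0<..} y * truncated_mass (profile_level w y) f \<partial>lborel)"
    unfolding truncated_mass_def
    by (subst nn_integral_cmult[symmetric]) (auto intro!: nn_integral_cong simp: mult_ac min.commute)
  finally show ?thesis .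
qed

lemma nn_integral_excess:
  fixes f :: "'a::euclidean_space \<Rightarrow> real"
  assumes [measurable]: "f \<in> borel_measurable lebesgue" and c: "0 \<le> c"
  shows "(\<integral>\<^sup>+x. ennreal (\<bar>f x\<bar> - c) \<partial>lebesgue) = (\<integral>\<^sup>+s. indicator {c<..} s * distribution f s \<partial>lborel)"
proof -
  interpret P: pair_sigma_finite "lebesgue :: 'a measure" "lborel :: real measure"
    by (intro pair_sigma_finite.intro sigma_finite_lebesgue lborel.sigma_finite_measure_axioms)
  let ?k = "\<lambda>x s. indicator {z. c < snd z \<and> snd z < \<bar>f (fst z)\<bar>} (x, s) :: ennreal"
  have "(\<integral>\<^sup>+x. ennreal (\<bar>f x\<bar> - c) \<partial>lebesgue) = (\<integral>\<^sup>+x. (\<integral>\<^sup>+s. ?k x s \<partial>lborel) \<partial>lebesgue)"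
  proof (rule nn_integral_cong)
    fix x
    have "(\<integral>\<^sup>+s. ?k x s \<partial>lborel) = (\<integral>\<^sup>+s. indicator {c<..<\<bar>f x\<bar>} s \<partial>lborel)"
      by (intro nn_integral_cong) (auto simp: indicator_def)
    also have "\<dots> = ennreal (\<bar>f x\<bar> - c)"
      by (cases "c \<le> \<bar>f x\<bar>") (simp_all add: ennreal_neg)
    finally show "ennreal (\<bar>f x\<bar> - c) = (\<integral>\<^sup>+s. ?k x s \<partial>lborel)" by simp
  qed
  also have "\<dots> = (\<integral>\<^sup>+s. (\<integral>\<^sup>+x. ?k x s \<partial>lebesgue) \<partial>lborel)"
    by (rule P.Fubini'[symmetric]) measurable
  also have "\<dots> = (\<integral>\<^sup>+s. indicator {c<..} s * distribution f s \<partial>lborel)"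
  proof (rule nn_integral_cong)
    fix s
    have "(\<integral>\<^sup>+x. ?k x s \<partial>lebesgue) = (\<integral>\<^sup>+x. indicator {c<..} s * indicator {x. s < \<bar>f x\<bar>} x \<partial>lebesgue)"
      by (intro nn_integral_cong) (auto simp: indicator_def)
    also have "\<dots> = indicator {c<..} s * distribution f s"
      unfolding distribution_def by (rule nn_integral_cmult_indicator) measurable
    finally show "(\<integral>\<^sup>+x. ?k x s \<partial>lebesgue) = indicator {c<..} s * distribution f s" .
  qed
  finally show ?thesis .
qed

text \<open>
  Bound the minimum by \<open>\<tau>\<close> on the levels below \<open>c\<close> and by the distribution function above.
\<close>

lemma truncated_mass_le:
  fixes f :: "'a::euclidean_space \<Rightarrow> real"
  assumes [measurable]: "f \<in> borel_measurable lebesgue" and c: "0 \<le> c"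
  shows "truncated_mass \<tau> f \<le> ennreal c * \<tau> + (\<integral>\<^sup>+x. ennreal (\<bar>f x\<bar> - c) \<partial>lebesgue)"
proof -
  have "truncated_mass \<tau> f \<le> (\<integral>\<^sup>+s. \<tau> * indicator {0<..c} s + indicator {c<..} s * distribution f s \<partial>lborel)"
    unfolding truncated_mass_def
    by (intro nn_integral_mono) (auto simp: indicator_def)
  also have "\<dots> = ennreal c * \<tau> + (\<integral>\<^sup>+x. ennreal (\<bar>f x\<bar> - c) \<partial>lebesgue)"
    using c by (subst nn_integral_add)
      (simp_all add: nn_integral_cmult_indicator nn_integral_excess mult.commute[of "ennreal _"])
  finally show ?thesis .
qed

text \<open>
  The minimizing \<open>c\<close> is the level at which the distribution function crosses \<open>\<tau>\<close>, that is, the value of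
  the rearrangement at \<open>\<tau>\<close>.  If there is no crossing, the truncated mass is infinite.
\<close>

lemma truncated_mass_attained:
  fixes f :: "'a::euclidean_space \<Rightarrow> real"
  assumes [measurable]: "f \<in> borel_measurable lebesgue" and fin: "truncated_mass \<tau> f \<noteq> top" and \<tau>: "\<tau> \<noteq> 0"
  obtains c where "0 \<le> c" "ennreal c * \<tau> + (\<integral>\<^sup>+x. ennreal (\<bar>f x\<bar> - c) \<partial>lebesgue) \<le> truncated_mass \<tau> f"
proof -
  let ?D = "{s. 0 < s \<and> \<tau> < distribution f s}"
  consider (all) "?D = {0<..}" | (bdd) a where "0 \<le> a" "{0<..<a} \<subseteq> ?D" "?D \<subseteq> {0<..a}"
    by (rule downset_cases[of ?D]) (auto intro: less_le_trans distribution_antimono[OF assms(1)])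
  then show thesis
  proof cases
    case all
    \<comment> \<open>No crossing: every level contributes at least \<tau>.\<close>
    have "top = (\<integral>\<^sup>+s. \<tau> * indicator {0::real<..} s \<partial>lborel)"
      using \<tau> emeasure_positive_below[of top]
      by (subst nn_integral_cmult_indicator) (auto simp: greaterThan_def ennreal_mult_top)
    also have "\<dots> \<le> truncated_mass \<tau> f"
      unfolding truncated_mass_def
    proof (rule nn_integral_mono)
      fix s :: real
      show "\<tau> * indicator {0<..} s \<le> indicator {0<..} s * min (distribution f s) \<tau>"
      proof (cases "0 < s")
        case True
        then have "s \<in> ?D" using all by auto
        then show ?thesis using True by simp
      qed simp
    qed
    finally show thesis using fin by (simp add: top_unique)
  next
    case (bdd a)
    have "ennreal a * \<tau> + (\<integral>\<^sup>+x. ennreal (\<bar>f x\<bar> - a) \<partial>lebesgue)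
      = (\<integral>\<^sup>+s. \<tau> * indicator {0<..<a} s + indicator {a<..} s * distribution f s \<partial>lborel)"
      using bdd(1) by (subst nn_integral_add)
        (simp_all add: nn_integral_cmult_indicator nn_integral_excess mult.commute[of "ennreal _"])
    also have "\<dots> \<le> truncated_mass \<tau> f"
      unfolding truncated_mass_def
    proof (rule nn_integral_mono)
      fix s :: real
      consider "s \<in> {0<..<a}" | "s \<in> {a<..}" | "s \<notin> {0<..<a}" "s \<notin> {a<..}" by blast
      then show "\<tau> * indicator {0<..<a} s + indicator {a<..} s * distribution f s
        \<le> indicator {0<..} s * min (distribution f s) \<tau>"
      proof cases
        case 1
        then have "s \<in> ?D" using bdd(2) by blast
        then show ?thesis using 1 by auto
      next
        case 2
        then have "s \<notin> ?D" using bdd(3) by auto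
        then show ?thesis using 2 bdd(1) by auto
      next
        case 3 then show ?thesis by (simp add: indicator_def)
      qed
    qed
    finally show thesis using that bdd(1) by blast
  qed
qed

text \<open>
  Optimal levels \<open>c\<close> for \<open>f\<close> and \<open>d\<close> for \<open>g\<close> give the admissible level \<open>c + d\<close> for the sum, because
  \<open>(|f + g| - c - d)\<^sup>+ \<le> (|f| - c)\<^sup>+ + (|g| - d)\<^sup>+\<close>.
\<close>

lemma truncated_mass_subadditive:
  fixes f g :: "'a::euclidean_space \<Rightarrow> real"
  assumes [measurable]: "f \<in> borel_measurable lebesgue" "g \<in> borel_measurable lebesgue"
  shows "truncated_mass \<tau> (\<lambda>x. f x + g x) \<le> truncated_mass \<tau> f + truncated_mass \<tau> g"
proof (cases "truncated_mass \<tau> f = top \<or> truncated_mass \<tau> g = top \<or> \<tau> = 0")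
  case True
  then show ?thesis by (auto simp: truncated_mass_def)
next
  case False
  obtain c where c: "0 \<le> c" "ennreal c * \<tau> + (\<integral>\<^sup>+x. ennreal (\<bar>f x\<bar> - c) \<partial>lebesgue) \<le> truncated_mass \<tau> f"
    using truncated_mass_attained[OF assms(1)] False by blast
  obtain d where d: "0 \<le> d" "ennreal d * \<tau> + (\<integral>\<^sup>+x. ennreal (\<bar>g x\<bar> - d) \<partial>lebesgue) \<le> truncated_mass \<tau> g"
    using truncated_mass_attained[OF assms(2)] False by blast
  have "truncated_mass \<tau> (\<lambda>x. f x + g x) \<le> ennreal (c + d) * \<tau> + (\<integral>\<^sup>+x. ennreal (\<bar>f x + g x\<bar> - (c + d)) \<partial>lebesgue)"
    by (rule truncated_mass_le) (use c d in auto)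
  also have "(\<integral>\<^sup>+x. ennreal (\<bar>f x + g x\<bar> - (c + d)) \<partial>lebesgue)
    \<le> (\<integral>\<^sup>+x. ennreal (\<bar>f x\<bar> - c) + ennreal (\<bar>g x\<bar> - d) \<partial>lebesgue)"
  proof (rule nn_integral_mono)
    fix x
    have "ennreal (\<bar>f x + g x\<bar> - (c + d)) \<le> ennreal (max 0 (\<bar>f x\<bar> - c) + max 0 (\<bar>g x\<bar> - d))"
      by (rule ennreal_leI) linarith
    also have "\<dots> = ennreal (\<bar>f x\<bar> - c) + ennreal (\<bar>g x\<bar> - d)"
      by (simp add: ennreal_max_0)
    finally show "ennreal (\<bar>f x + g x\<bar> - (c + d)) \<le> ennreal (\<bar>f x\<bar> - c) + ennreal (\<bar>g x\<bar> - d)" .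
  qed
  also have "(\<integral>\<^sup>+x. ennreal (\<bar>f x\<bar> - c) + ennreal (\<bar>g x\<bar> - d) \<partial>lebesgue)
    = (\<integral>\<^sup>+x. ennreal (\<bar>f x\<bar> - c) \<partial>lebesgue) + (\<integral>\<^sup>+x. ennreal (\<bar>g x\<bar> - d) \<partial>lebesgue)"
    by (rule nn_integral_add) measurable
  also have "ennreal (c + d) * \<tau> + ((\<integral>\<^sup>+x. ennreal (\<bar>f x\<bar> - c) \<partial>lebesgue) + (\<integral>\<^sup>+x. ennreal (\<bar>g x\<bar> - d) \<partial>lebesgue))
    = (ennreal c * \<tau> + (\<integral>\<^sup>+x. ennreal (\<bar>f x\<bar> - c) \<partial>lebesgue)) + (ennreal d * \<tau> + (\<integral>\<^sup>+x. ennreal (\<bar>g x\<bar> - d) \<partial>lebesgue))"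
    using c(1) d(1) by (simp add: distrib_right add_ac)
  also have "\<dots> \<le> truncated_mass \<tau> f + truncated_mass \<tau> g"
    by (rule add_mono[OF c(2) d(2)])
  finally show ?thesis by (simp add: add_left_mono)
qed

lemma truncated_mass_measurable [measurable]:
  assumes [measurable]: "f \<in> borel_measurable lebesgue"
  shows "(\<lambda>\<tau>. truncated_mass \<tau> f) \<in> borel_measurable borel"
  unfolding truncated_mass_def by measurable

lemma choquet_subadditive:
  fixes f g :: "'a::euclidean_space \<Rightarrow> real"
  assumes [measurable]: "w \<in> borel_measurable borel" "f \<in> borel_measurable lebesgue" "g \<in> borel_measurable lebesgue"
    and anti: "antimono_on {0<..} w"
  shows "choquet w (\<lambda>x. f x + g x) \<le> choquet w f + choquet w g"
proof -
  have [measurable]: "(\<lambda>x. f x + g x) \<in> borel_measurable lebesgue" by measurable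
  have "choquet w (\<lambda>x. f x + g x) \<le> (\<integral>\<^sup>+y. indicator {0<..} y * truncated_mass (profile_level w y) f
    + indicator {0<..} y * truncated_mass (profile_level w y) g \<partial>lborel)"
    unfolding choquet_eq_truncated_mass[OF assms(1) \<open>(\<lambda>x. f x + g x) \<in> borel_measurable lebesgue\<close> anti]
    by (intro nn_integral_mono) (auto simp: indicator_def intro: truncated_mass_subadditive)
  also have "\<dots> = choquet w f + choquet w g"
    unfolding choquet_eq_truncated_mass[OF assms(1,2) anti] choquet_eq_truncated_mass[OF assms(1,3) anti]
    by (rule nn_integral_add) measurable
  finally show ?thesis .
qed

section \<open>From subadditivity to the norm\<close>

text \<open>
  Extension of the convexity of powers to the closed half-line.
\<close>

lemma powr_convex_nonneg:
  fixes x y t p :: real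
  assumes "1 \<le> p" "0 \<le> x" "0 \<le> y" "0 \<le> t" "t \<le> 1"
  shows "((1 - t) * x + t * y) powr p \<le> (1 - t) * x powr p + t * y powr p"
proof -
  have scale: "(r * z) powr p \<le> r * z powr p" if "0 \<le> r" "r \<le> 1" "0 \<le> z" for r z :: real
  proof -
    have "r powr p \<le> r" using powr_mono'[of 1 p r] that assms(1) by (cases "r = 0") auto
    then show ?thesis using that by (simp add: powr_mult mult_right_mono)
  qed
  consider "x = 0" | "y = 0" | "0 < x" "0 < y" using assms by linarith
  then show ?thesis
  proof cases
    case 1 then show ?thesis using scale[of t y] assms by simp
  next
    case 2 then show ?thesis using scale[of "1 - t" x] assms by simp
  next
    case 3
    then show ?thesis
      using convex_onD[OF powr_convex[OF assms(1)], of t x y] assms by simp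
  qed
qed

text \<open>
  Convexity of the \<open>p\<close>-th power at the convex combination of \<open>|x| / A\<close> and \<open>|y| / B\<close> with weights
  \<open>A / (A + B)\<close> and \<open>B / (A + B)\<close>.
\<close>

lemma powr_triangle_split:
  fixes x y A B p :: real
  assumes "1 \<le> p" "0 < A" "0 < B"
  shows "\<bar>x + y\<bar> powr p \<le> (A + B) powr p * (A / (A + B) / A powr p) * \<bar>x\<bar> powr p
    + (A + B) powr p * (B / (A + B) / B powr p) * \<bar>y\<bar> powr p"
proof -
  define t where "t = B / (A + B)"
  have t: "0 \<le> t" "t \<le> 1" "1 - t = A / (A + B)" using assms by (auto simp: t_def field_simps)
  have "(A + B) * (A / (A + B) * (\<bar>x\<bar> / A)) = \<bar>x\<bar>" "(A + B) * (B / (A + B) * (\<bar>y\<bar> / B)) = \<bar>y\<bar>"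
    using assms by simp_all
  then have "\<bar>x\<bar> + \<bar>y\<bar> = (A + B) * ((1 - t) * (\<bar>x\<bar> / A) + t * (\<bar>y\<bar> / B))"
    unfolding t(3) by (simp only: t_def distrib_left)
  then have "\<bar>x + y\<bar> powr p \<le> ((A + B) * ((1 - t) * (\<bar>x\<bar> / A) + t * (\<bar>y\<bar> / B))) powr p"
    using assms by (intro powr_mono2) auto
  also have "\<dots> = (A + B) powr p * ((1 - t) * (\<bar>x\<bar> / A) + t * (\<bar>y\<bar> / B)) powr p"
    by (rule powr_mult)
  also have "\<dots> \<le> (A + B) powr p * ((1 - t) * (\<bar>x\<bar> / A) powr p + t * (\<bar>y\<bar> / B) powr p)"
    using assms t by (intro mult_left_mono powr_convex_nonneg) auto
  also have "\<dots> = (A + B) powr p * (A / (A + B) / A powr p) * \<bar>x\<bar> powr p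
    + (A + B) powr p * (B / (A + B) / B powr p) * \<bar>y\<bar> powr p"
    unfolding t(3) using assms by (simp add: t_def powr_divide field_simps)
  finally show ?thesis .
qed

lemma ennpowr_le_iff:
  assumes "0 < p" "0 \<le> a"
  shows "ennpowr x (1 / p) \<le> ennreal a \<longleftrightarrow> x \<le> ennreal (a powr p)"
proof (cases x)
  case (real r)
  have "r powr (1 / p) \<le> a \<longleftrightarrow> r \<le> a powr p"
  proof
    assume "r powr (1 / p) \<le> a"
    then have "(r powr (1 / p)) powr p \<le> a powr p" using assms by (intro powr_mono2) auto
    then show "r \<le> a powr p" using assms real by (simp add: powr_powr)
  next
    assume "r \<le> a powr p"
    then have "r powr (1 / p) \<le> (a powr p) powr (1 / p)" using assms real by (intro powr_mono2) auto
    then show "r powr (1 / p) \<le> a" using assms by (simp add: powr_powr)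
  qed
  then show ?thesis using real assms by (simp add: ennpowr_def)
qed (simp add: ennpowr_def top_unique)

text \<open>
  Minkowski's inequality holds for every monotone sublinear functional in place of the integral:
  normalize \<open>f\<close> and \<open>g\<close> by slightly more than their norms and use convexity of the \<open>p\<close>-th power
  pointwise.
\<close>

lemma power_mean_triangle:
  fixes I :: "('a \<Rightarrow> real) \<Rightarrow> ennreal" and f g :: "'a \<Rightarrow> real"
  assumes p: "1 \<le> p"
    and mono: "\<And>f g. g \<in> borel_measurable M \<Longrightarrow> (\<And>x. \<bar>f x\<bar> \<le> \<bar>g x\<bar>) \<Longrightarrow> I f \<le> I g"
    and cmult: "\<And>c f. f \<in> borel_measurable M \<Longrightarrow> I (\<lambda>x. c * f x) = ennreal \<bar>c\<bar> * I f"
    and sub: "\<And>f g. f \<in> borel_measurable M \<Longrightarrow> g \<in> borel_measurable M \<Longrightarrow> I (\<lambda>x. f x + g x) \<le> I f + I g"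
    and [measurable]: "f \<in> borel_measurable M" "g \<in> borel_measurable M"
  shows "ennpowr (I (\<lambda>x. \<bar>f x + g x\<bar> powr p)) (1 / p)
    \<le> ennpowr (I (\<lambda>x. \<bar>f x\<bar> powr p)) (1 / p) + ennpowr (I (\<lambda>x. \<bar>g x\<bar> powr p)) (1 / p)"
proof -
  let ?N = "\<lambda>f. ennpowr (I (\<lambda>x. \<bar>f x\<bar> powr p)) (1 / p)"
  show ?thesis
  proof (cases "?N f = top \<or> ?N g = top")
    case True then show ?thesis by auto
  next
    case False
    then obtain a b where ab: "0 \<le> a" "?N f = ennreal a" "0 \<le> b" "?N g = ennreal b"
      by (metis ennreal_cases)
    \<comment> \<open>Strict bounds A and B are positive, also for functions of norm 0.\<close>
    have main: "?N (\<lambda>x. f x + g x) \<le> ennreal (A + B)" if A: "a < A" and B: "b < B" for A B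
    proof -
      have pos: "0 < A" "0 < B" using ab A B by auto
      have IA: "I (\<lambda>x. \<bar>f x\<bar> powr p) \<le> ennreal (A powr p)"
        using ennpowr_le_iff[of p A] p pos A ab by (metis ennreal_leI less_imp_le order_less_le_trans zero_less_one)
      have IB: "I (\<lambda>x. \<bar>g x\<bar> powr p) \<le> ennreal (B powr p)"
        using ennpowr_le_iff[of p B] p pos B ab by (metis ennreal_leI less_imp_le order_less_le_trans zero_less_one)
      define c where "c = (A + B) powr p * (A / (A + B) / A powr p)"
      define d where "d = (A + B) powr p * (B / (A + B) / B powr p)"
      have cd: "0 \<le> c" "0 \<le> d" using pos by (auto simp: c_def d_def)
      have "I (\<lambda>x. \<bar>f x + g x\<bar> powr p) \<le> I (\<lambda>x. c * \<bar>f x\<bar> powr p + d * \<bar>g x\<bar> powr p)"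
      proof (rule mono)
        fix x
        have "\<bar>f x + g x\<bar> powr p \<le> c * \<bar>f x\<bar> powr p + d * \<bar>g x\<bar> powr p"
          unfolding c_def d_def by (rule powr_triangle_split[OF p pos])
        then show "\<bar>\<bar>f x + g x\<bar> powr p\<bar> \<le> \<bar>c * \<bar>f x\<bar> powr p + d * \<bar>g x\<bar> powr p\<bar>" by simp
      qed measurable
      also have "\<dots> \<le> I (\<lambda>x. c * \<bar>f x\<bar> powr p) + I (\<lambda>x. d * \<bar>g x\<bar> powr p)"
        by (rule sub) measurable
      also have "I (\<lambda>x. c * \<bar>f x\<bar> powr p) = ennreal c * I (\<lambda>x. \<bar>f x\<bar> powr p)"
        using cd by (subst cmult) auto
      also have "I (\<lambda>x. d * \<bar>g x\<bar> powr p) = ennreal d * I (\<lambda>x. \<bar>g x\<bar> powr p)"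
        using cd by (subst cmult) auto
      also have "ennreal c * I (\<lambda>x. \<bar>f x\<bar> powr p) + ennreal d * I (\<lambda>x. \<bar>g x\<bar> powr p)
        \<le> ennreal c * ennreal (A powr p) + ennreal d * ennreal (B powr p)"
        by (intro add_mono mult_left_mono IA IB) auto
      also have "\<dots> = ennreal (c * A powr p + d * B powr p)"
        using cd by (simp add: ennreal_mult ennreal_plus)
      also have "c * A powr p + d * B powr p = (A + B) powr p"
      proof -
        have "c * A powr p + d * B powr p = (A + B) powr p * (A / (A + B) + B / (A + B))"
          using pos by (simp add: c_def d_def distrib_left)
        also have "A / (A + B) + B / (A + B) = 1" using pos by (simp add: add_divide_distrib[symmetric])
        finally show ?thesis by simp
      qed
      finally show ?thesis using ennpowr_le_iff[of p "A + B"] p pos by auto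
    qed
    have eps: "?N (\<lambda>x. f x + g x) \<le> ennreal (a + b) + ennreal e" if "0 < e" for e
    proof -
      have "?N (\<lambda>x. f x + g x) \<le> ennreal ((a + e / 2) + (b + e / 2))"
        using that by (intro main) auto
      also have "(a + e / 2) + (b + e / 2) = (a + b) + e" by simp
      also have "ennreal ((a + b) + e) = ennreal (a + b) + ennreal e"
        using that ab by (intro ennreal_plus) auto
      finally show ?thesis .
    qed
    have "?N (\<lambda>x. f x + g x) \<le> ennreal (a + b)"
      by (rule ennreal_le_epsilon) (rule eps)
    then show ?thesis using ab by simp
  qed
qed

lemma Lambda_fun_eq_choquet:
  fixes f v :: "'a::euclidean_space \<Rightarrow> real"
  assumes [measurable]: "u \<in> borel_measurable borel" "f \<in> borel_measurable lebesgue" and p: "0 < p"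
    and polar: "\<And>G. G \<in> borel_measurable borel \<Longrightarrow> (\<integral>\<^sup>+x. G (vol_coord (x::'a)) * ennreal (v x) \<partial>lborel)
      = k * (\<integral>\<^sup>+s. indicator {0<..} s * (G s * u s) \<partial>lborel)"
  shows "Lambda_fun p v f = ennpowr (k * choquet u (\<lambda>x. \<bar>f x\<bar> powr p)) (1 / p)"
proof -
  have [measurable]: "(\<lambda>x. \<bar>f x\<bar> powr p) \<in> borel_measurable lebesgue" by measurable
  have "(\<integral>\<^sup>+x. ennpowr (spherical_rearr f x) p * ennreal (v x) \<partial>lebesgue)
    = (\<integral>\<^sup>+x. rearr (\<lambda>x. \<bar>f x\<bar> powr p) (vol_coord x) * ennreal (v x) \<partial>lborel)"
    unfolding nn_integral_completion by (simp add: spherical_rearr_eq rearr_powr p)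
  also have "\<dots> = k * choquet u (\<lambda>x. \<bar>f x\<bar> powr p)"
    by (subst polar) (simp_all add: nn_integral_rearr_eq_choquet)
  finally show ?thesis by (simp add: Lambda_fun_def)
qed

lemma weighted_vol_symm_eq:
  fixes v :: "'a::euclidean_space \<Rightarrow> real"
  assumes polar: "\<And>G. G \<in> borel_measurable borel \<Longrightarrow> (\<integral>\<^sup>+x. G (vol_coord (x::'a)) * ennreal (v x) \<partial>lborel)
      = k * (\<integral>\<^sup>+s. indicator {0<..} s * (G s * u s) \<partial>lborel)"
  shows "weighted_vol v (spherical_symm A) = k * cumulative u (emeasure lebesgue A)"
proof -
  have "weighted_vol v (spherical_symm A)
    = (\<integral>\<^sup>+x. indicator {s. ennreal s < emeasure lebesgue A} (vol_coord x) * ennreal (v x) \<partial>lborel)"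
    unfolding weighted_vol_def nn_integral_completion
    by (intro nn_integral_cong) (auto simp: indicator_def mem_spherical_symm_iff)
  also have "\<dots> = k * (\<integral>\<^sup>+s. indicator {0<..} s * (indicator {s. ennreal s < emeasure lebesgue A} s * u s) \<partial>lborel)"
    by (rule polar) measurable
  also have "(\<integral>\<^sup>+s. indicator {0<..} s * (indicator {s. ennreal s < emeasure lebesgue A} s * u s) \<partial>lborel)
    = cumulative u (emeasure lebesgue A)"
    unfolding cumulative_def by (intro nn_integral_cong) (auto simp: indicator_def)
  finally show ?thesis .
qed

text \<open>
  Apart from the triangle inequality, the norm axioms only need that the Choquet integral is
  homogeneous, depends on the distribution function alone and vanishes for null functions only.
\<close>

lemma norm_if_choquet_subadditive:
  fixes v :: "'a::euclidean_space \<Rightarrow> real"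
  assumes p: "1 \<le> p" and k: "0 < k" "k < top"
    and Lam: "\<And>f. f \<in> borel_measurable lebesgue \<Longrightarrow> Lambda_fun p v f = ennpowr (k * choquet u (\<lambda>x. \<bar>f x\<bar> powr p)) (1 / p)"
    and pos: "\<And>A::'a set. A \<in> sets lebesgue \<Longrightarrow> 0 < emeasure lebesgue A \<Longrightarrow> 0 < cumulative u (emeasure lebesgue A)"
    and sub: "\<And>f g :: 'a \<Rightarrow> real. f \<in> borel_measurable lebesgue \<Longrightarrow> g \<in> borel_measurable lebesgue \<Longrightarrow>
      choquet u (\<lambda>x. f x + g x) \<le> choquet u f + choquet u g"
  shows "norm_mod_AE lebesgue (Lambda_space p v) (\<lambda>f. enn2real (Lambda_fun p v f))"
proof -
  let ?N = "Lambda_fun p v"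
  have cong: "?N g = ?N f" if "f \<in> borel_measurable lebesgue" "g \<in> borel_measurable lebesgue" "AE x in lebesgue. f x = g x" for f g
  proof -
    have "choquet u (\<lambda>x. \<bar>g x\<bar> powr p) = choquet u (\<lambda>x. \<bar>f x\<bar> powr p)"
      by (rule choquet_cong_AE) (use that in auto)
    then show ?thesis using that Lam by simp
  qed
  have triangle: "?N (\<lambda>x. f x + g x) \<le> ?N f + ?N g" if [measurable]: "f \<in> borel_measurable lebesgue" "g \<in> borel_measurable lebesgue" for f g
  proof -
    have "ennpowr (k * choquet u (\<lambda>x. \<bar>f x + g x\<bar> powr p)) (1 / p)
      \<le> ennpowr (k * choquet u (\<lambda>x. \<bar>f x\<bar> powr p)) (1 / p) + ennpowr (k * choquet u (\<lambda>x. \<bar>g x\<bar> powr p)) (1 / p)"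
    proof (rule power_mean_triangle[where I="\<lambda>f. k * choquet u f" and M=lebesgue, OF p])
      show "k * choquet u f \<le> k * choquet u g" if "g \<in> borel_measurable lebesgue" "\<And>x. \<bar>f x\<bar> \<le> \<bar>g x\<bar>" for f g :: "'a \<Rightarrow> real"
        using choquet_mono[OF that] by (rule mult_left_mono) simp
      show "k * choquet u (\<lambda>x. c * f x) = ennreal \<bar>c\<bar> * (k * choquet u f)" if "f \<in> borel_measurable lebesgue" for c and f :: "'a \<Rightarrow> real"
        using choquet_cmult[OF that] by (simp add: mult_ac)
      show "k * choquet u (\<lambda>x. f x + g x) \<le> k * choquet u f + k * choquet u g"
        if "f \<in> borel_measurable lebesgue" "g \<in> borel_measurable lebesgue" for f g :: "'a \<Rightarrow> real"
        using mult_left_mono[OF sub[OF that], of k] by (simp add: distrib_left)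
    qed measurable
    then show ?thesis using Lam by simp
  qed
  have scale: "?N (\<lambda>x. c * f x) = ennreal \<bar>c\<bar> * ?N f" if [measurable]: "f \<in> borel_measurable lebesgue" for c f
  proof -
    have [measurable]: "(\<lambda>x. \<bar>f x\<bar> powr p) \<in> borel_measurable lebesgue" by measurable
    have "choquet u (\<lambda>x. \<bar>c * f x\<bar> powr p) = choquet u (\<lambda>x. \<bar>c\<bar> powr p * \<bar>f x\<bar> powr p)"
      by (simp add: abs_mult powr_mult)
    also have "\<dots> = ennreal (\<bar>c\<bar> powr p) * choquet u (\<lambda>x. \<bar>f x\<bar> powr p)"
      by (subst choquet_cmult) auto
    finally have eq: "k * choquet u (\<lambda>x. \<bar>c * f x\<bar> powr p) = ennreal (\<bar>c\<bar> powr p) * (k * choquet u (\<lambda>x. \<bar>f x\<bar> powr p))"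
      by (simp add: mult_ac)
    have "ennpowr (ennreal (\<bar>c\<bar> powr p) * X) (1 / p) = ennreal \<bar>c\<bar> * ennpowr X (1 / p)" for X
    proof (cases X)
      case (real r)
      have "(\<bar>c\<bar> powr p * r) powr (1 / p) = \<bar>c\<bar> * r powr (1 / p)"
        using real p by (simp add: powr_mult powr_powr)
      then show ?thesis using real by (simp add: ennpowr_def ennreal_mult[symmetric])
    next
      case top
      then show ?thesis using p by (cases "c = 0") (auto simp: ennpowr_def ennreal_mult_top)
    qed
    then show ?thesis using Lam[OF that] Lam[of "\<lambda>x. c * f x"] eq by simp
  qed
  have zero: "?N f = 0 \<longleftrightarrow> (AE x in lebesgue. f x = 0)" if [measurable]: "f \<in> borel_measurable lebesgue" for f
  proof -
    have "?N f = 0 \<longleftrightarrow> k * choquet u (\<lambda>x. \<bar>f x\<bar> powr p) = 0"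
      using Lam[OF that] ennpowr_le_iff[of p 0] p by (auto simp: zero_less_iff_neq_zero[symmetric])
    also have "\<dots> \<longleftrightarrow> choquet u (\<lambda>x. \<bar>f x\<bar> powr p) = 0" using k by auto
    also have "\<dots> \<longleftrightarrow> (AE x in lebesgue. \<bar>f x\<bar> powr p = 0)"
    proof (rule choquet_eq_0_iff)
      show "0 < cumulative u (emeasure lebesgue A)" if "A \<in> sets lebesgue" "0 < emeasure lebesgue A" for A :: "'a set"
        using that by (rule pos)
    qed measurable
    finally show ?thesis by simp
  qed
  have mem: "f \<in> Lambda_space p v \<longleftrightarrow> f \<in> borel_measurable lebesgue \<and> ?N f < top" for f
    by (simp add: Lambda_space_def)
  show ?thesis
    unfolding norm_mod_AE_def
  proof (intro conjI ballI allI impI)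
    fix f g assume f: "f \<in> Lambda_space p v" and g: "g \<in> borel_measurable lebesgue" and eq: "AE x in lebesgue. f x = g x"
    have "?N g = ?N f" using cong[OF _ g eq] f by (simp add: mem)
    then show "g \<in> Lambda_space p v" "enn2real (?N g) = enn2real (?N f)" using f g by (auto simp: mem)
  next
    show "(\<lambda>_. 0) \<in> Lambda_space p v" using zero[of "\<lambda>_. 0"] by (simp add: mem)
  next
    fix f g assume f: "f \<in> Lambda_space p v" and g: "g \<in> Lambda_space p v"
    have le: "?N (\<lambda>x. f x + g x) \<le> ?N f + ?N g" and fin: "?N f + ?N g < top"
      using triangle f g by (auto simp: mem)
    have "(\<lambda>x. f x + g x) \<in> borel_measurable lebesgue"
      using f g by (intro borel_measurable_add) (auto simp: mem)
    then show "(\<lambda>x. f x + g x) \<in> Lambda_space p v" using le_less_trans[OF le fin] by (simp add: mem)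
    have "enn2real (?N (\<lambda>x. f x + g x)) \<le> enn2real (?N f + ?N g)" using le fin by (rule enn2real_mono)
    also have "\<dots> = enn2real (?N f) + enn2real (?N g)" using f g by (intro enn2real_plus) (auto simp: mem)
    finally show "enn2real (?N (\<lambda>x. f x + g x)) \<le> enn2real (?N f) + enn2real (?N g)" .
  next
    fix c f assume f: "f \<in> Lambda_space p v"
    show "(\<lambda>x. c * f x) \<in> Lambda_space p v"
      using f scale[of f c] by (auto simp: mem ennreal_mult_less_top)
    show "enn2real (?N (\<lambda>x. c * f x)) = \<bar>c\<bar> * enn2real (?N f)"
      using f scale[of f c] by (simp add: mem enn2real_mult)
  next
    fix f assume f: "f \<in> Lambda_space p v"
    show "0 \<le> enn2real (?N f)" by simp
    have "enn2real (?N f) = 0 \<longleftrightarrow> ?N f = 0" using f by (auto simp: mem enn2real_eq_0_iff)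
    then show "enn2real (?N f) = 0 \<longleftrightarrow> (AE x in lebesgue. f x = 0)"
      using zero f by (simp add: mem)
  qed
qed

section \<open>From the norm to submodularity\<close>

text \<open>
  Concavity of the \<open>p\<close>-th root, in the form in which it bounds a sum of two norms.
\<close>

lemma half_sum_powr_le:
  fixes x y p :: real
  assumes "1 \<le> p" "0 \<le> x" "0 \<le> y"
  shows "(x powr (1 / p) + y powr (1 / p)) powr p \<le> 2 powr p * ((x + y) / 2)"
proof -
  let ?a = "x powr (1 / p)" and ?b = "y powr (1 / p)"
  have "?a + ?b = 2 * ((1 - 1 / 2) * ?a + 1 / 2 * ?b)" by simp
  then have "(?a + ?b) powr p = (2 * ((1 - 1 / 2) * ?a + 1 / 2 * ?b)) powr p" by (simp only:)
  also have "\<dots> = 2 powr p * ((1 - 1 / 2) * ?a + 1 / 2 * ?b) powr p" by (rule powr_mult)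
  also have "\<dots> \<le> 2 powr p * ((1 - 1 / 2) * ?a powr p + 1 / 2 * ?b powr p)"
    using assms by (intro mult_left_mono powr_convex_nonneg) auto
  also have "\<dots> = 2 powr p * ((x + y) / 2)" using assms by (simp add: powr_powr field_simps)
  finally show ?thesis .
qed

text \<open>
  After raising to the \<open>p\<close>-th power and bounding the right-hand side by concavity of the root, the
  two sides agree at \<open>d = 0\<close>.  Up to common terms and factors, the derivatives there are
  \<open>p / 2 * (U - I)\<close> and \<open>p * ((a + b) / 2 - I)\<close>, and comparing them gives the claim.
\<close>

lemma submodular_of_perturbed_triangle:
  fixes U I a b p :: real
  assumes p: "1 \<le> p" and nn: "0 \<le> U" "0 \<le> I" "0 \<le> a" "0 \<le> b"
    and tri: "\<And>d. 0 < d \<Longrightarrow> ((2 + d) powr p * U + ((2 * (1 + d)) powr p - (2 + d) powr p) * I) powr (1 / p)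
      \<le> (U + ((1 + d) powr p - 1) * a) powr (1 / p) + (U + ((1 + d) powr p - 1) * b) powr (1 / p)"
  shows "U + I \<le> a + b"
proof -
  have step: "((1 + d / 2) powr p - 1) / d * (U - I) \<le> ((1 + d) powr p - 1) / d * ((a + b) / 2 - I)" if d: "0 < d" for d
  proof -
    let ?k = "(1 + d) powr p - 1"
    let ?L = "(2 + d) powr p * U + ((2 * (1 + d)) powr p - (2 + d) powr p) * I"
    have k: "0 \<le> ?k" using d p by (simp add: ge_one_powr_ge_zero)
    have le: "(2 + d) powr p \<le> (2 * (1 + d)) powr p" using d p by (intro powr_mono2) auto
    have L: "0 \<le> ?L" using nn le by (intro add_nonneg_nonneg mult_nonneg_nonneg) auto
    have "?L = (?L powr (1 / p)) powr p" using L p by (simp add: powr_powr)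
    also have "\<dots> \<le> ((U + ?k * a) powr (1 / p) + (U + ?k * b) powr (1 / p)) powr p"
      using tri[OF d] p by (intro powr_mono2) auto
    also have "\<dots> \<le> 2 powr p * (((U + ?k * a) + (U + ?k * b)) / 2)"
      using nn k p by (intro half_sum_powr_le) auto
    finally have "?L \<le> 2 powr p * (((U + ?k * a) + (U + ?k * b)) / 2)" .
    moreover have "(2 + d) powr p = 2 powr p * (1 + d / 2) powr p"
      using d powr_mult[of 2 "1 + d / 2" p] by (simp add: distrib_left)
    moreover have "(2 * (1 + d)) powr p = 2 powr p * (1 + d) powr p"
      by (rule powr_mult)
    ultimately have "2 powr p * ((1 + d / 2) powr p * U + ((1 + d) powr p - (1 + d / 2) powr p) * I)
      \<le> 2 powr p * (((U + ?k * a) + (U + ?k * b)) / 2)"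
      by (simp add: algebra_simps)
    then have "(1 + d / 2) powr p * U + ((1 + d) powr p - (1 + d / 2) powr p) * I \<le> ((U + ?k * a) + (U + ?k * b)) / 2"
      by simp
    then have "((1 + d / 2) powr p - 1) * (U - I) \<le> ?k * ((a + b) / 2 - I)"
      by (simp add: field_simps)
    then show ?thesis using d by (simp add: divide_right_mono)
  qed
  have l1: "((\<lambda>d. ((1 + d / 2) powr p - 1) / d) \<longlongrightarrow> p / 2) (at_right 0)" by real_asymp
  have l2: "((\<lambda>d. ((1 + d) powr p - 1) / d) \<longlongrightarrow> p) (at_right 0)" by real_asymp
  have "p / 2 * (U - I) \<le> p * ((a + b) / 2 - I)"
  proof (rule tendsto_le)
    show "((\<lambda>d. ((1 + d / 2) powr p - 1) / d * (U - I)) \<longlongrightarrow> p / 2 * (U - I)) (at_right 0)"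
      by (intro tendsto_intros l1)
    show "((\<lambda>d. ((1 + d) powr p - 1) / d * ((a + b) / 2 - I)) \<longlongrightarrow> p * ((a + b) / 2 - I)) (at_right 0)"
      by (intro tendsto_intros l2)
    show "\<forall>\<^sub>F d in at_right 0. ((1 + d / 2) powr p - 1) / d * (U - I) \<le> ((1 + d) powr p - 1) / d * ((a + b) / 2 - I)"
      using step by (auto simp: eventually_at_filter)
  qed simp
  then have "p * ((U - I) / 2) \<le> p * ((a + b) / 2 - I)" by simp
  then have "(U - I) / 2 \<le> (a + b) / 2 - I" using p by (simp only: mult_le_cancel_left_pos)
  then show ?thesis by (simp add: field_simps)
qed

text \<open>
  The test functions are \<open>1 + d\<close> on \<open>A\<close> and \<open>1\<close> on the rest of \<open>A \<union> B\<close>, and the same with \<open>B\<close>.  Their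
  sum is \<open>2 (1 + d)\<close> on \<open>A \<inter> B\<close> and \<open>2 + d\<close> on the rest, so all three norms involve only the four
  weighted volumes.
\<close>

lemma submodular_if_norm:
  fixes v :: "'a::euclidean_space \<Rightarrow> real" and A B :: "'a set"
  assumes p: "1 \<le> p"
    and Lam: "\<And>f. f \<in> borel_measurable lebesgue \<Longrightarrow> Lambda_fun p v f = ennpowr (k * choquet u (\<lambda>x. \<bar>f x\<bar> powr p)) (1 / p)"
    and fin: "\<And>m. m < top \<Longrightarrow> k * cumulative u m < top"
    and norm: "norm_mod_AE lebesgue (Lambda_space p v) (\<lambda>f. enn2real (Lambda_fun p v f))"
    and A[measurable]: "A \<in> sets lebesgue" and B[measurable]: "B \<in> sets lebesgue"
  shows "k * cumulative u (emeasure lebesgue (A \<union> B)) + k * cumulative u (emeasure lebesgue (A \<inter> B))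
    \<le> k * cumulative u (emeasure lebesgue A) + k * cumulative u (emeasure lebesgue B)"
proof -
  let ?\<Phi> = "\<lambda>E :: 'a set. k * cumulative u (emeasure lebesgue E)"
  have mono: "?\<Phi> E \<le> ?\<Phi> F" if "E \<subseteq> F" "F \<in> sets lebesgue" for E F :: "'a set"
    by (intro mult_left_mono cumulative_mono emeasure_mono that) simp
  \<comment> \<open>If A or B has infinite measure, so has the union, and the claim is monotonicity.\<close>
  consider "emeasure lebesgue A = top" | "emeasure lebesgue B = top"
    | "emeasure lebesgue A < top" "emeasure lebesgue B < top"
    using less_top[of "emeasure lebesgue A"] less_top[of "emeasure lebesgue B"] by blast
  then show ?thesis
  proof cases
    case 1
    then have "emeasure lebesgue (A \<union> B) = emeasure lebesgue A"
      using emeasure_mono[of A "A \<union> B" lebesgue] by (simp add: top_unique)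
    then show ?thesis using mono[of "A \<inter> B" B] by (simp add: add_left_mono)
  next
    case 2
    then have "emeasure lebesgue (A \<union> B) = emeasure lebesgue B"
      using emeasure_mono[of B "A \<union> B" lebesgue] by (simp add: top_unique)
    then show ?thesis using mono[of "A \<inter> B" A] by (simp add: add_left_mono add.commute)
  next
    case 3
    have U: "emeasure lebesgue (A \<union> B) < top"
      using emeasure_subadditive[OF A B] 3 by (auto intro: le_less_trans)
    have I: "emeasure lebesgue (A \<inter> B) < top"
      using emeasure_mono[of "A \<inter> B" A lebesgue] 3 by (auto intro: le_less_trans)
    define \<phi> where "\<phi> E = enn2real (?\<Phi> E)" for E
    have \<phi>: "?\<Phi> E = ennreal (\<phi> E)" if "emeasure lebesgue E < top" for E
      using fin[OF that] by (simp add: \<phi>_def)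
    have tri: "enn2real (Lambda_fun p v (\<lambda>x. f x + g x)) \<le> enn2real (Lambda_fun p v f) + enn2real (Lambda_fun p v g)"
      if "f \<in> Lambda_space p v" "g \<in> Lambda_space p v" for f g
      using norm that by (simp add: norm_mod_AE_def)
    have \<phi>nn: "0 \<le> \<phi> E" for E by (simp add: \<phi>_def)
    let ?F = "\<lambda>\<alpha> \<beta> E1 E2 x. \<alpha> * indicator E1 x + \<beta> * indicator (E2 - E1) x :: real"
    have N: "Lambda_fun p v (?F \<alpha> \<beta> E1 E2) = ennreal ((\<beta> powr p * \<phi> E2 + (\<alpha> powr p - \<beta> powr p) * \<phi> E1) powr (1 / p))"
      and F: "?F \<alpha> \<beta> E1 E2 \<in> Lambda_space p v"
      if E: "E1 \<subseteq> E2" "E1 \<in> sets lebesgue" "E2 \<in> sets lebesgue" "emeasure lebesgue E1 < top" "emeasure lebesgue E2 < top"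
        and ab: "0 \<le> \<beta>" "\<beta> \<le> \<alpha>" for \<alpha> \<beta> E1 E2
    proof -
      note [measurable] = E(2,3)
      have pw: "\<beta> powr p \<le> \<alpha> powr p" using ab p by (intro powr_mono2) auto
      have nn: "0 \<le> \<beta> powr p * \<phi> E2 + (\<alpha> powr p - \<beta> powr p) * \<phi> E1"
        using pw by (simp add: \<phi>_def)
      have m: "?F \<alpha> \<beta> E1 E2 \<in> borel_measurable lebesgue" by measurable
      have "(\<lambda>x. \<bar>?F \<alpha> \<beta> E1 E2 x\<bar> powr p) = ?F (\<alpha> powr p) (\<beta> powr p) E1 E2"
        using E(1) ab by (auto simp: fun_eq_iff indicator_def)
      then have "Lambda_fun p v (?F \<alpha> \<beta> E1 E2) = ennpowr (k * choquet u (?F (\<alpha> powr p) (\<beta> powr p) E1 E2)) (1 / p)"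
        using Lam[OF m] by simp
      also have "k * choquet u (?F (\<alpha> powr p) (\<beta> powr p) E1 E2)
        = ennreal (\<beta> powr p) * ?\<Phi> E2 + ennreal (\<alpha> powr p - \<beta> powr p) * ?\<Phi> E1"
        using pw by (subst choquet_two_step[OF E(1)]) (auto simp: distrib_left mult_ac)
      also have "\<dots> = ennreal (\<beta> powr p * \<phi> E2 + (\<alpha> powr p - \<beta> powr p) * \<phi> E1)"
        unfolding \<phi>[OF E(4)] \<phi>[OF E(5)] using pw \<phi>nn by (simp add: ennreal_mult ennreal_plus)
      finally show N: "Lambda_fun p v (?F \<alpha> \<beta> E1 E2) = ennreal ((\<beta> powr p * \<phi> E2 + (\<alpha> powr p - \<beta> powr p) * \<phi> E1) powr (1 / p))"
        using nn by (simp add: ennpowr_def)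
      show "?F \<alpha> \<beta> E1 E2 \<in> Lambda_space p v" using m N by (simp add: Lambda_space_def)
    qed
    have "\<phi> (A \<union> B) + \<phi> (A \<inter> B) \<le> \<phi> A + \<phi> B"
    proof (rule submodular_of_perturbed_triangle[OF p])
      fix d :: real assume d: "0 < d"
      let ?f = "?F (1 + d) 1 A (A \<union> B)" and ?g = "?F (1 + d) 1 B (A \<union> B)"
      have sum: "(\<lambda>x. ?f x + ?g x) = ?F (2 * (1 + d)) (2 + d) (A \<inter> B) (A \<union> B)"
        by (auto simp: fun_eq_iff indicator_def)
      have f: "?f \<in> Lambda_space p v" and g: "?g \<in> Lambda_space p v"
        by (rule F; use 3 U d in simp)+
      have "enn2real (Lambda_fun p v (\<lambda>x. ?f x + ?g x)) \<le> enn2real (Lambda_fun p v ?f) + enn2real (Lambda_fun p v ?g)"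
        by (rule tri[OF f g])
      moreover have "Lambda_fun p v ?f = ennreal ((\<phi> (A \<union> B) + ((1 + d) powr p - 1) * \<phi> A) powr (1 / p))"
        using N[of A "A \<union> B" 1 "1 + d"] 3 U d by simp
      moreover have "Lambda_fun p v ?g = ennreal ((\<phi> (A \<union> B) + ((1 + d) powr p - 1) * \<phi> B) powr (1 / p))"
        using N[of B "A \<union> B" 1 "1 + d"] 3 U d by simp
      moreover have "Lambda_fun p v (\<lambda>x. ?f x + ?g x)
        = ennreal (((2 + d) powr p * \<phi> (A \<union> B) + ((2 * (1 + d)) powr p - (2 + d) powr p) * \<phi> (A \<inter> B)) powr (1 / p))"
        unfolding sum by (rule N) (use I U d in auto)
      ultimately show "((2 + d) powr p * \<phi> (A \<union> B) + ((2 * (1 + d)) powr p - (2 + d) powr p) * \<phi> (A \<inter> B)) powr (1 / p)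
        \<le> (\<phi> (A \<union> B) + ((1 + d) powr p - 1) * \<phi> A) powr (1 / p)
        + (\<phi> (A \<union> B) + ((1 + d) powr p - 1) * \<phi> B) powr (1 / p)"
        by simp
    qed (simp_all add: \<phi>_def)
    then have "ennreal (\<phi> (A \<union> B) + \<phi> (A \<inter> B)) \<le> ennreal (\<phi> A + \<phi> B)" by (rule ennreal_leI)
    then show ?thesis
      unfolding \<phi>[OF U] \<phi>[OF I] \<phi>[OF 3(1)] \<phi>[OF 3(2)] using \<phi>nn by (simp add: ennreal_plus)
  qed
qed

section \<open>From submodularity to a decreasing profile\<close>

lemma emeasure_vol_coord:
  assumes "S \<in> sets borel"
  shows "emeasure lebesgue {x :: 'a::euclidean_space. vol_coord x \<in> S} = emeasure lborel ({0<..} \<inter> S)"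
proof -
  have "vol_coord -` S \<in> sets (borel :: 'a measure)"
    using measurable_sets[OF vol_coord_measurable assms] by simp
  then have "emeasure lebesgue {x :: 'a. vol_coord x \<in> S} = emeasure (distr lborel borel (vol_coord :: 'a \<Rightarrow> real)) S"
    using assms by (subst emeasure_distr) (simp_all add: vimage_def emeasure_completion)
  also have "\<dots> = emeasure lborel ({0<..} \<inter> S)"
    unfolding distr_vol_coord using assms by (rule emeasure_pos_lborel)
  finally show ?thesis .
qed

lemma vol_coord_vimage_sets:
  assumes "S \<in> sets borel"
  shows "{x :: 'a::euclidean_space. vol_coord x \<in> S} \<in> sets lebesgue"
proof -
  have "vol_coord -` S \<in> sets (borel :: 'a measure)"
    using measurable_sets[OF vol_coord_measurable assms] by simp
  then show ?thesis by (simp add: vimage_def)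
qed

lemma cumulative_eq_density:
  assumes [measurable]: "u \<in> borel_measurable borel"
  shows "cumulative u (ennreal t) = emeasure (density lborel (\<lambda>s. indicator {0<..} s * u s)) {..<t}"
  unfolding cumulative_def
  by (subst emeasure_density) (auto intro!: nn_integral_cong simp: indicator_def ennreal_less_iff)

text \<open>
  A locally integrable density is determined by its primitive.
\<close>

lemma AE_eq_if_cumulative_eq:
  assumes [measurable]: "u \<in> borel_measurable borel" "w \<in> borel_measurable borel"
    and eq: "\<And>t. cumulative u (ennreal t) = cumulative w (ennreal t)"
    and fin: "\<And>t. cumulative u (ennreal t) < top"
  shows "AE s in lborel. 0 < s \<longrightarrow> u s = w s"
proof -
  have "density lborel (\<lambda>s. indicator {0<..} s * u s) = density lborel (\<lambda>s. indicator {0<..} s * w s)"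
    by (rule measure_eqI_Iio) (use eq fin in \<open>simp_all add: cumulative_eq_density\<close>)
  then have "AE s in lborel. indicator {0<..} s * u s = indicator {0<..} s * w s"
    by (intro sigma_finite_measure.density_unique[OF lborel.sigma_finite_measure_axioms]) auto
  then show ?thesis by eventually_elim (auto simp: indicator_def)
qed

text \<open>
  Take for \<open>A\<close> the ball of volume \<open>x + h\<close>, and for \<open>B\<close> the ball of volume \<open>x\<close> together with the shell of
  volume \<open>l\<close> around \<open>A\<close>.
\<close>

lemma radial_submodular:
  fixes k :: ennreal
  assumes k: "0 < k" "k < top"
    and b: "\<And>A B :: 'a::euclidean_space set. A \<in> sets lebesgue \<Longrightarrow> B \<in> sets lebesgue \<Longrightarrow>
      k * cumulative u (emeasure lebesgue (A \<union> B)) + k * cumulative u (emeasure lebesgue (A \<inter> B))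
        \<le> k * cumulative u (emeasure lebesgue A) + k * cumulative u (emeasure lebesgue B)"
    and x: "0 \<le> x" "0 \<le> h" "0 \<le> l"
  shows "cumulative u (ennreal (x + h + l)) + cumulative u (ennreal x)
    \<le> cumulative u (ennreal (x + h)) + cumulative u (ennreal (x + l))"
proof -
  let ?V = "\<lambda>S. {y :: 'a. vol_coord y \<in> S}"
  let ?S = "{..<x + h}" and ?T = "{..<x} \<union> {x + h..<x + h + l}"
  have eS: "emeasure lebesgue (?V ?S) = ennreal (x + h)"
  proof -
    have "{0<..} \<inter> ?S = {0<..<x + h}" by auto
    then show ?thesis using x by (subst emeasure_vol_coord) auto
  qed
  have eT: "emeasure lebesgue (?V ?T) = ennreal (x + l)"
  proof -
    have "emeasure lborel ({0<..} \<inter> ?T) = emeasure lborel ({0<..<x} \<union> ({0<..} \<inter> {x + h..<x + h + l}))"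
      by (rule arg_cong[where f="emeasure lborel"]) auto
    also have "\<dots> = emeasure lborel {0<..<x} + emeasure lborel ({0<..} \<inter> {x + h..<x + h + l})"
      using x by (intro plus_emeasure[symmetric]) auto
    also have "emeasure lborel ({0<..} \<inter> {x + h..<x + h + l}) = emeasure lborel {x + h..<x + h + l}"
    proof (rule emeasure_eq_AE)
      show "AE s in lborel. (s \<in> {0<..} \<inter> {x + h..<x + h + l}) = (s \<in> {x + h..<x + h + l})"
        using AE_lborel_singleton[of 0] by eventually_elim (use x in auto)
    qed auto
    also have "emeasure lborel {0<..<x} + emeasure lborel {x + h..<x + h + l} = ennreal (x + l)"
      using x by (simp add: ennreal_plus)
    finally show ?thesis by (subst emeasure_vol_coord) auto
  qed
  have eU: "emeasure lebesgue (?V ?S \<union> ?V ?T) = ennreal (x + h + l)"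
  proof -
    have "?V ?S \<union> ?V ?T = ?V {..<x + h + l}" using x by auto
    moreover have "{0<..} \<inter> {..<x + h + l} = {0<..<x + h + l}" by auto
    ultimately show ?thesis using x by (simp only:) (subst emeasure_vol_coord, auto)
  qed
  have eI: "emeasure lebesgue (?V ?S \<inter> ?V ?T) = ennreal x"
  proof -
    have "?V ?S \<inter> ?V ?T = ?V {..<x}" using x by auto
    moreover have "{0<..} \<inter> {..<x} = {0<..<x}" by auto
    ultimately show ?thesis using x by (simp only:) (subst emeasure_vol_coord, auto)
  qed
  have "?V ?S \<in> sets lebesgue" "?V ?T \<in> sets lebesgue"
    by (rule vol_coord_vimage_sets; simp)+
  from b[OF this] have "k * (cumulative u (ennreal (x + h + l)) + cumulative u (ennreal x))
      \<le> k * (cumulative u (ennreal (x + h)) + cumulative u (ennreal (x + l)))"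
    unfolding eS eT eU eI by (simp add: distrib_left)
  then show ?thesis using k by (simp add: ennreal_mult_le_mult_iff)
qed

text \<open>
  The hypothesis makes the increments of the primitive \<open>W\<close> over intervals of fixed length decrease as
  the interval moves to the right.  Hence the difference quotients with step \<open>1 / 2\<^sup>k\<close> are decreasing functions,
  and they increase with \<open>k\<close>, since the left half of an interval carries at least half of the
  mass.  Their supremum \<open>w\<close> has the primitive \<open>W\<close> by monotone convergence, so it equals \<open>u\<close> almost
  everywhere; this replaces Lebesgue's differentiation theorem.
\<close>

lemma ae_decreasing_if_submodular:
  fixes u :: "real \<Rightarrow> ennreal"
  assumes u[measurable]: "u \<in> borel_measurable borel"
    and fin: "\<And>t. cumulative u (ennreal t) < top"
    and submod: "\<And>x h l. 0 \<le> x \<Longrightarrow> 0 \<le> h \<Longrightarrow> 0 \<le> l \<Longrightarrow>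
      cumulative u (ennreal (x + h + l)) + cumulative u (ennreal x)
        \<le> cumulative u (ennreal (x + h)) + cumulative u (ennreal (x + l))"
  obtains w :: "real \<Rightarrow> ennreal" where "antimono_on {0<..} w" "AE s in lborel. 0 < s \<longrightarrow> u s = w s"
proof -
  define M where "M = density lborel (\<lambda>s. indicator {0<..} s * u s)"
  have M_sets[measurable_cong]: "sets M = sets borel" by (simp add: M_def)
  define W where "W t = cumulative u (ennreal t)" for t
  have WM: "W t = emeasure M {..<t}" for t
    unfolding W_def M_def by (rule cumulative_eq_density[OF u])
  have Wfin: "W t \<noteq> top" for t using fin[of t] by (simp add: W_def)
  have W0: "W 0 = 0" by (simp add: W_def)
  have incr: "W (x + h) = W x + emeasure M {x..<x + h}" if "0 \<le> h" for x h
  proof -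
    have eq: "{..<x + h} = {..<x} \<union> {x..<x + h}" using that by auto
    have "emeasure M {..<x} + emeasure M {x..<x + h} = emeasure M ({..<x} \<union> {x..<x + h})"
      by (rule plus_emeasure) (simp_all add: M_sets disjoint_iff)
    then show ?thesis unfolding WM eq[symmetric] by (rule sym)
  qed
  \<comment> \<open>Submodularity with l = y - x, after cancelling the finite numbers W x and W y.\<close>
  have slide: "emeasure M {y..<y + h} \<le> emeasure M {x..<x + h}" if "0 \<le> x" "x \<le> y" "0 \<le> h" for x y h
  proof -
    have "W (y + h) + W x \<le> W (x + h) + W y"
    proof -
      have "x + h + (y - x) = y + h" "x + (y - x) = y" by simp_all
      then show ?thesis using submod[of x h "y - x"] that unfolding W_def by (simp only:)
    qed
    then have "(W y + emeasure M {y..<y + h}) + W x \<le> (W x + emeasure M {x..<x + h}) + W y"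
      unfolding incr[OF that(3), of x] incr[OF that(3), of y] .
    then have "(W x + W y) + emeasure M {y..<y + h} \<le> (W x + W y) + emeasure M {x..<x + h}"
      by (simp only: ac_simps)
    then show ?thesis using Wfin[of x] Wfin[of y] by (simp add: ennreal_add_left_cancel_le)
  qed
  define r :: "nat \<Rightarrow> real" where "r k = (1 / 2) ^ k" for k
  have r: "0 < r k" "r k = r (Suc k) + r (Suc k)" for k by (auto simp: r_def)
  define q where "q k x = ennreal (2 ^ k) * emeasure M {x..<x + r k}" for k x
  have q_anti: "antimono_on {0<..} (q k)" for k
    unfolding q_def by (intro monotone_onI mult_left_mono slide) (use r(1)[of k] in auto)
  have q_mono: "q k x \<le> q (Suc k) x" if "0 < x" for k x
  proof -
    let ?h = "r (Suc k)"
    have h: "0 < ?h" by (rule r)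
    have "{x..<x + r k} = {x..<x + ?h} \<union> {x + ?h..<x + ?h + ?h}" using r(2)[of k] h by auto
    moreover have "emeasure M {x..<x + ?h} + emeasure M {x + ?h..<x + ?h + ?h}
        = emeasure M ({x..<x + ?h} \<union> {x + ?h..<x + ?h + ?h})"
      by (rule plus_emeasure) (simp_all add: M_sets disjoint_iff)
    ultimately have "emeasure M {x..<x + r k} = emeasure M {x..<x + ?h} + emeasure M {x + ?h..<x + ?h + ?h}"
      by simp
    also have "\<dots> \<le> emeasure M {x..<x + ?h} + emeasure M {x..<x + ?h}"
      using that h by (intro add_left_mono slide) auto
    also have "\<dots> = 2 * emeasure M {x..<x + ?h}" by (simp add: mult_2)
    finally have "q k x \<le> ennreal (2 ^ k) * (2 * emeasure M {x..<x + ?h})"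
      unfolding q_def by (rule mult_left_mono) simp
    also have "\<dots> = q (Suc k) x"
      by (simp add: q_def ennreal_mult mult_ac)
    finally show ?thesis .
  qed
  define w where "w x = (SUP k. q k x)" for x
  have w_anti: "antimono_on {0<..} w"
  proof (intro monotone_onI)
    fix x y :: real assume xy: "x \<in> {0<..}" "y \<in> {0<..}" "x \<le> y"
    have "q k y \<le> q k x" for k using monotone_onD[OF q_anti xy] .
    then show "w y \<le> w x" unfolding w_def by (intro SUP_mono) auto
  qed
  have q_meas[measurable]: "(\<lambda>x. q k x * indicator {0<..} x) \<in> borel_measurable borel" for k
    by (rule antimono_on_borel_measurable[OF q_anti])
  have w_meas[measurable]: "(\<lambda>x. w x * indicator {0<..} x) \<in> borel_measurable borel"
    by (rule antimono_on_borel_measurable[OF w_anti])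
  have W_small: "(\<lambda>k. W (r k)) \<longlonglongrightarrow> 0"
  proof -
    have "(\<lambda>k. emeasure M {..<r k}) \<longlonglongrightarrow> emeasure M (\<Inter>k. {..<r k})"
    proof (rule Lim_emeasure_decseq)
      show "decseq (\<lambda>k. {..<r k})"
        unfolding decseq_Suc_iff by (auto intro: less_le_trans simp: r_def)
      show "emeasure M {..<r k} \<noteq> \<infinity>" for k using Wfin[of "r k"] by (simp add: WM)
    qed (auto simp: M_def)
    moreover have "(\<Inter>k. {..<r k}) = {..0}"
    proof (intro set_eqI iffI)
      fix x assume x: "x \<in> (\<Inter>k. {..<r k})"
      have "r \<longlonglongrightarrow> 0" unfolding r_def by (rule LIMSEQ_power_zero) simp
      then have "x \<le> 0" by (rule LIMSEQ_le_const) (use x in \<open>auto intro!: exI[of _ 0] less_imp_le\<close>)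
      then show "x \<in> {..0}" by simp
    qed (auto intro: le_less_trans r(1))
    moreover have "emeasure M {..0} = 0"
    proof -
      have "emeasure M {..0} = (\<integral>\<^sup>+s. (indicator {0<..} s * u s) * indicator {..0} s \<partial>lborel)"
        unfolding M_def by (rule emeasure_density) auto
      also have "\<dots> = (\<integral>\<^sup>+s. 0 \<partial>(lborel :: real measure))"
        by (intro nn_integral_cong) (auto simp: indicator_def)
      finally have "emeasure M {..0} = (\<integral>\<^sup>+s. 0 \<partial>(lborel :: real measure))" .
      then show ?thesis by simp
    qed
    ultimately show ?thesis by (simp add: WM)
  qed
  let ?Q = "\<lambda>k t. \<integral>\<^sup>+x. q k x * indicator {0<..} x * indicator {..<t} x \<partial>lborel"
  \<comment> \<open>Tonelli: each y is counted by the x in (0, t) with x \<le> y < x + r k,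
    an interval of length at most r k, and of length r k if r k \<le> y < t.\<close>
  have Q_eq: "?Q k t = (\<integral>\<^sup>+y. (indicator {0<..} y * u y) *
      (ennreal (2 ^ k) * emeasure lborel {x. 0 < x \<and> x < t \<and> x \<le> y \<and> y < x + r k}) \<partial>lborel)" for k t
  proof -
    let ?f = "\<lambda>x y. (indicator {0<..} y * u y) * (ennreal (2 ^ k) *
      indicator {z. 0 < fst z \<and> fst z < t \<and> fst z \<le> snd z \<and> snd z < fst z + r k} (x, y))"
    have "?Q k t = (\<integral>\<^sup>+x. (\<integral>\<^sup>+y. ?f x y \<partial>lborel) \<partial>lborel)"
    proof (rule nn_integral_cong)
      fix x :: real
      have "q k x * indicator {0<..} x * indicator {..<t} x
        = (ennreal (2 ^ k) * indicator {0<..<t} x) * emeasure M {x..<x + r k}"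
        by (auto simp: q_def indicator_def)
      also have "emeasure M {x..<x + r k} = (\<integral>\<^sup>+y. (indicator {0<..} y * u y) * indicator {x..<x + r k} y \<partial>lborel)"
        unfolding M_def by (rule emeasure_density) auto
      also have "(ennreal (2 ^ k) * indicator {0<..<t} x) * \<dots>
        = (\<integral>\<^sup>+y. (ennreal (2 ^ k) * indicator {0<..<t} x) * ((indicator {0<..} y * u y) * indicator {x..<x + r k} y) \<partial>lborel)"
        by (rule nn_integral_cmult[symmetric]) measurable
      also have "\<dots> = (\<integral>\<^sup>+y. ?f x y \<partial>lborel)"
        by (intro nn_integral_cong) (auto simp: indicator_def mult_ac)
      finally show "q k x * indicator {0<..} x * indicator {..<t} x = (\<integral>\<^sup>+y. ?f x y \<partial>lborel)" .
    qed
    also have "\<dots> = (\<integral>\<^sup>+y. (\<integral>\<^sup>+x. ?f x y \<partial>lborel) \<partial>lborel)"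
      by (rule lborel_pair.Fubini') measurable
    also have "\<dots> = (\<integral>\<^sup>+y. (indicator {0<..} y * u y) *
      (ennreal (2 ^ k) * emeasure lborel {x. 0 < x \<and> x < t \<and> x \<le> y \<and> y < x + r k}) \<partial>lborel)"
    proof (rule nn_integral_cong)
      fix y :: real
      let ?S = "{x. 0 < x \<and> x < t \<and> x \<le> y \<and> y < x + r k}"
      have "(\<integral>\<^sup>+x. ?f x y \<partial>lborel) = (\<integral>\<^sup>+x. (indicator {0<..} y * u y * ennreal (2 ^ k)) * indicator ?S x \<partial>lborel)"
        by (intro nn_integral_cong) (auto simp: indicator_def)
      also have "\<dots> = (indicator {0<..} y * u y * ennreal (2 ^ k)) * emeasure lborel ?S"
        by (rule nn_integral_cmult_indicator) measurable
      finally show "(\<integral>\<^sup>+x. ?f x y \<partial>lborel) = (indicator {0<..} y * u y) * (ennreal (2 ^ k) * emeasure lborel ?S)"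
        by (simp add: mult_ac)
    qed
    finally show ?thesis .
  qed
  have one: "ennreal (2 ^ k) * ennreal (r k) = 1" for k
    by (simp add: r_def ennreal_mult[symmetric] power_mult_distrib[symmetric])
  have Q_le: "?Q k t \<le> W t + W (r k)" if t: "0 \<le> t" for k t
  proof -
    have "?Q k t \<le> (\<integral>\<^sup>+y. (indicator {0<..} y * u y) * indicator {..<t + r k} y \<partial>lborel)"
      unfolding Q_eq
    proof (intro nn_integral_mono mult_left_mono)
      fix y
      let ?S = "{x. 0 < x \<and> x < t \<and> x \<le> y \<and> y < x + r k}"
      show "ennreal (2 ^ k) * emeasure lborel ?S \<le> indicator {..<t + r k} y"
      proof (cases "y < t + r k")
        case True
        have "emeasure lborel ?S \<le> emeasure lborel {y - r k<..y}" by (rule emeasure_mono) auto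
        then have "ennreal (2 ^ k) * emeasure lborel ?S \<le> ennreal (2 ^ k) * ennreal (r k)"
          using r(1)[of k] by (intro mult_left_mono) auto
        then show ?thesis using True by (simp only: one) simp
      next
        case False
        then have "?S = {}" by auto
        then have "emeasure lborel ?S = 0" by (simp only: emeasure_empty)
        then show ?thesis by (simp only: mult_zero_right) simp
      qed
    qed simp
    also have "\<dots> = W (t + r k)"
      unfolding WM M_def by (rule emeasure_density[symmetric]) auto
    also have "\<dots> = W t + emeasure M {t..<t + r k}" using r(1)[of k] by (intro incr) simp
    also have "emeasure M {t..<t + r k} \<le> emeasure M {0..<0 + r k}"
      using t r(1)[of k] by (intro slide) auto
    also have "emeasure M {0..<0 + r k} = W (r k)"
      using incr[of "r k" 0] W0 r(1)[of k] by simp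
    finally show ?thesis by (simp add: add_left_mono)
  qed
  have Q_ge: "W t \<le> ?Q k t + W (r k)" for k t
  proof -
    have "W t \<le> emeasure M ({..<r k} \<union> {r k..<t})"
      unfolding WM by (rule emeasure_mono) (auto simp: M_def)
    also have "\<dots> \<le> emeasure M {..<r k} + emeasure M {r k..<t}"
      by (rule emeasure_subadditive) (auto simp: M_def)
    also have "emeasure M {r k..<t} = (\<integral>\<^sup>+y. (indicator {0<..} y * u y) * indicator {r k..<t} y \<partial>lborel)"
      unfolding M_def by (rule emeasure_density) auto
    also have "\<dots> \<le> ?Q k t"
      unfolding Q_eq
    proof (intro nn_integral_mono mult_left_mono)
      fix y
      let ?S = "{x. 0 < x \<and> x < t \<and> x \<le> y \<and> y < x + r k}"
      show "indicator {r k..<t} y \<le> ennreal (2 ^ k) * emeasure lborel ?S"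
      proof (cases "y \<in> {r k..<t}")
        case True
        have "emeasure lborel {y - r k<..y} \<le> emeasure lborel ?S" by (rule emeasure_mono) (use True in auto)
        then have "ennreal (2 ^ k) * ennreal (r k) \<le> ennreal (2 ^ k) * emeasure lborel ?S"
          using r(1)[of k] by (intro mult_left_mono) auto
        then show ?thesis using True by (simp only: one) simp
      qed simp
    qed simp
    finally show ?thesis by (simp add: WM add.commute add_left_mono)
  qed
  have w_int: "(\<integral>\<^sup>+x. w x * indicator {0<..} x * indicator {..<t} x \<partial>lborel) = W t" if t: "0 \<le> t" for t
  proof -
    have inc: "incseq (\<lambda>k x. q k x * indicator {0<..} x * indicator {..<t} x)"
      by (intro incseq_SucI le_funI) (auto simp: indicator_def q_mono)
    have "(\<integral>\<^sup>+x. w x * indicator {0<..} x * indicator {..<t} x \<partial>lborel)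
      = (\<integral>\<^sup>+x. (SUP k. q k x * indicator {0<..} x * indicator {..<t} x) \<partial>lborel)"
      by (intro nn_integral_cong) (auto simp: w_def indicator_def)
    also have "\<dots> = (SUP k. ?Q k t)"
      by (rule nn_integral_monotone_convergence_SUP[OF inc]) simp
    finally have eq: "(\<integral>\<^sup>+x. w x * indicator {0<..} x * indicator {..<t} x \<partial>lborel) = (SUP k. ?Q k t)" .
    have "incseq (\<lambda>k. ?Q k t)"
      using inc by (auto simp: mono_def le_fun_def intro!: nn_integral_mono)
    then have lim: "(\<lambda>k. ?Q k t) \<longlonglongrightarrow> (SUP k. ?Q k t)" by (rule LIMSEQ_SUP)
    have "(SUP k. ?Q k t) \<le> W t"
    proof (rule LIMSEQ_le[OF lim])
      show "(\<lambda>k. W t + W (r k)) \<longlonglongrightarrow> W t"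
        using tendsto_add[OF tendsto_const W_small, of "W t"] by simp
    qed (use Q_le[OF t] in auto)
    moreover have "W t \<le> (SUP k. ?Q k t)"
    proof (rule LIMSEQ_le[OF tendsto_const])
      show "(\<lambda>k. ?Q k t + W (r k)) \<longlonglongrightarrow> (SUP k. ?Q k t)"
        using tendsto_add[OF lim W_small] by simp
    qed (use Q_ge in auto)
    ultimately show ?thesis using eq by simp
  qed
  have "AE s in lborel. 0 < s \<longrightarrow> u s = w s * indicator {0<..} s"
  proof (rule AE_eq_if_cumulative_eq)
    fix t
    show "cumulative u (ennreal t) < top" by (rule fin)
    have "cumulative (\<lambda>s. w s * indicator {0<..} s) (ennreal t)
      = (\<integral>\<^sup>+x. w x * indicator {0<..} x * indicator {..<t} x \<partial>lborel)"
      unfolding cumulative_def by (intro nn_integral_cong) (auto simp: indicator_def ennreal_less_iff)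
    also have "\<dots> = W t"
    proof (cases "0 \<le> t")
      case False
      then have "(\<integral>\<^sup>+x. w x * indicator {0<..} x * indicator {..<t} x \<partial>lborel) = (\<integral>\<^sup>+x. 0 \<partial>(lborel::real measure))"
        by (intro nn_integral_cong) (auto simp: indicator_def)
      then show ?thesis using False by (simp add: W_def ennreal_neg)
    qed (rule w_int)
    finally show "cumulative u (ennreal t) = cumulative (\<lambda>s. w s * indicator {0<..} s) (ennreal t)"
      by (simp add: W_def)
  qed measurable
  then have "AE s in lborel. 0 < s \<longrightarrow> u s = w s"
    by eventually_elim (auto simp: indicator_def)
  then show thesis using that w_anti by blast
qed

section \<open>The Hardy-Littlewood inequality and ranks\<close>

text \<open>
  The truncated mass is the integral of the rearrangement over \<open>(0, m)\<close>: this is the Choquet formula for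
  the profile that is the indicator of \<open>(0, m)\<close>.
\<close>

lemma cumulative_rearr:
  fixes h :: "'a::euclidean_space \<Rightarrow> real"
  assumes [measurable]: "h \<in> borel_measurable lebesgue"
  shows "cumulative (rearr h) m = truncated_mass m h"
proof -
  let ?u = "indicator {s. ennreal s < m} :: real \<Rightarrow> ennreal"
  have "cumulative (rearr h) m = (\<integral>\<^sup>+t. indicator {0<..} t * (rearr h t * ?u t) \<partial>lborel)"
    unfolding cumulative_def by (intro nn_integral_cong) (auto simp: indicator_def)
  also have "\<dots> = choquet ?u h"
    by (rule nn_integral_rearr_eq_choquet) measurable
  also have "\<dots> = truncated_mass m h"
    unfolding choquet_def truncated_mass_def
  proof (intro nn_integral_cong arg_cong2[where f="(*)"] refl)
    fix s
    let ?D = "{t. 0 < t \<and> ennreal t < m}"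
    have "cumulative ?u (distribution h s) = (\<integral>\<^sup>+t. indicator {t \<in> ?D. ennreal t < distribution h s} t \<partial>lborel)"
      unfolding cumulative_def by (intro nn_integral_cong) (auto simp: indicator_def)
    also have "\<dots> = emeasure lborel {t \<in> ?D. ennreal t < distribution h s}"
      by (rule nn_integral_indicator) measurable
    also have "\<dots> = min (emeasure lborel ?D) (distribution h s)"
      by (rule emeasure_downset_below) (auto intro: le_less_trans ennreal_leI)
    finally show "cumulative ?u (distribution h s) = min (distribution h s) m"
      by (simp add: emeasure_positive_below min.commute)
  qed
  finally show ?thesis .
qed

text \<open>
  The layer cake formula for both factors of a product.
\<close>

lemma nn_integral_product_levels:
  fixes f h :: "'a::euclidean_space \<Rightarrow> real"
  assumes [measurable]: "f \<in> borel_measurable lebesgue" "h \<in> borel_measurable lebesgue"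
  shows "(\<integral>\<^sup>+x. ennreal \<bar>f x * h x\<bar> \<partial>lebesgue) = (\<integral>\<^sup>+s. indicator {0<..} s *
    (\<integral>\<^sup>+t. indicator {0<..} t * emeasure lebesgue ({x. s < \<bar>f x\<bar>} \<inter> {x. t < \<bar>h x\<bar>}) \<partial>lborel) \<partial>lborel)"
proof -
  interpret P: pair_sigma_finite "lebesgue :: 'a measure" "lborel :: real measure"
    by (intro pair_sigma_finite.intro sigma_finite_lebesgue lborel.sigma_finite_measure_axioms)
  let ?k = "\<lambda>f x s. indicator {z. 0 < snd z \<and> snd z < \<bar>f (fst z)\<bar>} (x, s) :: ennreal"
  have abs_eq: "ennreal \<bar>f x\<bar> = (\<integral>\<^sup>+s. ?k f x s \<partial>lborel)" for f :: "'a \<Rightarrow> real" and x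
  proof -
    have "(\<integral>\<^sup>+s. ?k f x s \<partial>lborel) = (\<integral>\<^sup>+s. indicator {0<..<\<bar>f x\<bar>} s \<partial>lborel)"
      by (intro nn_integral_cong) (auto simp: indicator_def)
    then show ?thesis by simp
  qed
  have slice[measurable]: "(\<lambda>s. ?k f x s) \<in> borel_measurable lborel" for f :: "'a \<Rightarrow> real" and x
  proof -
    have "(\<lambda>s. ?k f x s) = indicator {0<..<\<bar>f x\<bar>}" by (auto simp: fun_eq_iff indicator_def)
    then show ?thesis by simp
  qed
  have "(\<integral>\<^sup>+x. ennreal \<bar>f x * h x\<bar> \<partial>lebesgue) = (\<integral>\<^sup>+x. (\<integral>\<^sup>+s. ?k f x s * ennreal \<bar>h x\<bar> \<partial>lborel) \<partial>lebesgue)"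
  proof (rule nn_integral_cong)
    fix x
    have "ennreal \<bar>f x * h x\<bar> = ennreal \<bar>f x\<bar> * ennreal \<bar>h x\<bar>" by (simp add: abs_mult ennreal_mult)
    also have "\<dots> = (\<integral>\<^sup>+s. ?k f x s * ennreal \<bar>h x\<bar> \<partial>lborel)"
      unfolding abs_eq[of f] by (rule nn_integral_multc[symmetric]) (rule slice)
    finally show "ennreal \<bar>f x * h x\<bar> = (\<integral>\<^sup>+s. ?k f x s * ennreal \<bar>h x\<bar> \<partial>lborel)" .
  qed
  also have "\<dots> = (\<integral>\<^sup>+s. (\<integral>\<^sup>+x. ?k f x s * ennreal \<bar>h x\<bar> \<partial>lebesgue) \<partial>lborel)"
    by (rule P.Fubini'[symmetric]) measurable
  also have "\<dots> = (\<integral>\<^sup>+s. indicator {0<..} s *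
    (\<integral>\<^sup>+t. indicator {0<..} t * emeasure lebesgue ({x. s < \<bar>f x\<bar>} \<inter> {x. t < \<bar>h x\<bar>}) \<partial>lborel) \<partial>lborel)"
  proof (rule nn_integral_cong)
    fix s :: real
    let ?A = "{x. s < \<bar>f x\<bar>}"
    have "(\<integral>\<^sup>+x. ?k f x s * ennreal \<bar>h x\<bar> \<partial>lebesgue)
      = (\<integral>\<^sup>+x. indicator {0<..} s * (indicator ?A x * ennreal \<bar>h x\<bar>) \<partial>lebesgue)"
      by (intro nn_integral_cong) (auto simp: indicator_def)
    also have "\<dots> = indicator {0<..} s * (\<integral>\<^sup>+x. indicator ?A x * ennreal \<bar>h x\<bar> \<partial>lebesgue)"
      by (rule nn_integral_cmult) measurable
    also have "(\<integral>\<^sup>+x. indicator ?A x * ennreal \<bar>h x\<bar> \<partial>lebesgue)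
      = (\<integral>\<^sup>+x. (\<integral>\<^sup>+t. indicator ?A x * ?k h x t \<partial>lborel) \<partial>lebesgue)"
      unfolding abs_eq[of h] by (intro nn_integral_cong nn_integral_cmult[symmetric]) (rule slice)
    also have "\<dots> = (\<integral>\<^sup>+t. (\<integral>\<^sup>+x. indicator ?A x * ?k h x t \<partial>lebesgue) \<partial>lborel)"
      by (rule P.Fubini'[symmetric]) measurable
    also have "\<dots> = (\<integral>\<^sup>+t. indicator {0<..} t * emeasure lebesgue (?A \<inter> {x. t < \<bar>h x\<bar>}) \<partial>lborel)"
    proof (rule nn_integral_cong)
      fix t :: real
      have "(\<integral>\<^sup>+x. indicator ?A x * ?k h x t \<partial>lebesgue)
        = (\<integral>\<^sup>+x. indicator {0<..} t * indicator (?A \<inter> {x. t < \<bar>h x\<bar>}) x \<partial>lebesgue)"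
        by (intro nn_integral_cong) (auto simp: indicator_def)
      also have "\<dots> = indicator {0<..} t * emeasure lebesgue (?A \<inter> {x. t < \<bar>h x\<bar>})"
        by (rule nn_integral_cmult_indicator) measurable
      finally show "(\<integral>\<^sup>+x. indicator ?A x * ?k h x t \<partial>lebesgue)
        = indicator {0<..} t * emeasure lebesgue (?A \<inter> {x. t < \<bar>h x\<bar>})" .
    qed
    finally show "(\<integral>\<^sup>+x. ?k f x s * ennreal \<bar>h x\<bar> \<partial>lebesgue) = indicator {0<..} s *
      (\<integral>\<^sup>+t. indicator {0<..} t * emeasure lebesgue (?A \<inter> {x. t < \<bar>h x\<bar>}) \<partial>lborel)" .
  qed
  finally show ?thesis .
qed

text \<open>
  In the layer cake formula, the measure of an intersection is at most the smaller of the two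
  measures, with equality for the symmetrized sets.
\<close>

lemma Hardy_Littlewood:
  fixes f h :: "'a::euclidean_space \<Rightarrow> real"
  assumes [measurable]: "f \<in> borel_measurable lebesgue" "h \<in> borel_measurable lebesgue"
  shows "(\<integral>\<^sup>+x. ennreal \<bar>f x * h x\<bar> \<partial>lebesgue) \<le> (\<integral>\<^sup>+t. indicator {0<..} t * (rearr f t * rearr h t) \<partial>lborel)"
proof -
  have "(\<integral>\<^sup>+x. ennreal \<bar>f x * h x\<bar> \<partial>lebesgue)
    \<le> (\<integral>\<^sup>+s. indicator {0<..} s * truncated_mass (distribution f s) h \<partial>lborel)"
    unfolding nn_integral_product_levels[OF assms] truncated_mass_def
  proof (intro nn_integral_mono mult_left_mono min.boundedI)
    fix s t
    show "emeasure lebesgue ({x. s < \<bar>f x\<bar>} \<inter> {x. t < \<bar>h x\<bar>}) \<le> distribution h t"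
      unfolding distribution_def by (rule emeasure_mono) auto
    show "emeasure lebesgue ({x. s < \<bar>f x\<bar>} \<inter> {x. t < \<bar>h x\<bar>}) \<le> distribution f s"
      unfolding distribution_def by (rule emeasure_mono) auto
  qed simp_all
  also have "\<dots> = choquet (rearr h) f"
    unfolding choquet_def by (simp add: cumulative_rearr)
  also have "\<dots> = (\<integral>\<^sup>+t. indicator {0<..} t * (rearr f t * rearr h t) \<partial>lborel)"
    by (rule nn_integral_rearr_eq_choquet[symmetric]) measurable
  finally show ?thesis .
qed

text \<open>
  The rank of \<open>x\<close> is the volume of the points at which \<open>g\<close> is larger than at \<open>x\<close>.  Without ties and
  with finite ranks, the set of points of rank below \<open>t\<close> is a superlevel set of \<open>g\<close>, up to a null
  set, and has measure \<open>t\<close>.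
\<close>

lemma rank_distr:
  fixes g :: "'a::euclidean_space \<Rightarrow> real"
  assumes g[measurable]: "g \<in> borel_measurable lebesgue" and pos: "\<And>x. 0 < g x"
    and fin: "\<And>c. 0 < c \<Longrightarrow> distribution g c < top"
    and null: "\<And>c. emeasure lebesgue {x. g x = c} = 0"
  shows "distr lebesgue borel (\<lambda>x. enn2real (distribution g (g x))) = pos_lborel"
proof -
  let ?\<rho> = "\<lambda>x. enn2real (distribution g (g x))"
  have [measurable]: "?\<rho> \<in> borel_measurable lebesgue" by measurable
  have d: "distribution g c = emeasure lebesgue {x. c < g x}" for c
    using pos by (simp add: distribution_def abs_of_pos)
  have ge: "emeasure lebesgue {x. c \<le> g x} = distribution g c" for c
    unfolding d
  proof (rule emeasure_eq_AE)
    have "{x. g x = c} \<in> null_sets lebesgue"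
    proof (rule null_setsI[OF null])
      have "{x \<in> space lebesgue. g x = c} \<in> sets lebesgue" by measurable
      then show "{x. g x = c} \<in> sets lebesgue" by simp
    qed
    then have "AE x in lebesgue. x \<notin> {x. g x = c}" by (rule AE_not_in)
    then show "AE x in lebesgue. (x \<in> {x. c \<le> g x}) = (x \<in> {x. c < g x})"
      by eventually_elim auto
    have "{x \<in> space lebesgue. c \<le> g x} \<in> sets lebesgue" by measurable
    then show "{x. c \<le> g x} \<in> sets lebesgue" by simp
  qed measurable
  have inv_mono: "1 / real (Suc n) \<le> 1 / real (Suc m)" if "m \<le> n" for m n
    using that by (simp add: frac_le)
  have main: "emeasure lebesgue {x. ?\<rho> x < t} = ennreal t" if t: "0 < t" for t
  proof -
    define S where "S = {c. 0 < c \<and> distribution g c < ennreal t}"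
    have up: "c' \<in> S" if "c \<in> S" "c \<le> c'" for c c'
      using that distribution_antimono[OF g that(2)] by (auto simp: S_def)
    have rS: "?\<rho> x < t \<longleftrightarrow> g x \<in> S" for x
      using fin[OF pos[of x]] pos[of x] t by (cases "distribution g (g x)") (auto simp: S_def ennreal_less_iff)
    obtain c1 where c1: "c1 \<in> S"
    proof -
      have "(\<lambda>n. emeasure lebesgue {x. real (Suc n) < g x}) \<longlonglongrightarrow> emeasure lebesgue (\<Inter>n. {x. real (Suc n) < g x})"
      proof (rule Lim_emeasure_decseq)
        show "decseq (\<lambda>n. {x. real (Suc n) < g x})" by (auto simp: decseq_def)
        show "emeasure lebesgue {x. real (Suc n) < g x} \<noteq> \<infinity>" for n
        proof -
          have "0 < real (Suc n)" by simp
          from fin[OF this] show ?thesis unfolding d infinity_ennreal_def by (rule less_imp_neq)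
        qed
      qed auto
      moreover have "(\<Inter>n. {x. real (Suc n) < g x}) = {}"
      proof -
        have "\<exists>n. \<not> real (Suc n) < g x" for x
          using reals_Archimedean2[of "g x"] by (metis less_Suc_eq less_asym of_nat_less_iff order.strict_trans lessI)
        then show ?thesis by blast
      qed
      ultimately have "(\<lambda>n. distribution g (real (Suc n))) \<longlonglongrightarrow> 0" by (simp add: d)
      then have "\<forall>\<^sub>F n in sequentially. distribution g (real (Suc n)) < ennreal t"
        by (rule order_tendstoD) (use t in simp)
      then obtain n where "distribution g (real (Suc n)) < ennreal t"
        by (auto simp: eventually_sequentially)
      then show thesis using that[of "real (Suc n)"] by (simp add: S_def)
    qed
    obtain c2 where c2: "0 < c2" "c2 \<notin> S"
    proof -
      have "(\<lambda>n. emeasure lebesgue {x. 1 / real (Suc n) < g x}) \<longlonglongrightarrow> emeasure lebesgue (\<Union>n. {x. 1 / real (Suc n) < g x})"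
      proof (rule Lim_emeasure_incseq)
        show "incseq (\<lambda>n. {x. 1 / real (Suc n) < g x})"
          by (auto simp: incseq_def simp del: of_nat_Suc dest: inv_mono)
      qed auto
      moreover have "(\<Union>n. {x. 1 / real (Suc n) < g x}) = UNIV"
        using pos nat_approx_posE by (metis (mono_tags, lifting) UNIV_I UN_iff mem_Collect_eq subsetI subset_antisym top_greatest)
      ultimately have "(\<lambda>n. distribution g (1 / real (Suc n))) \<longlonglongrightarrow> top" by (simp add: d emeasure_lborel_UNIV)
      then have "\<forall>\<^sub>F n in sequentially. ennreal t < distribution g (1 / real (Suc n))"
        by (rule order_tendstoD) simp
      then obtain n where "ennreal t < distribution g (1 / real (Suc n))"
        by (auto simp: eventually_sequentially)
      then show thesis using that[of "1 / real (Suc n)"] by (auto simp: S_def)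
    qed
    \<comment> \<open>Rank below t means g x in S, and S is a ray with endpoint c0; whether it contains
      c0 does not matter, as g takes the value c0 on a null set only.\<close>
    define c0 where "c0 = Inf S"
    have bdd: "bdd_below S" by (rule bdd_belowI[of _ 0]) (simp add: S_def)
    have low: "c2 \<le> c" if "c \<in> S" for c using up[OF that, of c2] c2 by force
    have c0: "c2 \<le> c0" unfolding c0_def using c1 low by (intro cInf_greatest) auto
    have above: "c \<in> S" if "c0 < c" for c
    proof -
      have "S \<noteq> {}" using c1 by blast
      then obtain c' where "c' \<in> S" "c' < c" using \<open>c0 < c\<close> cInf_less_iff[OF _ bdd, of c] unfolding c0_def by blast
      then show ?thesis using up by force
    qed
    have left: "0 < c0 - c0 / real (n + 2)" "c0 - c0 / real (n + 2) < c0" for n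
    proof -
      have "c0 / real (n + 2) \<le> c0 / 2" using c0 c2 by (intro divide_left_mono) auto
      then show "0 < c0 - c0 / real (n + 2)" using c0 c2 by linarith
      show "c0 - c0 / real (n + 2) < c0" using c0 c2 by simp
    qed
    have below: "c0 \<le> c" if "c \<in> S" for c unfolding c0_def by (rule cInf_lower[OF that bdd])
    have "emeasure lebesgue {x. ?\<rho> x < t} = distribution g c0"
    proof (rule antisym)
      have "{x. ?\<rho> x < t} \<subseteq> {x. c0 \<le> g x}" using rS below by auto
      moreover have "{x. c0 \<le> g x} \<in> sets lebesgue"
      proof -
        have "{x \<in> space lebesgue. c0 \<le> g x} \<in> sets lebesgue" by measurable
        then show ?thesis by simp
      qed
      ultimately show "emeasure lebesgue {x. ?\<rho> x < t} \<le> distribution g c0"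
        unfolding ge[symmetric] by (rule emeasure_mono)
      have "{x. c0 < g x} \<subseteq> {x. ?\<rho> x < t}" using rS above by auto
      moreover have "{x. ?\<rho> x < t} \<in> sets lebesgue"
      proof -
        have "{x \<in> space lebesgue. ?\<rho> x < t} \<in> sets lebesgue" by measurable
        then show ?thesis by simp
      qed
      ultimately show "distribution g c0 \<le> emeasure lebesgue {x. ?\<rho> x < t}"
        unfolding d by (rule emeasure_mono)
    qed
    also have "distribution g c0 = ennreal t"
    proof (rule antisym)
      have "(\<lambda>n. emeasure lebesgue {x. c0 + 1 / real (Suc n) < g x}) \<longlonglongrightarrow> emeasure lebesgue (\<Union>n. {x. c0 + 1 / real (Suc n) < g x})"
      proof (rule Lim_emeasure_incseq)
        show "incseq (\<lambda>n. {x. c0 + 1 / real (Suc n) < g x})"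
          by (auto simp: incseq_def simp del: of_nat_Suc dest: inv_mono)
      qed auto
      moreover have "(\<Union>n. {x. c0 + 1 / real (Suc n) < g x}) = {x. c0 < g x}"
      proof (intro set_eqI iffI)
        fix x assume "x \<in> {x. c0 < g x}"
        then obtain n where "1 / real (Suc n) < g x - c0" using nat_approx_posE[of "g x - c0"] by auto
        then show "x \<in> (\<Union>n. {x. c0 + 1 / real (Suc n) < g x})" by (auto intro!: exI[of _ n])
      next
        fix x assume "x \<in> (\<Union>n. {x. c0 + 1 / real (Suc n) < g x})"
        then obtain n where "c0 + 1 / real (Suc n) < g x" by auto
        moreover have "0 < 1 / real (Suc n)" by simp
        ultimately show "x \<in> {x. c0 < g x}" by (simp only: mem_Collect_eq)
      qed
      ultimately have "(\<lambda>n. distribution g (c0 + 1 / real (Suc n))) \<longlonglongrightarrow> distribution g c0" by (simp add: d)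
      moreover have "distribution g (c0 + 1 / real (Suc n)) \<le> ennreal t" for n
        using above[of "c0 + 1 / real (Suc n)"] by (simp add: S_def less_imp_le)
      ultimately show "distribution g c0 \<le> ennreal t" by (intro LIMSEQ_le_const2) auto
    next
      have "(\<lambda>n. emeasure lebesgue {x. c0 - c0 / real (n + 2) < g x}) \<longlonglongrightarrow> emeasure lebesgue (\<Inter>n. {x. c0 - c0 / real (n + 2) < g x})"
      proof (rule Lim_emeasure_decseq)
        show "decseq (\<lambda>n. {x. c0 - c0 / real (n + 2) < g x})"
        proof (intro decseq_SucI subsetI)
          fix n x assume x: "x \<in> {x. c0 - c0 / real (Suc n + 2) < g x}"
          have "c0 / real (Suc n + 2) \<le> c0 / real (n + 2)"
            using c0 c2 by (intro divide_left_mono) auto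
          then show "x \<in> {x. c0 - c0 / real (n + 2) < g x}" using x by simp
        qed
        show "emeasure lebesgue {x. c0 - c0 / real (n + 2) < g x} \<noteq> \<infinity>" for n
        proof -
          from fin[OF left(1)] show ?thesis unfolding d infinity_ennreal_def by (rule less_imp_neq)
        qed
      qed auto
      moreover have "(\<Inter>n. {x. c0 - c0 / real (n + 2) < g x}) = {x. c0 \<le> g x}"
      proof (intro set_eqI iffI)
        fix x assume x: "x \<in> (\<Inter>n. {x. c0 - c0 / real (n + 2) < g x})"
        have "(\<lambda>n. c0 - c0 / real (n + 2)) \<longlonglongrightarrow> c0" by real_asymp
        then have "c0 \<le> g x" by (rule LIMSEQ_le_const2) (use x in \<open>auto intro: less_imp_le\<close>)
        then show "x \<in> {x. c0 \<le> g x}" by simp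
      next
        fix x assume x: "x \<in> {x. c0 \<le> g x}"
        then have "c0 - c0 / real (n + 2) < g x" for n using left(2)[of n] by simp
        then show "x \<in> (\<Inter>n. {x. c0 - c0 / real (n + 2) < g x})" by blast
      qed
      ultimately have "(\<lambda>n. distribution g (c0 - c0 / real (n + 2))) \<longlonglongrightarrow> distribution g c0"
        using ge[of c0] unfolding d by (simp only:)
      moreover have "ennreal t \<le> distribution g (c0 - c0 / real (n + 2))" for n
      proof -
        have "c0 - c0 / real (n + 2) \<notin> S" using below left(2)[of n] by force
        then show ?thesis using left(1)[of n] by (simp add: S_def not_less)
      qed
      ultimately show "ennreal t \<le> distribution g c0" by (intro LIMSEQ_le_const) auto
    qed
    finally show ?thesis .
  qed
  have all: "emeasure (distr lebesgue borel ?\<rho>) {..<t} = ennreal t" for t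
  proof (cases "0 < t")
    case True
    then show ?thesis using main by (subst emeasure_distr) (auto simp: vimage_def)
  next
    case False
    have "\<not> ?\<rho> x < t" for x using False enn2real_nonneg[of "distribution g (g x)"] by linarith
    then have "?\<rho> -` {..<t} = {}" by auto
    then show ?thesis using False by (subst emeasure_distr) (auto simp: ennreal_neg)
  qed
  show ?thesis
    by (rule measure_eqI_Iio) (simp_all add: all emeasure_pos_lborel_Iio)
qed

section \<open>Duality for a decreasing profile\<close>

text \<open>
  Composing the profile with the rank of \<open>g\<close> gives \<open>h\<close>.  It has the same distribution as \<open>w\<close>, because
  the rank preserves measure, and its superlevel sets are nested with those of \<open>F\<close>, because both
  functions increase with \<open>g\<close>.  Nested sets meet in the smaller one, so the Hardy-Littlewood
  inequality becomes an equality for \<open>F\<close> and \<open>h\<close>.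
\<close>

lemma comonotone_partner:
  fixes F g :: "'a::euclidean_space \<Rightarrow> real"
  assumes F[measurable]: "F \<in> borel_measurable lebesgue" and F0: "\<And>x. 0 \<le> F x"
    and g[measurable]: "g \<in> borel_measurable lebesgue" and pos: "\<And>x. 0 < g x"
    and fin: "\<And>c. 0 < c \<Longrightarrow> distribution g c < top"
    and null: "\<And>c. emeasure lebesgue {x. g x = c} = 0"
    and order: "\<And>x y. g x \<le> g y \<Longrightarrow> F x \<le> F y"
    and w[measurable]: "w \<in> borel_measurable borel" and anti: "antimono_on {0<..} w"
    and wfin: "\<And>s. 0 < s \<Longrightarrow> w s < top"
  obtains h where "h \<in> borel_measurable lebesgue"
    "\<And>t. 0 < t \<Longrightarrow> distribution h t = profile_level w t"
    "choquet w F \<le> (\<integral>\<^sup>+x. ennreal \<bar>F x * h x\<bar> \<partial>lebesgue)"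
proof -
  define \<rho> where "\<rho> x = enn2real (distribution g (g x))" for x
  have [measurable]: "\<rho> \<in> borel_measurable lebesgue" unfolding \<rho>_def by measurable
  have distr: "distr lebesgue borel \<rho> = pos_lborel"
    using rank_distr[OF g pos fin null] unfolding \<rho>_def .
  have \<rho>_anti: "\<rho> y \<le> \<rho> x" if "g x \<le> g y" for x y
    unfolding \<rho>_def using distribution_antimono[OF g that] fin[OF pos[of x]]
    by (intro enn2real_mono)
  have push: "emeasure lebesgue {x. \<rho> x \<in> S} = emeasure lborel ({0<..} \<inter> S)" if "S \<in> sets borel" for S
  proof -
    have "emeasure lebesgue {x. \<rho> x \<in> S} = emeasure (distr lebesgue borel \<rho>) S"
      using that by (subst emeasure_distr) (simp_all add: vimage_def)
    then show ?thesis unfolding distr using emeasure_pos_lborel[OF that] by simp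
  qed
  define h where "h x = (if 0 < \<rho> x then enn2real (w (\<rho> x)) else 0)" for x
  have h[measurable]: "h \<in> borel_measurable lebesgue" unfolding h_def by measurable
  have h_iff: "t < \<bar>h x\<bar> \<longleftrightarrow> 0 < \<rho> x \<and> ennreal t < w (\<rho> x)" if "0 < t" for t x
    using wfin[of "\<rho> x"] that by (cases "w (\<rho> x)") (auto simp: h_def ennreal_less_iff)
  have dist: "distribution h t = profile_level w t" if t: "0 < t" for t
  proof -
    let ?S = "{s. 0 < s \<and> ennreal t < w s}"
    have "distribution h t = emeasure lebesgue {x. \<rho> x \<in> ?S}"
      by (simp add: distribution_def h_iff[OF t])
    also have "\<dots> = emeasure lborel ({0<..} \<inter> ?S)" by (rule push) measurable
    also have "{0<..} \<inter> ?S = ?S" by auto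
    finally show ?thesis by (simp add: profile_level_def)
  qed
  \<comment> \<open>Points of rank 0, where the profile has no meaning, form a null set.\<close>
  have zero: "AE x in lebesgue. 0 < \<rho> x"
  proof -
    have "{x. \<rho> x \<in> {..0}} \<in> null_sets lebesgue"
    proof (rule null_setsI)
      have "{0<..} \<inter> {..0} = ({} :: real set)" by auto
      then show "emeasure lebesgue {x. \<rho> x \<in> {..0}} = 0" by (subst push) simp_all
      have "{x \<in> space lebesgue. \<rho> x \<in> {..0}} \<in> sets lebesgue" by measurable
      then show "{x. \<rho> x \<in> {..0}} \<in> sets lebesgue" by simp
    qed
    then have "AE x in lebesgue. x \<notin> {x. \<rho> x \<in> {..0}}" by (rule AE_not_in)
    then show ?thesis by eventually_elim (auto simp: not_le)
  qed
  \<comment> \<open>If x lies in the superlevel set of h but not in that of F, then every y in the latter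
    has larger g and so smaller rank than x, which puts it into the superlevel set of h.\<close>
  have nested: "min (distribution h t) (distribution F s)
    \<le> emeasure lebesgue ({x. s < \<bar>F x\<bar>} \<inter> {x. t < \<bar>h x\<bar>})" if t: "0 < t" for s t
  proof (cases "\<exists>x. t < \<bar>h x\<bar> \<and> \<not> s < \<bar>F x\<bar>")
    case True
    then obtain x where x: "t < \<bar>h x\<bar>" "\<bar>F x\<bar> \<le> s" by (auto simp: not_less)
    have "distribution F s \<le> emeasure lebesgue ({x. s < \<bar>F x\<bar>} \<inter> {x. t < \<bar>h x\<bar>})"
      unfolding distribution_def
    proof (rule emeasure_mono_AE)
      show "AE y in lebesgue. y \<in> {x. s < \<bar>F x\<bar>} \<longrightarrow> y \<in> {x. s < \<bar>F x\<bar>} \<inter> {x. t < \<bar>h x\<bar>}"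
        using zero
      proof eventually_elim
        case (elim y)
        have "t < \<bar>h y\<bar>" if "s < \<bar>F y\<bar>"
        proof -
          have "\<not> F y \<le> F x" using x that F0[of x] F0[of y] by simp
          then have "g x \<le> g y" using order[of y x] by (meson linear)
          then have "\<rho> y \<le> \<rho> x" by (rule \<rho>_anti)
          then have "w (\<rho> x) \<le> w (\<rho> y)"
            using elim h_iff[OF t, of x] x by (intro monotone_onD[OF anti]) auto
          then show ?thesis using elim h_iff[OF t] x by (meson less_le_trans)
        qed
        then show ?case by simp
      qed
    qed measurable
    then show ?thesis by (rule min.coboundedI2)
  next
    case False
    then have "{x. s < \<bar>F x\<bar>} \<inter> {x. t < \<bar>h x\<bar>} = {x. t < \<bar>h x\<bar>}" by auto
    then show ?thesis by (simp add: distribution_def)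
  qed
  have "choquet w F \<le> (\<integral>\<^sup>+x. ennreal \<bar>F x * h x\<bar> \<partial>lebesgue)"
    unfolding choquet_def nn_integral_product_levels[OF F h] cumulative_eq_level_integral[OF w anti]
  proof (rule nn_integral_mono, rule mult_left_mono, rule nn_integral_mono)
    fix s t :: real
    show "indicator {0<..} t * min (profile_level w t) (distribution F s)
      \<le> indicator {0<..} t * emeasure lebesgue ({x. s < \<bar>F x\<bar>} \<inter> {x. t < \<bar>h x\<bar>})"
    proof (cases "0 < t")
      case True then show ?thesis using nested[OF True, of s] dist[OF True] by simp
    qed simp
  qed simp
  with h dist show thesis by (rule that)
qed

text \<open>
  Approximation of \<open>|f|\<close> from below.  The bounded support makes ranks finite, and values in a lattice
  leave gaps into which a term breaking ties fits.
\<close>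

definition dyadic_truncation :: "nat \<Rightarrow> ('a::euclidean_space \<Rightarrow> real) \<Rightarrow> 'a \<Rightarrow> real" where
  "dyadic_truncation k f x = indicator (ball 0 (real k)) x * (of_int \<lfloor>2 ^ k * \<bar>f x\<bar>\<rfloor> / 2 ^ k)"

lemma dyadic_truncation_measurable [measurable]:
  assumes [measurable]: "f \<in> borel_measurable lebesgue"
  shows "dyadic_truncation k f \<in> borel_measurable lebesgue"
proof -
  have "(\<lambda>y::real. of_int \<lfloor>2 ^ k * y\<rfloor> / 2 ^ k :: real) \<in> borel_measurable borel" by measurable
  moreover have "(\<lambda>x. \<bar>f x\<bar>) \<in> borel_measurable lebesgue" by measurable
  ultimately have "(\<lambda>x. of_int \<lfloor>2 ^ k * \<bar>f x\<bar>\<rfloor> / 2 ^ k :: real) \<in> borel_measurable lebesgue"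
    by (rule measurable_compose[rotated])
  moreover have "(indicator (ball 0 (real k)) :: 'a \<Rightarrow> real) \<in> borel_measurable lebesgue"
    by (rule borel_measurable_indicator) simp
  ultimately show ?thesis
    unfolding dyadic_truncation_def[abs_def] by (intro borel_measurable_times)
qed

lemma dyadic_truncation_nonneg: "0 \<le> dyadic_truncation k f x"
  by (simp add: dyadic_truncation_def)

lemma dyadic_truncation_le: "dyadic_truncation k f x \<le> \<bar>f x\<bar>"
proof -
  have "of_int \<lfloor>2 ^ k * \<bar>f x\<bar>\<rfloor> \<le> 2 ^ k * \<bar>f x\<bar>" by (rule of_int_floor_le)
  then show ?thesis by (simp add: dyadic_truncation_def indicator_def field_simps)
qed

lemma dyadic_truncation_Suc: "dyadic_truncation k f x \<le> dyadic_truncation (Suc k) f x"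
proof -
  let ?y = "2 ^ k * \<bar>f x\<bar>"
  have "2 * \<lfloor>?y\<rfloor> \<le> \<lfloor>2 * ?y\<rfloor>" by (simp add: le_floor_iff)
  then have "2 * (of_int \<lfloor>?y\<rfloor> :: real) \<le> of_int \<lfloor>2 * ?y\<rfloor>" by linarith
  then have "of_int \<lfloor>?y\<rfloor> / 2 ^ k \<le> (of_int \<lfloor>2 ^ Suc k * \<bar>f x\<bar>\<rfloor> :: real) / 2 ^ Suc k"
    by (simp add: field_simps)
  then show ?thesis by (auto simp: dyadic_truncation_def indicator_def)
qed

lemma dyadic_truncation_dense:
  assumes "s < \<bar>f x\<bar>"
  shows "\<exists>k. s < dyadic_truncation k f x"
proof -
  obtain k1 where k1: "norm x < real k1" using reals_Archimedean2 by blast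
  obtain k2 where k2: "(1 / 2) ^ k2 < \<bar>f x\<bar> - s"
    using real_arch_pow_inv[of "\<bar>f x\<bar> - s" "1 / 2"] assms by auto
  let ?k = "max k1 k2"
  have "(1 / 2 :: real) ^ ?k \<le> (1 / 2) ^ k2" by (rule power_decreasing) auto
  then have e: "(1 / 2) ^ ?k < \<bar>f x\<bar> - s" using k2 by (rule le_less_trans)
  have "2 ^ ?k * \<bar>f x\<bar> - 1 < of_int \<lfloor>2 ^ ?k * \<bar>f x\<bar>\<rfloor>" by linarith
  then have "(2 ^ ?k * \<bar>f x\<bar> - 1) / 2 ^ ?k < of_int \<lfloor>2 ^ ?k * \<bar>f x\<bar>\<rfloor> / 2 ^ ?k"
    by (intro divide_strict_right_mono) auto
  moreover have "(2 ^ ?k * \<bar>f x\<bar> - 1) / 2 ^ ?k = \<bar>f x\<bar> - (1 / 2) ^ ?k"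
    by (simp add: diff_divide_distrib power_one_over)
  moreover have "x \<in> ball 0 (real ?k)" using k1 by simp
  ultimately show ?thesis using e by (intro exI[of _ ?k]) (simp add: dyadic_truncation_def)
qed

text \<open>
  The term \<open>1 / (2\<^sup>k (1 + |x|))\<close> does not exceed the spacing \<open>1 / 2\<^sup>k\<close> of the values of the
  truncation, so adding it keeps their order.  It is positive and
  tends to \<open>0\<close> at infinity, so the distribution function stays finite.  Its level sets are spheres and
  the lattice is countable, so the level sets of the sum are null.
\<close>

lemma dyadic_rank_function:
  fixes f :: "'a::euclidean_space \<Rightarrow> real"
  assumes f[measurable]: "f \<in> borel_measurable lebesgue"
  obtains g where "g \<in> borel_measurable lebesgue" "\<And>x. 0 < g x"
    "\<And>c. 0 < c \<Longrightarrow> distribution g c < top" "\<And>c. emeasure lebesgue {x. g x = c} = 0"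
    "\<And>x y. g x \<le> g y \<Longrightarrow> dyadic_truncation k f x \<le> dyadic_truncation k f y"
proof -
  let ?F = "dyadic_truncation k f" and ?e = "\<lambda>x::'a. (1 / 2) ^ k / (1 + norm x)"
  define g where "g x = ?F x + ?e x" for x
  have int: "\<exists>j::int. ?F x = of_int j / 2 ^ k" for x
    by (cases "x \<in> ball 0 (real k)") (auto simp: dyadic_truncation_def intro: exI[of _ 0])
  have e: "0 < ?e x" "?e x \<le> (1 / 2) ^ k" for x :: 'a
  proof -
    have "0 < 1 + norm x" using norm_ge_zero[of x] by linarith
    then show "0 < ?e x" "?e x \<le> (1 / 2) ^ k" by (simp_all add: divide_le_eq)
  qed
  show thesis
  proof (rule that[of g])
    have "?e \<in> borel_measurable lebesgue" by (rule measurable_completion) measurable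
    then show "g \<in> borel_measurable lebesgue"
      unfolding g_def by (intro borel_measurable_add dyadic_truncation_measurable f)
    show g0: "0 < g x" for x using dyadic_truncation_nonneg[of k f x] e(1)[of x] by (simp add: g_def)
    show "distribution g c < top" if c: "0 < c" for c
    proof -
      let ?R = "max (real k) ((1 / 2) ^ k / c)"
      have "{x. c < \<bar>g x\<bar>} \<subseteq> cball 0 ?R"
      proof
        fix x assume "x \<in> {x. c < \<bar>g x\<bar>}"
        then have x: "c < g x" using g0[of x] by simp
        show "x \<in> cball 0 ?R"
        proof (cases "x \<in> ball 0 (real k)")
          case False
          then have "c < ?e x" using x by (simp add: g_def dyadic_truncation_def)
          moreover have p: "0 < 1 + norm x" using norm_ge_zero[of x] by linarith
          ultimately have "c * (1 + norm x) < (1 / 2) ^ k" by (simp add: less_divide_eq)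
          then have "1 + norm x < (1 / 2) ^ k / c" using c by (simp add: less_divide_eq mult.commute)
          then show ?thesis by simp
        qed simp
      qed
      then have "distribution g c \<le> emeasure lebesgue (cball 0 ?R :: 'a set)"
        unfolding distribution_def by (rule emeasure_mono) simp
      also have "\<dots> < top" using emeasure_bounded_finite[of "cball 0 ?R :: 'a set"] by simp
      finally show ?thesis .
    qed
    show "emeasure lebesgue {x. g x = c} = 0" for c
    proof -
      have "{x. g x = c} \<subseteq> (\<Union>j::int. sphere 0 ((1 / 2) ^ k / (c - of_int j / 2 ^ k) - 1))"
      proof
        fix x assume "x \<in> {x. g x = c}"
        moreover obtain j :: int where "?F x = of_int j / 2 ^ k" using int by blast
        ultimately have eq: "?e x = c - of_int j / 2 ^ k" by (auto simp: g_def)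
        have p: "0 < 1 + norm x" using norm_ge_zero[of x] by linarith
        have "(1 / 2) ^ k / ?e x = 1 + norm x" using p by simp
        then have "norm x = (1 / 2) ^ k / (c - of_int j / 2 ^ k) - 1" unfolding eq by simp
        then show "x \<in> (\<Union>j::int. sphere 0 ((1 / 2) ^ k / (c - of_int j / 2 ^ k) - 1))" by auto
      qed
      moreover have "negligible (\<Union>j::int. sphere (0::'a) ((1 / 2) ^ k / (c - of_int j / 2 ^ k) - 1))"
        by (intro negligible_countable_Union) (auto simp: negligible_sphere)
      ultimately have "negligible {x. g x = c}" by (rule negligible_subset[rotated])
      then show ?thesis by (simp only: negligible_iff_null_sets null_setsD1)
    qed
    show "?F x \<le> ?F y" if xy: "g x \<le> g y" for x y
    proof (rule ccontr)
      assume n: "\<not> ?F x \<le> ?F y"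
      obtain i j :: int where ij: "?F x = of_int i / 2 ^ k" "?F y = of_int j / 2 ^ k" using int by metis
      then have "of_int j < (of_int i :: real)" using n by (simp add: divide_le_cancel not_le divide_less_cancel)
      then have "j + 1 \<le> i" by simp
      then have "of_int (j + 1) \<le> (of_int i :: real)" by (simp only: of_int_le_iff)
      then have "of_int j + 1 \<le> (of_int i :: real)" by simp
      then have "(of_int j + 1) / 2 ^ k \<le> (of_int i :: real) / 2 ^ k" by (intro divide_right_mono) auto
      then have "?F y + (1 / 2) ^ k \<le> ?F x" unfolding ij by (simp add: add_divide_distrib power_one_over)
      then show False using xy e(1)[of x] e(2)[of y] by (simp add: g_def)
    qed
  qed
qed

lemma cumulative_SUP:
  assumes u[measurable]: "u \<in> borel_measurable borel" and m: "incseq m"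
  shows "cumulative u (SUP k. m k) = (SUP k. cumulative u (m k))"
proof -
  have "cumulative u (SUP k. m k) = (\<integral>\<^sup>+s. (SUP k. u s * indicator {s. 0 < s \<and> ennreal s < m k} s) \<partial>lborel)"
    unfolding cumulative_def
  proof (rule nn_integral_cong)
    fix s :: real
    show "u s * indicator {s. 0 < s \<and> ennreal s < (SUP k. m k)} s
      = (SUP k. u s * indicator {s. 0 < s \<and> ennreal s < m k} s)"
    proof (cases "0 < s \<and> ennreal s < (SUP k. m k)")
      case True
      then obtain k where k: "ennreal s < m k" by (auto simp: less_SUP_iff)
      have "(SUP k. u s * indicator {s. 0 < s \<and> ennreal s < m k} s) = u s"
      proof (rule antisym)
        show "(SUP k. u s * indicator {s. 0 < s \<and> ennreal s < m k} s) \<le> u s"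
          by (rule SUP_least) (auto simp: indicator_def)
        show "u s \<le> (SUP k. u s * indicator {s. 0 < s \<and> ennreal s < m k} s)"
          using True k by (intro SUP_upper2[of k]) auto
      qed
      then show ?thesis using True by simp
    next
      case False
      then have "\<not> (0 < s \<and> ennreal s < m k)" for k by (auto simp: less_SUP_iff)
      then show ?thesis using False by simp
    qed
  qed
  also have "\<dots> = (SUP k. cumulative u (m k))"
    unfolding cumulative_def
  proof (rule nn_integral_monotone_convergence_SUP)
    show "incseq (\<lambda>k s. u s * indicator {s. 0 < s \<and> ennreal s < m k} s)"
    proof (intro incseq_SucI le_funI mult_left_mono)
      fix k s
      have "m k \<le> m (Suc k)" using m by (rule incseq_SucD)
      then show "indicator {s. 0 < s \<and> ennreal s < m k} s \<le> (indicator {s. 0 < s \<and> ennreal s < m (Suc k)} s :: ennreal)"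
        by (auto simp: indicator_def intro: less_le_trans)
    qed simp
  qed measurable
  finally show ?thesis .
qed

text \<open>
  Superlevel sets of the approximations increase to those of \<open>|f|\<close>; apply monotone convergence
  inside the primitive and outside.
\<close>

lemma choquet_SUP_dyadic:
  fixes f :: "'a::euclidean_space \<Rightarrow> real"
  assumes f[measurable]: "f \<in> borel_measurable lebesgue" and u[measurable]: "u \<in> borel_measurable borel"
  shows "choquet u f = (SUP k. choquet u (dyadic_truncation k f))"
proof -
  let ?F = "\<lambda>k. dyadic_truncation k f"
  have level_inc: "incseq (\<lambda>k. {x. s < \<bar>?F k x\<bar>})" for s
    by (intro incseq_SucI) (auto simp: dyadic_truncation_nonneg intro: less_le_trans dyadic_truncation_Suc)
  have inc: "incseq (\<lambda>k. distribution (?F k) s)" for s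
    unfolding distribution_def using level_inc[of s]
    by (intro incseq_SucI emeasure_mono) (auto dest: incseq_SucD)
  have "distribution f s = (SUP k. distribution (?F k) s)" for s
  proof -
    have "{x. s < \<bar>f x\<bar>} = (\<Union>k. {x. s < \<bar>?F k x\<bar>})"
    proof (intro set_eqI iffI)
      fix x assume "x \<in> {x. s < \<bar>f x\<bar>}"
      then show "x \<in> (\<Union>k. {x. s < \<bar>?F k x\<bar>})"
        using dyadic_truncation_dense[of s f x] by (auto simp: dyadic_truncation_nonneg)
    next
      fix x assume "x \<in> (\<Union>k. {x. s < \<bar>?F k x\<bar>})"
      then obtain k where "s < ?F k x" by (auto simp: dyadic_truncation_nonneg)
      then show "x \<in> {x. s < \<bar>f x\<bar>}" using dyadic_truncation_le[of k f x] by simp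
    qed
    then have "distribution f s = emeasure lebesgue (\<Union>k. {x. s < \<bar>?F k x\<bar>})"
      by (simp only: distribution_def)
    also have "\<dots> = (SUP k. distribution (?F k) s)"
      unfolding distribution_def by (rule SUP_emeasure_incseq[symmetric]) (use level_inc in auto)
    finally show ?thesis .
  qed
  then have "choquet u f = (\<integral>\<^sup>+s. (SUP k. indicator {0<..} s * cumulative u (distribution (?F k) s)) \<partial>lborel)"
    unfolding choquet_def
    by (intro nn_integral_cong) (simp add: cumulative_SUP[OF u inc] SUP_mult_left_ennreal)
  also have "\<dots> = (SUP k. choquet u (?F k))"
    unfolding choquet_def
  proof (rule nn_integral_monotone_convergence_SUP)
    show "incseq (\<lambda>k s. indicator {0<..} s * cumulative u (distribution (?F k) s))"
      by (intro incseq_SucI le_funI mult_left_mono cumulative_mono incseq_SucD[OF inc]) simp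
  qed measurable
  finally show ?thesis .
qed

text \<open>
  A decreasing profile that is infinite at one point is infinite, hence not integrable, to the left
  of it.
\<close>

lemma finite_if_cumulative_finite:
  assumes anti: "antimono_on {0<..} w" and fin: "\<And>t. cumulative w (ennreal t) < top" and s: "0 < s"
  shows "w s < top"
proof (rule ccontr)
  assume "\<not> w s < top"
  then have top: "w s = top" using less_top[of "w s"] by blast
  have "top = (\<integral>\<^sup>+t. top * indicator {0<..<s} t \<partial>lborel)"
    using s by (subst nn_integral_cmult_indicator) (auto simp: ennreal_top_mult)
  also have "\<dots> \<le> cumulative w (ennreal s)"
    unfolding cumulative_def
  proof (rule nn_integral_mono)
    fix t
    have "w t = top" if "0 < t" "t < s" using monotone_onD[OF anti, of t s] that top by (simp add: top_unique)
    then show "top * indicator {0<..<s} t \<le> w t * indicator {t. 0 < t \<and> ennreal t < ennreal s} t"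
      by (auto simp: indicator_def ennreal_less_iff)
  qed
  finally show False using fin[of s] by simp
qed

text \<open>
  The supremum need not be attained, for instance when the rearrangement of \<open>f\<close> is constant but
  \<open>|f|\<close> stays strictly below that constant; the bound is approached along partners of the
  truncations of \<open>f\<close>.
\<close>

lemma SUP_equimeasurable:
  fixes f :: "'a::euclidean_space \<Rightarrow> real"
  assumes f[measurable]: "f \<in> borel_measurable lebesgue"
    and w[measurable]: "w \<in> borel_measurable borel" and anti: "antimono_on {0<..} w"
    and fin: "\<And>t. cumulative w (ennreal t) < top"
    and W: "AE x in lborel. W (x::'a) = w (vol_coord x)"
  shows "(SUP h\<in>{h \<in> borel_measurable lebesgue. AE x in lebesgue. spherical_rearr h x = W x}.
      \<integral>\<^sup>+x. ennreal \<bar>f x * h x\<bar> \<partial>lebesgue)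
    = (\<integral>\<^sup>+x. spherical_rearr f x * W x \<partial>lebesgue)"
proof -
  let ?H = "{h \<in> borel_measurable lebesgue. AE x in lebesgue. spherical_rearr h x = W x}"
  have WL: "AE x in lebesgue. W (x::'a) = w (vol_coord x)" using W by (rule AE_completion)
  have rhs: "(\<integral>\<^sup>+x. spherical_rearr f x * W x \<partial>lebesgue) = choquet w f"
  proof -
    have "(\<integral>\<^sup>+x. spherical_rearr f x * W x \<partial>lebesgue) = (\<integral>\<^sup>+x. rearr f (vol_coord (x::'a)) * w (vol_coord x) \<partial>lborel)"
      unfolding nn_integral_completion
      by (rule nn_integral_cong_AE) (use W in \<open>eventually_elim, simp add: spherical_rearr_eq\<close>)
    also have "\<dots> = (\<integral>\<^sup>+s. indicator {0<..} s * (rearr f s * w s) \<partial>lborel)"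
      by (rule nn_integral_vol_coord) measurable
    also have "\<dots> = choquet w f" by (rule nn_integral_rearr_eq_choquet) measurable
    finally show ?thesis .
  qed
  show ?thesis
  proof (rule antisym)
    show "(SUP h\<in>?H. \<integral>\<^sup>+x. ennreal \<bar>f x * h x\<bar> \<partial>lebesgue) \<le> (\<integral>\<^sup>+x. spherical_rearr f x * W x \<partial>lebesgue)"
    proof (rule SUP_least)
      fix h assume "h \<in> ?H"
      then have h[measurable]: "h \<in> borel_measurable lebesgue" and eq: "AE x in lebesgue. spherical_rearr h x = W x" by auto
      have "(\<integral>\<^sup>+x. ennreal \<bar>f x * h x\<bar> \<partial>lebesgue) \<le> (\<integral>\<^sup>+t. indicator {0<..} t * (rearr f t * rearr h t) \<partial>lborel)"
        by (rule Hardy_Littlewood) measurable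
      also have "\<dots> = (\<integral>\<^sup>+x. rearr f (vol_coord (x::'a)) * rearr h (vol_coord x) \<partial>lborel)"
        by (rule nn_integral_vol_coord[symmetric]) measurable
      also have "\<dots> = (\<integral>\<^sup>+x. rearr f (vol_coord (x::'a)) * rearr h (vol_coord x) \<partial>lebesgue)"
        by (simp only: nn_integral_completion)
      also have "\<dots> = (\<integral>\<^sup>+x. spherical_rearr f x * W x \<partial>lebesgue)"
        by (rule nn_integral_cong_AE) (use eq in \<open>eventually_elim, simp add: spherical_rearr_eq\<close>)
      finally show "(\<integral>\<^sup>+x. ennreal \<bar>f x * h x\<bar> \<partial>lebesgue) \<le> (\<integral>\<^sup>+x. spherical_rearr f x * W x \<partial>lebesgue)" .
    qed
    show "(\<integral>\<^sup>+x. spherical_rearr f x * W x \<partial>lebesgue) \<le> (SUP h\<in>?H. \<integral>\<^sup>+x. ennreal \<bar>f x * h x\<bar> \<partial>lebesgue)"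
      unfolding rhs choquet_SUP_dyadic[OF f w]
    proof (rule SUP_least)
      fix k
      let ?F = "dyadic_truncation k f"
      obtain g where g: "g \<in> borel_measurable lebesgue" "\<And>x. 0 < g x"
        "\<And>c. 0 < c \<Longrightarrow> distribution g c < top" "\<And>c. emeasure lebesgue {x. g x = c} = 0"
        "\<And>x y. g x \<le> g y \<Longrightarrow> ?F x \<le> ?F y"
        using dyadic_rank_function[OF f] by blast
      obtain h where h: "h \<in> borel_measurable lebesgue"
        "\<And>t. 0 < t \<Longrightarrow> distribution h t = profile_level w t"
        "choquet w ?F \<le> (\<integral>\<^sup>+x. ennreal \<bar>?F x * h x\<bar> \<partial>lebesgue)"
        using comonotone_partner[OF dyadic_truncation_measurable[OF f] dyadic_truncation_nonneg g w anti
          finite_if_cumulative_finite[OF anti fin]] by blast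
      note [measurable] = h(1)
      have cum: "cumulative (rearr h) m = cumulative w m" for m
        unfolding cumulative_rearr[OF h(1)] cumulative_eq_level_integral[OF w anti] truncated_mass_def
        by (intro nn_integral_cong) (auto simp: indicator_def h(2))
      have "AE s in lborel. 0 < s \<longrightarrow> rearr h s = w s"
        by (rule AE_eq_if_cumulative_eq) (simp_all add: cum fin)
      then have "AE x in lborel. rearr h (vol_coord (x::'a)) = w (vol_coord x)"
        by (rule AE_vol_coord)
      then have "AE x in lebesgue. rearr h (vol_coord (x::'a)) = w (vol_coord x)"
        by (rule AE_completion)
      then have "AE x in lebesgue. spherical_rearr h x = W x"
        using WL by eventually_elim (simp add: spherical_rearr_eq)
      then have mem: "h \<in> ?H" by simp
      have "(\<integral>\<^sup>+x. ennreal \<bar>?F x * h x\<bar> \<partial>lebesgue) \<le> (\<integral>\<^sup>+x. ennreal \<bar>f x * h x\<bar> \<partial>lebesgue)"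
        by (intro nn_integral_mono ennreal_leI)
          (simp add: abs_mult dyadic_truncation_nonneg dyadic_truncation_le mult_right_mono)
      also have "\<dots> \<le> (SUP h\<in>?H. \<integral>\<^sup>+x. ennreal \<bar>f x * h x\<bar> \<partial>lebesgue)"
        by (rule SUP_upper[OF mem])
      finally show "choquet w ?F \<le> (SUP h\<in>?H. \<integral>\<^sup>+x. ennreal \<bar>f x * h x\<bar> \<partial>lebesgue)"
        using h(3) by (rule order_trans[rotated])
    qed
  qed
qed

text \<open>
  Only the existence of a competitor \<open>h\<close> matters, and the duality for one function with a
  positive right-hand side forces it: the supremum of the empty set is \<open>0\<close>.
\<close>

lemma ae_decreasing_if_duality:
  fixes W :: "'a::euclidean_space \<Rightarrow> ennreal"
  assumes u[measurable]: "u \<in> borel_measurable borel"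
    and W: "AE x in lborel. W (x::'a) = u (vol_coord x)"
    and pos: "0 < cumulative u (emeasure lebesgue (ball (0::'a) 1))"
    and dual: "(SUP h\<in>{h \<in> borel_measurable lebesgue. AE x in lebesgue. spherical_rearr h x = W x}.
      \<integral>\<^sup>+x. ennreal \<bar>indicator (ball 0 1) x * h x\<bar> \<partial>lebesgue)
    = (\<integral>\<^sup>+x. spherical_rearr (indicator (ball (0::'a) 1)) x * W x \<partial>lebesgue)"
  obtains w where "antimono_on {0<..} w" "AE s in lborel. 0 < s \<longrightarrow> u s = w s"
proof -
  let ?H = "{h \<in> borel_measurable lebesgue. AE x in lebesgue. spherical_rearr h x = W x}"
  let ?f = "indicator (ball (0::'a) 1) :: 'a \<Rightarrow> real"
  have f[measurable]: "?f \<in> borel_measurable lebesgue" by (rule borel_measurable_indicator) simp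
  have "(\<integral>\<^sup>+x. spherical_rearr ?f x * W x \<partial>lebesgue) = (\<integral>\<^sup>+x. rearr ?f (vol_coord (x::'a)) * u (vol_coord x) \<partial>lborel)"
    unfolding nn_integral_completion
    by (rule nn_integral_cong_AE) (use W in \<open>eventually_elim, simp add: spherical_rearr_eq\<close>)
  also have "\<dots> = (\<integral>\<^sup>+s. indicator {0<..} s * (rearr ?f s * u s) \<partial>lborel)"
    by (rule nn_integral_vol_coord) measurable
  also have "\<dots> = choquet u ?f" by (rule nn_integral_rearr_eq_choquet) measurable
  also have "\<dots> = cumulative u (emeasure lebesgue (ball (0::'a) 1))"
    using choquet_two_step[of "ball (0::'a) 1" "ball 0 1" 1 1 u] by simp
  finally have rhs: "(\<integral>\<^sup>+x. spherical_rearr ?f x * W x \<partial>lebesgue) = cumulative u (emeasure lebesgue (ball (0::'a) 1))" .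
  have "?H \<noteq> {}"
  proof
    assume e: "?H = {}"
    have "0 = (\<integral>\<^sup>+x. spherical_rearr ?f x * W x \<partial>lebesgue)"
      unfolding dual[symmetric] e by (simp add: bot_ennreal)
    then show False using pos unfolding rhs by simp
  qed
  then obtain h where h[measurable]: "h \<in> borel_measurable lebesgue" and eq: "AE x in lebesgue. spherical_rearr h x = W x"
    by blast
  have "AE x in lebesgue. rearr h (vol_coord (x::'a)) = u (vol_coord x)"
    using eq AE_completion[OF W] by eventually_elim (simp add: spherical_rearr_eq)
  then have "AE x in lborel. rearr h (vol_coord (x::'a)) = u (vol_coord x)"
    by (simp add: AE_completion_iff)
  then have "AE s in lborel. 0 < s \<longrightarrow> rearr h s = u s"
    by (rule AE_vol_coordD) measurable
  then have "AE s in lborel. 0 < s \<longrightarrow> u s = rearr h s" by eventually_elim auto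
  moreover have "antimono_on {0<..} (rearr h)"
    using antimonoD[OF rearr_antimono[OF h]] by (auto intro: monotone_onI)
  ultimately show thesis using that by blast
qed

section \<open>The equivalence\<close>

lemma ae_decreasing_iff:
  assumes "AE s in lborel. 0 < s \<longrightarrow> W s = u s"
  shows "ae_decreasing W \<longleftrightarrow> (\<exists>w. antimono_on {0<..} w \<and> (AE s in lborel. 0 < s \<longrightarrow> u s = w s))"
proof
  assume "ae_decreasing W"
  then obtain w where w: "antimono_on {0<..} w" "AE s in lborel. 0 < s \<longrightarrow> W s = w s"
    by (auto simp: ae_decreasing_def AE_completion_iff)
  have "AE s in lborel. 0 < s \<longrightarrow> u s = w s" using w(2) assms by eventually_elim auto
  then show "\<exists>w. antimono_on {0<..} w \<and> (AE s in lborel. 0 < s \<longrightarrow> u s = w s)" using w(1) by blast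
next
  assume "\<exists>w. antimono_on {0<..} w \<and> (AE s in lborel. 0 < s \<longrightarrow> u s = w s)"
  then obtain w where w: "antimono_on {0<..} w" "AE s in lborel. 0 < s \<longrightarrow> u s = w s" by blast
  have "AE s in lborel. 0 < s \<longrightarrow> W s = w s" using w(2) assms by eventually_elim auto
  then show "ae_decreasing W" using w(1) by (auto simp: ae_decreasing_def AE_completion_iff)
qed

lemma cumulative_cong_AE:
  assumes "AE s in lborel. 0 < s \<longrightarrow> u s = w s"
  shows "cumulative u m = cumulative w m"
  unfolding cumulative_def
  by (rule nn_integral_cong_AE) (use assms in \<open>eventually_elim, auto simp: indicator_def\<close>)

text \<open>
  A ball is contained in a compact ball, on which \<open>v\<close> is integrable.
\<close>

lemma weighted_vol_symm_finite:
  fixes v :: "'a::euclidean_space \<Rightarrow> real"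
  assumes v: "weight v" and A: "emeasure lebesgue A < top"
  shows "weighted_vol v (spherical_symm A) < top"
proof -
  let ?r = "root DIM('a) (measure lebesgue A / ball_vol TYPE('a))"
  have "set_integrable lebesgue (cball 0 ?r) v" using v by (simp add: weight_def)
  then have "(\<integral>\<^sup>+x. ennreal (norm (indicator (cball 0 ?r) x *\<^sub>R v x)) \<partial>lebesgue) < \<infinity>"
    unfolding set_integrable_def integrable_iff_bounded by simp
  moreover have "weighted_vol v (spherical_symm A) \<le> (\<integral>\<^sup>+x. ennreal (norm (indicator (cball 0 ?r) x *\<^sub>R v x)) \<partial>lebesgue)"
    unfolding weighted_vol_def
    using v A by (intro nn_integral_mono) (auto simp: spherical_symm_def indicator_def weight_def)
  ultimately show ?thesis by simp
qed

theorem theorem3p16: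
  fixes v :: "real ^ 'n \<Rightarrow> real" and p :: real
  assumes "CARD('n) \<ge> 2"
    and "weight v"
    and "p \<ge> 1"
  defines "a \<equiv> norm_mod_AE lebesgue (Lambda_space p v) (\<lambda>f. enn2real (Lambda_fun p v f))"
    and "b \<equiv> (\<forall>A\<in>sets lebesgue. \<forall>B\<in>sets lebesgue.
               weighted_vol v (spherical_symm (A \<union> B)) + weighted_vol v (spherical_symm (A \<inter> B))
                 \<le> weighted_vol v (spherical_symm A) + weighted_vol v (spherical_symm B))"
    and "c \<equiv> ae_decreasing (sphere_weight v)"
    and "d \<equiv> (\<forall>f :: real ^ 'n \<Rightarrow> real \<in> borel_measurable lebesgue.
               (SUP h\<in>{h \<in> borel_measurable lebesgue. AE x in lebesgue.
                    spherical_rearr h x =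
                      sphere_weight v (ball_vol TYPE(real ^ 'n) * norm x ^ CARD('n))}.
                  \<integral>\<^sup>+x. ennreal \<bar>f x * h x\<bar> \<partial>lebesgue)
                 = (\<integral>\<^sup>+x. spherical_rearr f x *
                      sphere_weight v (ball_vol TYPE(real ^ 'n) * norm x ^ CARD('n)) \<partial>lebesgue))"
  shows "(a \<longleftrightarrow> b) \<and> (b \<longleftrightarrow> c) \<and> (c \<longleftrightarrow> d)"
proof -
  let ?k = "ennreal (polar_factor TYPE(real ^ 'n))"
  let ?W = "\<lambda>x :: real ^ 'n. sphere_weight v (ball_vol TYPE(real ^ 'n) * norm x ^ CARD('n))"
  have k: "0 < ?k" "?k < top" using polar_factor_pos[where 'a="real ^ 'n"] by simp_all
  obtain u where u[measurable]: "u \<in> borel_measurable borel"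
    and uv: "AE s in lborel. 0 < s \<longrightarrow> sphere_weight v s = u s"
    and polar: "\<And>G. G \<in> borel_measurable borel \<Longrightarrow> (\<integral>\<^sup>+x. G (vol_coord (x :: real ^ 'n)) * ennreal (v x) \<partial>lborel)
      = ?k * (\<integral>\<^sup>+s. indicator {0<..} s * (G s * u s) \<partial>lborel)"
    using weight_profile[OF \<open>weight v\<close>] by blast
  have V: "weighted_vol v (spherical_symm A) = ?k * cumulative u (emeasure lebesgue A)" for A
    by (rule weighted_vol_symm_eq) (rule polar)
  have pos: "0 < cumulative u (emeasure lebesgue A)" if "A \<in> sets lebesgue" "0 < emeasure lebesgue A" for A :: "(real ^ 'n) set"
  proof -
    have "0 < weighted_vol v (spherical_symm A)" using \<open>weight v\<close> that by (simp add: weight_def)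
    then show ?thesis unfolding V by (auto simp: zero_less_iff_neq_zero)
  qed
  have V_fin: "?k * cumulative u m < top" if "m < top" for m
  proof -
    obtain t where t: "0 \<le> t" "m = ennreal t" using \<open>m < top\<close> by (cases m) auto
    have "emeasure lebesgue {y :: real ^ 'n. vol_coord y \<in> {..<t}} = emeasure lborel ({0<..} \<inter> {..<t})"
      by (rule emeasure_vol_coord) simp
    also have "{0<..} \<inter> {..<t} = {0<..<t}" by auto
    finally have e: "emeasure lebesgue {y :: real ^ 'n. vol_coord y \<in> {..<t}} = m" using t by simp
    show ?thesis
      using weighted_vol_symm_finite[OF \<open>weight v\<close>, of "{y. vol_coord y \<in> {..<t}}"] \<open>m < top\<close> unfolding V e .
  qed
  have fin: "cumulative u (ennreal t) < top" for t
    using V_fin[of "ennreal t"] k by (auto simp: ennreal_mult_less_top)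
  have Lam: "Lambda_fun p v f = ennpowr (?k * choquet u (\<lambda>x. \<bar>f x\<bar> powr p)) (1 / p)" if "f \<in> borel_measurable lebesgue" for f
    using \<open>p \<ge> 1\<close> by (intro Lambda_fun_eq_choquet polar that u) auto
  have c_iff: "c \<longleftrightarrow> (\<exists>w. antimono_on {0<..} w \<and> (AE s in lborel. 0 < s \<longrightarrow> u s = w s))"
    unfolding c_def by (rule ae_decreasing_iff[OF uv])
  have W: "AE x in lborel. ?W x = u (vol_coord x)"
    using AE_vol_coord[OF uv, where 'a="real ^ 'n"] by (simp add: vol_coord_def)
  \<comment> \<open>A decreasing representative is Borel measurable once it is set to 0 off the positive half-line.\<close>
  have decreasing: thesis
    if c and step: "\<And>w. w \<in> borel_measurable borel \<Longrightarrow> antimono_on {0<..} w \<Longrightarrow> AE s in lborel. 0 < s \<longrightarrow> u s = w s \<Longrightarrow> thesis"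
    for thesis
  proof -
    obtain w where w: "antimono_on {0<..} w" "AE s in lborel. 0 < s \<longrightarrow> u s = w s" using \<open>c\<close> c_iff by blast
    show thesis
    proof (rule step)
      show "(\<lambda>s. w s * indicator {0<..} s) \<in> borel_measurable borel"
        by (rule antimono_on_borel_measurable[OF w(1)])
      show "antimono_on {0<..} (\<lambda>s. w s * indicator {0<..} s)"
        using monotone_onD[OF w(1)] by (intro monotone_onI) auto
      show "AE s in lborel. 0 < s \<longrightarrow> u s = w s * indicator {0<..} s"
        using w(2) by eventually_elim auto
    qed
  qed
  have "a \<Longrightarrow> b"
    unfolding a_def b_def V
    using submodular_if_norm[OF \<open>p \<ge> 1\<close> Lam V_fin] by blast
  moreover have "b \<Longrightarrow> c"
  proof -
    assume b
    then have bb: "?k * cumulative u (emeasure lebesgue (A \<union> B)) + ?k * cumulative u (emeasure lebesgue (A \<inter> B))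
        \<le> ?k * cumulative u (emeasure lebesgue A) + ?k * cumulative u (emeasure lebesgue B)"
      if "A \<in> sets lebesgue" "B \<in> sets lebesgue" for A B :: "(real ^ 'n) set"
      using that unfolding b_def V by blast
    obtain w where "antimono_on {0<..} w" "AE s in lborel. 0 < s \<longrightarrow> u s = w s"
      using ae_decreasing_if_submodular[OF u fin radial_submodular[OF k bb]] by blast
    then show c unfolding c_iff by blast
  qed
  moreover have "c \<Longrightarrow> a"
  proof -
    assume c
    then show a
    proof (rule decreasing)
      fix w assume w: "w \<in> borel_measurable borel" "antimono_on {0<..} w" "AE s in lborel. 0 < s \<longrightarrow> u s = w s"
      have eq: "choquet u f = choquet w f" for f :: "real ^ 'n \<Rightarrow> real"
        unfolding choquet_def cumulative_cong_AE[OF w(3)] ..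
      show a
        unfolding a_def
      proof (rule norm_if_choquet_subadditive[OF \<open>p \<ge> 1\<close> k Lam pos])
        show "choquet u (\<lambda>x. f x + g x) \<le> choquet u f + choquet u g"
          if "f \<in> borel_measurable lebesgue" "g \<in> borel_measurable lebesgue" for f g :: "real ^ 'n \<Rightarrow> real"
          unfolding eq by (rule choquet_subadditive[OF w(1) that w(2)])
      qed
    qed
  qed
  moreover have "c \<Longrightarrow> d"
  proof -
    assume c
    then show d
    proof (rule decreasing)
      fix w assume w: "w \<in> borel_measurable borel" "antimono_on {0<..} w" "AE s in lborel. 0 < s \<longrightarrow> u s = w s"
      have "AE x in lborel. ?W x = w (vol_coord x)"
        using W AE_vol_coord[OF w(3), where 'a="real ^ 'n"] by eventually_elim simp
      moreover have "cumulative w (ennreal t) < top" for t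
        using fin[of t] by (simp only: cumulative_cong_AE[OF w(3)])
      ultimately show d
        unfolding d_def by (intro ballI SUP_equimeasurable[OF _ w(1,2), where W="?W"])
    qed
  qed
  moreover have "d \<Longrightarrow> c"
  proof -
    assume d
    have ball: "ball (0 :: real ^ 'n) 1 \<in> sets lebesgue" "0 < emeasure lebesgue (ball (0 :: real ^ 'n) 1)"
      using ball_vol_pos[where 'a="real ^ 'n"] emeasure_ball0[of 1, where 'a="real ^ 'n"]
      by (simp_all add: emeasure_completion)
    have "(indicator (ball 0 1) :: real ^ 'n \<Rightarrow> real) \<in> borel_measurable lebesgue"
      by (rule borel_measurable_indicator) simp
    with \<open>d\<close> have dual: "(SUP h\<in>{h \<in> borel_measurable lebesgue. AE x in lebesgue. spherical_rearr h x = ?W x}.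
        \<integral>\<^sup>+x. ennreal \<bar>indicator (ball 0 1) x * h x\<bar> \<partial>lebesgue)
      = (\<integral>\<^sup>+x. spherical_rearr (indicator (ball 0 1)) x * ?W x \<partial>lebesgue)"
      unfolding d_def by (rule bspec)
    show c unfolding c_iff
      using ae_decreasing_if_duality[OF u W pos[OF ball] dual] by blast
  qed
  ultimately show ?thesis by blast
qed

end
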